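(* Let $M$ be a closed connected manifold and let $f : M \to M$ be a partially hyperbolic diffeomorphism. Then every compact center-stable submanifold $S \subset M$ is periodic, i.e. there is an integer $k \ge 1$ such that $f^k(S) = S$.
   Context: $M$ is equipped with a Riemannian metric. A diffeomorphism $f$ of a closed connected manifold $M$ is (strongly) partially hyperbolic if there is a splitting $TM = E^s \oplus E^c \oplus E^u$ such that each subbundle is non-zero and invariant under the derivative $Df$ and $\|Df v^s\| < \|Df v^c\| < \|Df v^u\|$ and $\|Df v^s\| < 1 < \|Df v^u\|$ hold for all $x \in M$ and unit vectors $v^s \in E^s(x)$, $v^c \in E^c(x)$, $v^u \in E^u(x)$. Write $E^{cs} = E^c \oplus E^s$. An immersed ($C^1$) submanifold $S \subset M$ is a center-stable submanifold if it is tangent to $E^{cs}$, i.e. $T_xS = E^{cs}(x)$ for all $x\in S$. Immersed submanifolds are injectively immersed and have no boundary (so a compact one is embedded). *)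

theory Defs
  imports "HOL-Analysis.Analysis" "HOL-Library.Extended_Nat" "HOL-Library.Function_Algebras"
begin

section \<open>Functions as a real vector space\<close>

instantiation "fun" :: (type, scaleR) scaleR
begin
definition scaleR_fun :: "real \<Rightarrow> ('a \<Rightarrow> 'b) \<Rightarrow> 'a \<Rightarrow> 'b"
  where "scaleR_fun r f = (\<lambda>x. r *\<^sub>R f x)"
instance ..
end

instance "fun" :: (type, real_vector) real_vector
  by standard (simp_all add: scaleR_fun_def plus_fun_def fun_eq_iff scaleR_add_right scaleR_add_left)

section \<open>Functions of class C^r between Euclidean spaces\<close>

text \<open>\<open>Ck n f S\<close> is meant for open \<open>S\<close>: all iterated directional derivatives of \<open>f\<close> of
  order up to \<open>n\<close> exist and are continuous on \<open>S\<close>.\<close>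

primrec Ck :: "nat \<Rightarrow> ('a::euclidean_space \<Rightarrow> 'b::real_normed_vector) \<Rightarrow> 'a set \<Rightarrow> bool" where
  "Ck 0 f S \<longleftrightarrow> continuous_on S f"
| "Ck (Suc n) f S \<longleftrightarrow> (\<forall>x\<in>S. f differentiable (at x)) \<and>
     (\<forall>v. Ck n (\<lambda>x. frechet_derivative f (at x) v) S)"

definition Cr_on :: "enat \<Rightarrow> ('a::euclidean_space \<Rightarrow> 'b::real_normed_vector) \<Rightarrow> 'a set \<Rightarrow> bool" where
  "Cr_on r f S \<longleftrightarrow> (\<forall>n. enat n \<le> r \<longrightarrow> Ck n f S)"

section \<open>Manifolds without boundary\<close>

text \<open>A chart is its domain together with a coordinate map, whose values outside the domain are
  irrelevant.\<close>

type_synonym ('m, 'e) chart = "'m set \<times> ('m \<Rightarrow> 'e)"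

definition chart_inv :: "('m, 'e) chart \<Rightarrow> 'e \<Rightarrow> 'm" where
  "chart_inv c = inv_into (fst c) (snd c)"

definition manifold :: "enat \<Rightarrow> 'm topology \<Rightarrow> ('m, 'e::euclidean_space) chart set \<Rightarrow> bool" where
  "manifold r X A \<longleftrightarrow>
     Hausdorff_space X \<and> second_countable X \<and>
     (\<Union>c\<in>A. fst c) = topspace X \<and>
     (\<forall>c\<in>A. openin X (fst c) \<and> open (snd c ` fst c) \<and>
        homeomorphic_map (subtopology X (fst c)) (top_of_set (snd c ` fst c)) (snd c)) \<and>
     (\<forall>c\<in>A. \<forall>d\<in>A. Cr_on r (snd d \<circ> chart_inv c) (snd c ` (fst c \<inter> fst d)))"

definition closed_connected_manifold :: "'m topology \<Rightarrow> ('m, 'e::euclidean_space) chart set \<Rightarrow> bool" where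
  "closed_connected_manifold X A \<longleftrightarrow> manifold \<infinity> X A \<and> compact_space X \<and> connected_space X"

definition Cr_map :: "enat \<Rightarrow> 'm topology \<Rightarrow> ('m, 'e::euclidean_space) chart set \<Rightarrow>
    'n topology \<Rightarrow> ('n, 'd::euclidean_space) chart set \<Rightarrow> ('m \<Rightarrow> 'n) \<Rightarrow> bool" where
  "Cr_map r X A Y B f \<longleftrightarrow> continuous_map X Y f \<and>
     (\<forall>c\<in>A. \<forall>d\<in>B. Cr_on r (snd d \<circ> f \<circ> chart_inv c) (snd c ` {x \<in> fst c. f x \<in> fst d}))"

definition diffeomorphism :: "'m topology \<Rightarrow> ('m, 'e::euclidean_space) chart set \<Rightarrow> ('m \<Rightarrow> 'm) \<Rightarrow> bool" where
  "diffeomorphism X A f \<longleftrightarrow> bij_betw f (topspace X) (topspace X) \<and>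
     Cr_map 1 X A X A f \<and> Cr_map 1 X A X A (inv_into (topspace X) f)"

section \<open>Tangent vectors\<close>

text \<open>A tangent vector at \<open>x\<close> is the family of its coordinate vectors in all charts of the atlas
  around \<open>x\<close>, related by the derivatives of the transition maps. The entries at
  the remaining charts are set to 0, so that the tangent space is a linear subspace of the space of
  all families.\<close>

type_synonym ('m, 'e) tvec = "('m, 'e) chart \<Rightarrow> 'e"

definition charts_at :: "('m, 'e) chart set \<Rightarrow> 'm \<Rightarrow> ('m, 'e) chart set" where
  "charts_at A x = {c \<in> A. x \<in> fst c}"

definition tangent_space :: "('m, 'e::euclidean_space) chart set \<Rightarrow> 'm \<Rightarrow> ('m, 'e) tvec set" where
  "tangent_space A x = {v. (\<forall>c. c \<notin> charts_at A x \<longrightarrow> v c = 0) \<and>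
     (\<forall>c\<in>charts_at A x. \<forall>d\<in>charts_at A x.
        v d = frechet_derivative (snd d \<circ> chart_inv c) (at (snd c x)) (v c))}"

text \<open>The tangent vector at \<open>x\<close> with coordinate vector \<open>a\<close> in the chart \<open>c\<close>.\<close>

definition coord_vec :: "('m, 'e::euclidean_space) chart set \<Rightarrow> ('m, 'e) chart \<Rightarrow> 'm \<Rightarrow> 'e \<Rightarrow> ('m, 'e) tvec" where
  "coord_vec A c x a = (\<lambda>d. if d \<in> charts_at A x
     then frechet_derivative (snd d \<circ> chart_inv c) (at (snd c x)) a else 0)"

text \<open>The derivative \<open>T\<^sub>xM \<rightarrow> T\<^bsub>f(x)\<^esub>N\<close>; by the chain rule it does not depend on the chart
  chosen around \<open>x\<close>.\<close>

definition tangent_map :: "('m, 'e::euclidean_space) chart set \<Rightarrow> ('n, 'd::euclidean_space) chart set \<Rightarrow>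
    ('m \<Rightarrow> 'n) \<Rightarrow> 'm \<Rightarrow> ('m, 'e) tvec \<Rightarrow> ('n, 'd) tvec" where
  "tangent_map A B f x v = (\<lambda>d. if d \<in> charts_at B (f x)
     then let c = (SOME c. c \<in> charts_at A x)
          in frechet_derivative (snd d \<circ> f \<circ> chart_inv c) (at (snd c x)) (v c)
     else 0)"

definition riemannian_metric :: "'m topology \<Rightarrow> ('m, 'e::euclidean_space) chart set \<Rightarrow>
    ('m \<Rightarrow> ('m, 'e) tvec \<Rightarrow> ('m, 'e) tvec \<Rightarrow> real) \<Rightarrow> bool" where
  "riemannian_metric X A g \<longleftrightarrow>
     (\<forall>x\<in>topspace X. \<forall>u\<in>tangent_space A x. \<forall>v\<in>tangent_space A x.
        g x u v = g x v u \<and> (u \<noteq> 0 \<longrightarrow> g x u u > 0) \<and>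
        (\<forall>w\<in>tangent_space A x. \<forall>a b. g x (a *\<^sub>R u + b *\<^sub>R v) w = a * g x u w + b * g x v w)) \<and>
     (\<forall>c\<in>A. \<forall>a b. Cr_on \<infinity>
        (\<lambda>y. let x = chart_inv c y in g x (coord_vec A c x a) (coord_vec A c x b)) (snd c ` fst c))"

definition tnorm :: "('m \<Rightarrow> ('m, 'e) tvec \<Rightarrow> ('m, 'e) tvec \<Rightarrow> real) \<Rightarrow> 'm \<Rightarrow> ('m, 'e) tvec \<Rightarrow> real" where
  "tnorm g x v = sqrt (g x v v)"

text \<open>Continuous subbundles of rank \<open>k\<close> of the tangent bundle: locally spanned by a continuous frame
  of \<open>k\<close> independent vector fields.\<close>

definition subbundle :: "'m topology \<Rightarrow> ('m, 'e::euclidean_space) chart set \<Rightarrow> nat \<Rightarrow>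
    ('m \<Rightarrow> ('m, 'e) tvec set) \<Rightarrow> bool" where
  "subbundle X A k E \<longleftrightarrow>
     (\<forall>x\<in>topspace X. subspace (E x) \<and> E x \<subseteq> tangent_space A x) \<and>
     (\<forall>x0\<in>topspace X. \<exists>U b. openin X U \<and> x0 \<in> U \<and>
        (\<forall>x\<in>U. inj_on (\<lambda>i::nat. b i x) {..<k} \<and> independent ((\<lambda>i. b i x) ` {..<k}) \<and>
           span ((\<lambda>i. b i x) ` {..<k}) = E x) \<and>
        (\<forall>i<k. \<forall>c\<in>A. continuous_map (subtopology X (U \<inter> fst c)) euclidean (\<lambda>x. b i x c)))"

section \<open>Partial hyperbolicity and center-stable submanifolds\<close>

definition splitting :: "'m topology \<Rightarrow> ('m, 'e::euclidean_space) chart set \<Rightarrow>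
    ('m \<Rightarrow> ('m, 'e) tvec set) \<Rightarrow> ('m \<Rightarrow> ('m, 'e) tvec set) \<Rightarrow> ('m \<Rightarrow> ('m, 'e) tvec set) \<Rightarrow> bool" where
  "splitting X A Es Ec Eu \<longleftrightarrow>
     (\<forall>x\<in>topspace X. \<forall>v\<in>tangent_space A x.
        \<exists>!(a, b, c). a \<in> Es x \<and> b \<in> Ec x \<and> c \<in> Eu x \<and> v = a + b + c)"

definition partially_hyperbolic :: "'m topology \<Rightarrow> ('m, 'e::euclidean_space) chart set \<Rightarrow>
    ('m \<Rightarrow> ('m, 'e) tvec \<Rightarrow> ('m, 'e) tvec \<Rightarrow> real) \<Rightarrow> ('m \<Rightarrow> 'm) \<Rightarrow>
    ('m \<Rightarrow> ('m, 'e) tvec set) \<Rightarrow> ('m \<Rightarrow> ('m, 'e) tvec set) \<Rightarrow> ('m \<Rightarrow> ('m, 'e) tvec set) \<Rightarrow> bool" where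
  "partially_hyperbolic X A g f Es Ec Eu \<longleftrightarrow>
     diffeomorphism X A f \<and> splitting X A Es Ec Eu \<and>
     (\<forall>E\<in>{Es, Ec, Eu}. (\<exists>k\<ge>1. subbundle X A k E) \<and>
        (\<forall>x\<in>topspace X. tangent_map A A f x ` E x = E (f x))) \<and>
     (\<forall>x\<in>topspace X. \<forall>vs\<in>Es x. \<forall>vc\<in>Ec x. \<forall>vu\<in>Eu x.
        tnorm g x vs = 1 \<and> tnorm g x vc = 1 \<and> tnorm g x vu = 1 \<longrightarrow>
        (let n = (\<lambda>v. tnorm g (f x) (tangent_map A A f x v))
         in n vs < n vc \<and> n vc < n vu \<and> n vs < 1 \<and> 1 < n vu))"

definition bundle_sum :: "('m \<Rightarrow> ('m, 'e::euclidean_space) tvec set) \<Rightarrow> ('m \<Rightarrow> ('m, 'e) tvec set) \<Rightarrow>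
    'm \<Rightarrow> ('m, 'e) tvec set" where
  "bundle_sum E F x = {a + b |a b. a \<in> E x \<and> b \<in> F x}"

text \<open>An injectively immersed \<open>C\<^sup>1\<close> submanifold without boundary: a subset \<open>topspace Y\<close> with a manifold
  structure of its own, given by a topology \<open>Y\<close> that may be finer than the subspace topology and an
  atlas \<open>B\<close>, such that the inclusion is an immersion.\<close>

definition immersed_submanifold :: "'m topology \<Rightarrow> ('m, 'e::euclidean_space) chart set \<Rightarrow>
    'm topology \<Rightarrow> ('m, 'd::euclidean_space) chart set \<Rightarrow> bool" where
  "immersed_submanifold X A Y B \<longleftrightarrow>
     manifold 1 Y B \<and> topspace Y \<subseteq> topspace X \<and> Cr_map 1 Y B X A (\<lambda>x. x) \<and>
     (\<forall>x\<in>topspace Y. inj_on (tangent_map B A (\<lambda>x. x) x) (tangent_space B x))"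

definition center_stable_submanifold :: "'m topology \<Rightarrow> ('m, 'e::euclidean_space) chart set \<Rightarrow>
    ('m \<Rightarrow> ('m, 'e) tvec set) \<Rightarrow> ('m \<Rightarrow> ('m, 'e) tvec set) \<Rightarrow>
    'm topology \<Rightarrow> ('m, 'd::euclidean_space) chart set \<Rightarrow> bool" where
  "center_stable_submanifold X A Es Ec Y B \<longleftrightarrow>
     immersed_submanifold X A Y B \<and>
     (\<forall>x\<in>topspace Y. tangent_map B A (\<lambda>x. x) x ` tangent_space B x = bundle_sum Ec Es x)"

end

theory Submission
  imports Defs
begin

text \<open>Let \<open>G\<close> be the inverse of \<open>f\<close>, and use a metric in which the unstable bundle is orthogonal to the
  center-stable one. If \<open>T\<close> is compact and tangent to the center-stable bundle, and \<open>x\<close> is close to \<open>T\<close>, then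
  the displacement from \<open>x\<close> to a nearest point of \<open>T\<close> is orthogonal to the center-stable bundle, hence almost
  unstable, so \<open>G\<close> brings \<open>x\<close> closer to \<open>T\<close> by a uniform factor; no invariant manifolds are needed.

  By total boundedness, infinitely many of the iterates of \<open>S\<close>, say those with exponents
  \<open>n\<^sub>1 < n\<^sub>2 < \<dots>\<close>, are pairwise close. For large \<open>j\<close>, applying \<open>G\<close> \<open>n\<^sub>j\<close> times to iterates number \<open>n\<^sub>1\<close>, \<open>n\<^sub>2\<close>
  and \<open>n\<^sub>j\<close> yields three sets that are arbitrarily close to each other; the third is \<open>S\<close> itself, and the
  second is the image of the first under the iterate of \<open>f\<close> with exponent \<open>k = n\<^sub>2 - n\<^sub>1\<close>. In the limit this iterate maps
  \<open>S\<close> onto itself.\<close>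

section \<open>Calculus in Euclidean spaces\<close>

text \<open>The contraction constants must not depend on the set: every backward step compares with
  a new image of \<open>T\<close> under \<open>G\<close>, whose curvature is uncontrolled. They can
  be uniform because only the tangent plane at the nearest point enters, through the first variation
  of the squared distance. Orthogonality is indispensable there: \<open>G\<close> expands stable
  vectors, so the displacement must lose its center-stable component in the limit. Hyperbolicity is
  a pointwise strict inequality; compactness turns it into a uniform factor. The obstacle is that
  the splitting, hence the adapted metric, is only continuous. No global distance is built from it;
  instead, displacements are measured in finitely many coordinate balls, with the metric frozen at
  the first point. The result need not be symmetric, continuous in the first point, or subject to a
  triangle inequality. This does no harm: limits are taken along subsequences with a constant ball,
  and successive approximations are combined by passing to limits.\<close>

lemma Cr_on_has_derivative:
  assumes "Cr_on r h U" "1 \<le> r" "x \<in> U"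
  shows "(h has_derivative frechet_derivative h (at x)) (at x)"
proof -
  have "Ck (Suc 0) h U" using assms(1,2) unfolding Cr_on_def by (auto simp: one_enat_def)
  then show ?thesis using assms(3) frechet_derivative_works by auto
qed

lemma Cr_on_continuous_derivative:
  assumes "Cr_on r h U" "1 \<le> r"
  shows "continuous_on U (\<lambda>x. frechet_derivative h (at x) v)"
proof -
  have "Ck (Suc 0) h U" using assms(1,2) unfolding Cr_on_def by (auto simp: one_enat_def)
  then show ?thesis by auto
qed

lemma Cr_on_continuous: "Cr_on r h U \<Longrightarrow> continuous_on U h"
  unfolding Cr_on_def by (metis Ck.simps(1) i0_lb zero_enat_def)

lemma linear_eq_sum_Basis:
  fixes L :: "'a::euclidean_space \<Rightarrow> 'b::real_vector"
  assumes "linear L"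
  shows "L v = (\<Sum>b\<in>Basis. (v \<bullet> b) *\<^sub>R L b)"
  by (metis (no_types, lifting) assms euclidean_representation linear_scale linear_sum sum.cong)

lemma linear_norm_le_sum_Basis:
  fixes L :: "'a::euclidean_space \<Rightarrow> 'b::real_normed_vector"
  assumes "linear L"
  shows "norm (L v) \<le> (\<Sum>b\<in>Basis. norm (L b)) * norm v"
proof -
  have "L v = (\<Sum>b\<in>Basis. (v \<bullet> b) *\<^sub>R L b)" by (rule linear_eq_sum_Basis[OF assms])
  also have "norm \<dots> \<le> (\<Sum>b\<in>Basis. norm (L b) * norm v)"
    by (rule sum_norm_le) (simp add: mult.commute[of _ "norm (L _)"] mult_left_mono Basis_le_norm)
  finally show ?thesis by (simp add: sum_distrib_right)
qed

text \<open>Strict differentiability: since the base points \<open>a i\<close> move as well,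
  differentiability at \<open>p\<close> alone would not do. The mean value inequality for
  \<open>h\<close> minus its derivative at \<open>p\<close> gives it, that difference having small
  derivative near \<open>p\<close>. It yields the limit of difference quotients of \<open>G\<close>
  in charts.\<close>

lemma C1_difference_quotient_tendsto:
  fixes h :: "'a::euclidean_space \<Rightarrow> 'b::euclidean_space"
  assumes h: "Cr_on r h U" "1 \<le> r" and U: "open U" "p \<in> U"
    and a: "a \<longlonglongrightarrow> p" and t: "t \<longlonglongrightarrow> 0" "\<And>i. t i > 0" and v: "v \<longlonglongrightarrow> v0"
  shows "(\<lambda>i. (h (a i + t i *\<^sub>R v i) - h (a i)) /\<^sub>R t i) \<longlonglongrightarrow> frechet_derivative h (at p) v0"
proof -
  define L where "L x = frechet_derivative h (at x)" for x
  have L: "(h has_derivative L x) (at x)" if "x \<in> U" for x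
    using Cr_on_has_derivative[OF h that] by (simp add: L_def)
  have lin: "linear (L x)" if "x \<in> U" for x using L[OF that] has_derivative_linear by blast
  \<comment> \<open>\<open>Ck\<close> gives continuity of the derivative one direction at a time;
    the sum over \<open>Basis\<close> bounds the operator norm of the difference.\<close>
  have "continuous_on U (\<lambda>x. \<Sum>b\<in>Basis. norm (L x b - L p b))"
    unfolding L_def by (intro continuous_intros Cr_on_continuous_derivative[OF h])
  then have "((\<lambda>x. \<Sum>b\<in>Basis. norm (L x b - L p b)) \<longlongrightarrow> (\<Sum>b\<in>Basis. norm (L p b - L p b))) (at p within U)"
    using U(2) unfolding continuous_on_def by blast
  then have lim: "((\<lambda>x. \<Sum>b\<in>Basis. norm (L x b - L p b)) \<longlongrightarrow> 0) (nhds p)"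
    using tendsto_at_iff_tendsto_nhds[of "\<lambda>x. \<Sum>b\<in>Basis. norm (L x b - L p b)" p]
    by (simp add: at_within_open[OF U(2,1)])
  have e: "(\<lambda>i. ((h (a i + t i *\<^sub>R v i) - h (a i)) /\<^sub>R t i) - L p (v i)) \<longlonglongrightarrow> 0"
  proof (rule LIMSEQ_I)
    fix e :: real assume "e > 0"
    obtain K where K: "K > 0" "\<And>i. norm (v i) \<le> K"
      using convergent_imp_Bseq[OF convergentI[OF v]] unfolding Bseq_def by blast
    define e1 where "e1 = e / (2 * K)"
    have "e1 > 0" using \<open>e > 0\<close> K by (simp add: e1_def)
    then have "\<forall>\<^sub>F x in nhds p. (\<Sum>b\<in>Basis. norm (L x b - L p b)) < e1"
      using order_tendstoD(2)[OF lim] by blast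
    moreover have "\<forall>\<^sub>F x in nhds p. x \<in> U" using U eventually_nhds_in_open by blast
    ultimately have "\<forall>\<^sub>F x in nhds p. x \<in> U \<and> (\<Sum>b\<in>Basis. norm (L x b - L p b)) < e1"
      by eventually_elim auto
    then obtain d where d: "d > 0"
        "\<And>x. dist x p < d \<Longrightarrow> x \<in> U \<and> (\<Sum>b\<in>Basis. norm (L x b - L p b)) < e1"
      unfolding eventually_nhds_metric by blast
    have bound: "norm ((h y - L p y) - (h x - L p x)) \<le> e1 * norm (y - x)"
      if "x \<in> ball p d" "y \<in> ball p d" for x y
    proof (rule differentiable_bound[where f'="\<lambda>x y. L x y - L p y"])
      show "convex (ball p d)" by simp
      fix z assume z: "z \<in> ball p d"
      then have zU: "z \<in> U" using d by (simp add: dist_commute)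
      have "bounded_linear (L p)" using L U(2) has_derivative_bounded_linear by blast
      then have "(L p has_derivative L p) (at z)" by (rule bounded_linear_imp_has_derivative)
      then show "((\<lambda>x. h x - L p x) has_derivative (\<lambda>y. L z y - L p y)) (at z within ball p d)"
        using L[OF zU] by (intro has_derivative_at_withinI[OF has_derivative_diff])
      have "norm (L z y - L p y) \<le> e1 * norm y" for y
      proof -
        have "linear (\<lambda>y. L z y - L p y)" using lin[OF zU] lin[OF U(2)] linear_compose_sub by blast
        from linear_norm_le_sum_Basis[OF this, of y]
        show ?thesis using d(2)[of z] z
          by (smt (verit) dist_commute mem_ball mult_right_mono norm_ge_zero)
      qed
      then show "onorm (\<lambda>y. L z y - L p y) \<le> e1" by (rule onorm_le)
    qed (use that in auto)
    have "(\<lambda>i. a i + t i *\<^sub>R v i) \<longlonglongrightarrow> p + 0 *\<^sub>R v0" by (intro tendsto_intros a t v)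
    then have "\<forall>\<^sub>F i in sequentially. dist (a i + t i *\<^sub>R v i) p < d"
      using d(1) by (intro tendstoD) auto
    moreover have "\<forall>\<^sub>F i in sequentially. dist (a i) p < d" using a d(1) tendstoD by blast
    ultimately have "\<forall>\<^sub>F i in sequentially. norm (((h (a i + t i *\<^sub>R v i) - h (a i)) /\<^sub>R t i) - L p (v i) - 0) < e"
    proof eventually_elim
      case (elim i)
      let ?y = "a i + t i *\<^sub>R v i"
      have "norm ((h ?y - L p ?y) - (h (a i) - L p (a i))) \<le> e1 * norm (?y - a i)"
        using elim by (intro bound) (auto simp: dist_commute)
      also have "norm (?y - a i) = t i * norm (v i)" using t(2)[of i] by simp
      also have "(h ?y - L p ?y) - (h (a i) - L p (a i)) = t i *\<^sub>R (((h ?y - h (a i)) /\<^sub>R t i) - L p (v i))"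
        using t(2)[of i] lin[OF U(2)]
        by (simp add: linear_add linear_scale scaleR_diff_right algebra_simps)
      finally have "t i * norm (((h ?y - h (a i)) /\<^sub>R t i) - L p (v i)) \<le> t i * (e1 * norm (v i))"
        using t(2)[of i] by (simp add: mult.left_commute)
      then have "norm (((h ?y - h (a i)) /\<^sub>R t i) - L p (v i)) \<le> e1 * norm (v i)"
        using t(2)[of i] by simp
      also have "\<dots> \<le> e1 * K" using K(2) \<open>e1 > 0\<close> by (intro mult_left_mono) auto
      also have "\<dots> < e" using K(1) \<open>e > 0\<close> by (simp add: e1_def)
      finally show ?case by simp
    qed
    then show "\<exists>no. \<forall>n\<ge>no. norm (((h (a n + t n *\<^sub>R v n) - h (a n)) /\<^sub>R t n) - L p (v n) - 0) < e"
      by (simp add: eventually_sequentially)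
  qed
  have "bounded_linear (L p)" using L U(2) has_derivative_bounded_linear by blast
  then have "(\<lambda>i. L p (v i)) \<longlonglongrightarrow> L p v0" using v by (rule bounded_linear.tendsto)
  from tendsto_add[OF e this] show ?thesis by (simp add: L_def)
qed

text \<open>An unbounded summand, rescaled to norm 1, would subconverge to a common unit vector of \<open>E'\<close>
  and \<open>F'\<close>.\<close>

lemma complementary_summands_tendsto:
  fixes b c :: "nat \<Rightarrow> 'a::euclidean_space"
  assumes E: "\<And>i. subspace (E i)" and F: "\<And>i. subspace (F i)"
    and E': "subspace E'" and F': "subspace F'" and EF: "E' \<inter> F' \<subseteq> {0}"
    and clE: "\<And>r a l. strict_mono (r::nat\<Rightarrow>nat) \<Longrightarrow> (\<And>i. a i \<in> E (r i)) \<Longrightarrow> a \<longlonglongrightarrow> l \<Longrightarrow> l \<in> E'"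
    and clF: "\<And>r a l. strict_mono (r::nat\<Rightarrow>nat) \<Longrightarrow> (\<And>i. a i \<in> F (r i)) \<Longrightarrow> a \<longlonglongrightarrow> l \<Longrightarrow> l \<in> F'"
    and b: "\<And>i. b i \<in> E i" and c: "\<And>i. c i \<in> F i"
    and lim: "(\<lambda>i. b i + c i) \<longlonglongrightarrow> l"
  shows "\<exists>b0\<in>E'. \<exists>c0\<in>F'. b0 + c0 = l \<and> b \<longlonglongrightarrow> b0 \<and> c \<longlonglongrightarrow> c0"
proof -
  \<comment> \<open>Stated for arbitrary subsequences and summands, as it is applied to the rescaled
    summands, to the given ones, and to a subsequence kept away from \<open>b0\<close>.\<close>
  have subseq: "\<exists>b0 c0 r'. b0 \<in> E' \<and> c0 \<in> F' \<and> b0 + c0 = l' \<and> strict_mono (r'::nat\<Rightarrow>nat) \<and> (b' \<circ> r') \<longlonglongrightarrow> b0"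
    if r: "strict_mono (r::nat\<Rightarrow>nat)" and b': "\<And>i. b' i \<in> E (r i)" and c': "\<And>i. c' i \<in> F (r i)"
      and l': "(\<lambda>i. b' i + c' i) \<longlonglongrightarrow> l'" and bdd: "bounded (range b')" for r b' c' l'
  proof -
    obtain b0 r' where r': "strict_mono (r'::nat\<Rightarrow>nat)" "(b' \<circ> r') \<longlonglongrightarrow> b0"
      using bounded_imp_convergent_subsequence[OF bdd] by blast
    have "(\<lambda>i. b' (r' i) + c' (r' i)) \<longlonglongrightarrow> l'" using LIMSEQ_subseq_LIMSEQ[OF l' r'(1)] by (simp add: o_def)
    from tendsto_diff[OF this r'(2)] have c0: "(c' \<circ> r') \<longlonglongrightarrow> l' - b0" by (simp add: o_def)
    have rr: "strict_mono (r \<circ> r')" using r r'(1) by (simp add: strict_mono_o)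
    have "b0 \<in> E'" using clE[OF rr _ r'(2)] b' by simp
    moreover have "l' - b0 \<in> F'" using clF[OF rr _ c0] c' by simp
    ultimately show ?thesis using r' by (metis add_diff_cancel_left' add_diff_eq)
  qed
  have bdd: "bounded (range b)"
  proof (rule ccontr)
    assume "\<not> bounded (range b)"
    then have unb: "\<exists>i. norm (b i) > K" for K unfolding bounded_iff by (metis linorder_not_le rangeE)
    have step: "\<exists>i>n. norm (b i) > real m" for n m
    proof -
      obtain i where i: "norm (b i) > real m + (\<Sum>j\<le>n. norm (b j))" using unb by blast
      have "i > n"
      proof (rule ccontr)
        assume "\<not> i > n"
        then have "norm (b i) \<le> (\<Sum>j\<le>n. norm (b j))" by (intro member_le_sum) auto
        then show False using i by linarith
      qed
      moreover have "norm (b i) > real m" using i by (smt (verit) norm_ge_zero sum_nonneg)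
      ultimately show ?thesis by blast
    qed
    then obtain nx where nx: "\<And>n m. nx n m > n" "\<And>n m. norm (b (nx n m)) > real m" by metis
    \<comment> \<open>The requested bounds are 1 for \<open>r 0\<close> and \<open>i + 2\<close> for
      \<open>r (Suc i)\<close>, so that the norm at \<open>r i\<close> exceeds \<open>i + 1\<close>:
      it tends to infinity and is never 0.\<close>
    define r where "r = rec_nat (nx 0 1) (\<lambda>i k. nx k (i + 2))"
    have r: "strict_mono r" by (rule strict_mono_Suc_iff[THEN iffD2]) (simp add: r_def nx)
    have big: "norm (b (r i)) > real (i + 1)" for i
      using nx(2)[where n=0 and m=1] nx(2)[where m="Suc i"]
      by (cases i) (auto simp: r_def nx(2)[where m="Suc (Suc _)", simplified])
    let ?b = "\<lambda>i. b (r i) /\<^sub>R norm (b (r i))" and ?c = "\<lambda>i. c (r i) /\<^sub>R norm (b (r i))"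
    have "filterlim (\<lambda>i. norm (b (r i))) at_top sequentially"
      using big by (intro filterlim_at_top_mono[OF filterlim_real_sequentially] always_eventually allI)
        (metis add.commute le_add2 less_imp_le of_nat_mono order_trans)
    then have "(\<lambda>i. inverse (norm (b (r i)))) \<longlonglongrightarrow> 0" by (rule tendsto_inverse_0_at_top)
    moreover have "(\<lambda>i. b (r i) + c (r i)) \<longlonglongrightarrow> l" using LIMSEQ_subseq_LIMSEQ[OF lim r] by (simp add: o_def)
    ultimately have "(\<lambda>i. (b (r i) + c (r i)) /\<^sub>R norm (b (r i))) \<longlonglongrightarrow> 0 *\<^sub>R l" by (rule tendsto_scaleR)
    then have sum0: "(\<lambda>i. ?b i + ?c i) \<longlonglongrightarrow> 0" by (simp add: scaleR_add_right)
    have nz: "norm (?b i) = 1" for i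
    proof -
      have "norm (b (r i)) \<noteq> 0" using big[of i] of_nat_0_le_iff[of "i + 1"] by linarith
      then show ?thesis by simp
    qed
    have "bounded (range ?b)"
      unfolding bounded_iff by (intro exI[of _ 1] ballI, erule rangeE) (simp only: nz)
    moreover have "?b i \<in> E (r i)" "?c i \<in> F (r i)" for i
      using b c E F by (simp_all only: subspace_scale)
    ultimately obtain b0 c0 r' where *: "b0 \<in> E'" "c0 \<in> F'" "b0 + c0 = 0" "strict_mono (r'::nat\<Rightarrow>nat)" "(?b \<circ> r') \<longlonglongrightarrow> b0"
      using subseq[OF r, of ?b ?c 0] sum0 by blast
    have "b0 = - c0" using *(3) by (simp add: eq_neg_iff_add_eq_0)
    then have "b0 \<in> F'" using *(2) F' subspace_neg by blast
    then have "b0 = 0" using *(1) EF by blast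
    moreover have "(\<lambda>i. norm ((?b \<circ> r') i)) \<longlonglongrightarrow> norm b0" using *(5) by (rule tendsto_norm)
    then have "norm b0 = 1" unfolding o_def nz by (simp add: LIMSEQ_const_iff)
    ultimately show False by simp
  qed
  obtain b0 c0 where 0: "b0 \<in> E'" "c0 \<in> F'" "b0 + c0 = l"
    using subseq[of id b c l] b c lim bdd by (auto simp: strict_mono_id id_def strict_mono_def)
  \<comment> \<open>All subsequential limits agree: two decompositions of \<open>l\<close> differ by
    a vector common to \<open>E'\<close> and \<open>F'\<close>.\<close>
  have "b \<longlonglongrightarrow> b0"
  proof (rule ccontr)
    assume "\<not> b \<longlonglongrightarrow> b0"
    then obtain e where e: "e > 0" "\<not> (\<forall>\<^sub>F i in sequentially. dist (b i) b0 < e)"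
      unfolding tendsto_iff by blast
    then have "infinite {i. \<not> dist (b i) b0 < e}"
      by (simp add: eventually_cofinite[symmetric] cofinite_eq_sequentially)
    from infinite_enumerate[OF this] obtain r :: "nat \<Rightarrow> nat" where r: "strict_mono r" "\<And>i. \<not> dist (b (r i)) b0 < e"
      by auto
    have "(\<lambda>i. b (r i) + c (r i)) \<longlonglongrightarrow> l" using LIMSEQ_subseq_LIMSEQ[OF lim r(1)] by (simp add: o_def)
    moreover have "bounded (range (\<lambda>i. b (r i)))" by (rule bounded_subset[OF bdd]) auto
    ultimately obtain b1 c1 r' where *: "b1 \<in> E'" "c1 \<in> F'" "b1 + c1 = l" "strict_mono (r'::nat\<Rightarrow>nat)" "((\<lambda>i. b (r i)) \<circ> r') \<longlonglongrightarrow> b1"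
      using subseq[OF r(1), of "\<lambda>i. b (r i)" "\<lambda>i. c (r i)" l] b c by blast
    have "b1 - b0 = c0 - c1" using *(3) 0(3) by (metis add.commute add_diff_cancel_left diff_diff_eq2 diff_eq_eq)
    then have "b1 - b0 \<in> E' \<inter> F'" using *(1,2) 0(1,2) E' F' by (metis IntI subspace_diff)
    then have "b1 = b0" using EF by auto
    then have "\<forall>\<^sub>F i in sequentially. dist (b (r (r' i))) b0 < e" using *(5) e(1) tendstoD by (fastforce simp: o_def)
    then show False using r(2) by (auto simp: eventually_sequentially)
  qed
  moreover have "c \<longlonglongrightarrow> c0" using tendsto_diff[OF lim calculation] 0(3) by auto
  ultimately show ?thesis using 0 by blast
qed

section \<open>Charts and tangent vectors\<close>

lemma sum_fun_apply: "(\<Sum>i\<in>I. f i) x = (\<Sum>i\<in>I. f i x)"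
  for f :: "'i \<Rightarrow> 'a \<Rightarrow> 'b::comm_monoid_add"
  by (induction I rule: infinite_finite_induct) auto

lemma tangent_space_transition:
  "v \<in> tangent_space A x \<Longrightarrow> c \<in> charts_at A x \<Longrightarrow> d \<in> charts_at A x \<Longrightarrow>
    v d = frechet_derivative (snd d \<circ> chart_inv c) (at (snd c x)) (v c)"
  and tangent_space_outside: "v \<in> tangent_space A x \<Longrightarrow> c \<notin> charts_at A x \<Longrightarrow> v c = 0"
  unfolding tangent_space_def by blast+

lemma chart_inv_image: "p \<in> snd c ` fst c \<Longrightarrow> chart_inv c p \<in> fst c"
  and snd_chart_inv: "p \<in> snd c ` fst c \<Longrightarrow> snd c (chart_inv c p) = p"
  unfolding chart_inv_def by (auto intro: inv_into_into f_inv_into_f)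

context
  fixes r :: enat and X :: "'m topology" and A :: "('m, 'e::euclidean_space) chart set"
  assumes X: "manifold r X A"
begin

lemma chart_openin: "c \<in> A \<Longrightarrow> openin X (fst c)"
  and chart_image_open: "c \<in> A \<Longrightarrow> open (snd c ` fst c)"
  and chart_homeomorphic: "c \<in> A \<Longrightarrow>
    homeomorphic_map (subtopology X (fst c)) (top_of_set (snd c ` fst c)) (snd c)"
  and manifold_chart_subset: "c \<in> A \<Longrightarrow> fst c \<subseteq> topspace X"
  and manifold_chart_exists: "x \<in> topspace X \<Longrightarrow> \<exists>c\<in>A. x \<in> fst c"
  using X unfolding manifold_def by auto

lemma chart_inj: "c \<in> A \<Longrightarrow> inj_on (snd c) (fst c)"
  using homeomorphic_imp_injective_map[OF chart_homeomorphic] manifold_chart_subset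
  by (simp add: Int_absorb1)

lemma manifold_chart_inv_snd: "c \<in> A \<Longrightarrow> x \<in> fst c \<Longrightarrow> chart_inv c (snd c x) = x"
  unfolding chart_inv_def by (simp add: chart_inj)

lemma open_chart_image:
  assumes "c \<in> A" "openin X W"
  shows "open (snd c ` (fst c \<inter> W))"
proof -
  have "openin (top_of_set (snd c ` fst c)) (snd c ` (fst c \<inter> W))"
    using homeomorphic_imp_open_map[OF chart_homeomorphic[OF assms(1)]] assms
    by (simp add: open_map_def openin_subtopology_Int2)
  then show ?thesis using chart_image_open[OF assms(1)] openin_open_trans by blast
qed

lemma openin_chart_preimage:
  assumes "c \<in> A" "open V"
  shows "openin X {x \<in> fst c. snd c x \<in> V}"
proof -
  have "continuous_map (subtopology X (fst c)) euclidean (snd c)"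
    using homeomorphic_imp_continuous_map[OF chart_homeomorphic[OF assms(1)]]
    by (simp add: continuous_map_in_subtopology)
  then have "openin (subtopology X (fst c)) {x \<in> topspace (subtopology X (fst c)). snd c x \<in> V}"
    using assms(2) openin_continuous_map_preimage by fastforce
  then show ?thesis
    using chart_openin[OF assms(1)] manifold_chart_subset[OF assms(1)]
    by (simp add: Int_absorb1 openin_open_subtopology)
qed

text \<open>With its converse below, this translates between convergence in the abstract topology
  and convergence of coordinates, in which the analysis is done.\<close>

lemma limitin_imp_chart_tendsto:
  assumes "limitin X xs x F" "c \<in> A" "x \<in> fst c"
  shows "\<forall>\<^sub>F i in F. xs i \<in> fst c" "((\<lambda>i. snd c (xs i)) \<longlongrightarrow> snd c x) F"
proof -
  show "\<forall>\<^sub>F i in F. xs i \<in> fst c"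
    using assms chart_openin unfolding limitin_def by blast
  show "((\<lambda>i. snd c (xs i)) \<longlongrightarrow> snd c x) F"
  proof (rule topological_tendstoI)
    fix V assume "open V" "snd c x \<in> V"
    then have "\<forall>\<^sub>F i in F. xs i \<in> {x \<in> fst c. snd c x \<in> V}"
      using assms openin_chart_preimage unfolding limitin_def by blast
    then show "\<forall>\<^sub>F i in F. snd c (xs i) \<in> V" by eventually_elim auto
  qed
qed

lemma chart_tendsto_imp_limitin:
  assumes c: "c \<in> A" "x \<in> fst c" and ev: "\<forall>\<^sub>F i in F. xs i \<in> fst c"
    and lim: "((\<lambda>i. snd c (xs i)) \<longlongrightarrow> snd c x) F"
  shows "limitin X xs x F"
  unfolding limitin_def
proof (intro conjI allI impI)
  show "x \<in> topspace X" using c manifold_chart_subset by blast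
  fix W assume W: "openin X W \<and> x \<in> W"
  then have "open (snd c ` (fst c \<inter> W))" "snd c x \<in> snd c ` (fst c \<inter> W)"
    using c open_chart_image by auto
  then have "\<forall>\<^sub>F i in F. snd c (xs i) \<in> snd c ` (fst c \<inter> W)"
    using lim topological_tendstoD by blast
  with ev show "\<forall>\<^sub>F i in F. xs i \<in> W"
  proof eventually_elim
    case (elim i)
    then obtain y where "y \<in> fst c \<inter> W" "snd c (xs i) = snd c y" by blast
    then show ?case using chart_inj[OF c(1)] elim(1) by (metis IntD1 IntD2 inj_onD)
  qed
qed

lemma open_chart_image_preimage:
  assumes "continuous_map X Y h" "c \<in> A" "openin Y W"
  shows "open (snd c ` {x \<in> fst c. h x \<in> W})"
proof -
  have "{x \<in> fst c. h x \<in> W} = fst c \<inter> {x \<in> topspace X. h x \<in> W}"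
    using manifold_chart_subset[OF assms(2)] by auto
  then show ?thesis
    using open_chart_image[OF assms(2) openin_continuous_map_preimage[OF assms(1,3)]] by simp
qed

lemma transition_has_derivative:
  assumes "1 \<le> r" "c \<in> A" "d \<in> A" "x \<in> fst c" "x \<in> fst d"
  shows "(snd d \<circ> chart_inv c has_derivative frechet_derivative (snd d \<circ> chart_inv c) (at (snd c x))) (at (snd c x))"
proof -
  have "Cr_on r (snd d \<circ> chart_inv c) (snd c ` (fst c \<inter> fst d))"
    using X assms unfolding manifold_def by blast
  from Cr_on_has_derivative[OF this assms(1)] show ?thesis using assms by auto
qed

lemma chart_self_frechet_derivative:
  assumes "c \<in> A" "x \<in> fst c"
  shows "frechet_derivative (snd c \<circ> chart_inv c) (at (snd c x)) = (\<lambda>a. a)"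
proof -
  have "((\<lambda>a. a) has_derivative (\<lambda>a. a)) (at (snd c x))" by (rule has_derivative_ident)
  then have "(snd c \<circ> chart_inv c has_derivative (\<lambda>a. a)) (at (snd c x))"
    by (rule has_derivative_transform_within_open[where s="snd c ` fst c"])
       (use assms chart_image_open in \<open>auto simp: snd_chart_inv\<close>)
  then show ?thesis using frechet_derivative_at by metis
qed

lemma Cr_map_chart:
  assumes "Cr_map 1 X A Y B h" and Y: "\<And>d. d \<in> B \<Longrightarrow> openin Y (fst d)"
    and "c \<in> A" "d \<in> B" "x \<in> fst c" "h x \<in> fst d"
  shows Cr_map_chart_open: "open (snd c ` {x \<in> fst c. h x \<in> fst d})"
    and Cr_map_chart_Cr_on: "Cr_on 1 (snd d \<circ> h \<circ> chart_inv c) (snd c ` {x \<in> fst c. h x \<in> fst d})"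
    and Cr_map_chart_has_derivative: "(snd d \<circ> h \<circ> chart_inv c has_derivative
      frechet_derivative (snd d \<circ> h \<circ> chart_inv c) (at (snd c x))) (at (snd c x))"
proof -
  show "open (snd c ` {x \<in> fst c. h x \<in> fst d})"
    using assms open_chart_image_preimage unfolding Cr_map_def by blast
  show 1: "Cr_on 1 (snd d \<circ> h \<circ> chart_inv c) (snd c ` {x \<in> fst c. h x \<in> fst d})"
    using assms unfolding Cr_map_def by blast
  show "(snd d \<circ> h \<circ> chart_inv c has_derivative
      frechet_derivative (snd d \<circ> h \<circ> chart_inv c) (at (snd c x))) (at (snd c x))"
    by (rule Cr_on_has_derivative[OF 1]) (use assms in auto)
qed

end

text \<open>Inserting the chart \<open>d\<close> between \<open>h\<close> and \<open>u\<close>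
  changes nothing near \<open>snd c x\<close>. Leaving \<open>u\<close> arbitrary covers changes of
  chart (with \<open>h\<close> the identity) as well as compositions of two maps.\<close>

lemma chart_chain_rule:
  assumes X: "manifold r X A" and Y: "manifold s Y B"
    and h: "continuous_map X Y h"
    and c: "c \<in> A" "x \<in> fst c" and d: "d \<in> B" "h x \<in> fst d"
    and L1: "(snd d \<circ> h \<circ> chart_inv c has_derivative L1) (at (snd c x))"
    and L2: "(u \<circ> chart_inv d has_derivative L2) (at (snd d (h x)))"
  shows "(u \<circ> h \<circ> chart_inv c has_derivative L2 \<circ> L1) (at (snd c x))"
proof (rule has_derivative_transform_within_open)
  have "(snd d \<circ> h \<circ> chart_inv c) (snd c x) = snd d (h x)"
    by (simp add: manifold_chart_inv_snd[OF X c])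
  then show "((u \<circ> chart_inv d) \<circ> (snd d \<circ> h \<circ> chart_inv c) has_derivative L2 \<circ> L1) (at (snd c x))"
    using L1 L2 by (intro diff_chain_at) auto
  show "open (snd c ` {x \<in> fst c. h x \<in> fst d})"
    by (rule open_chart_image_preimage[OF X h c(1) chart_openin[OF Y d(1)]])
  show "snd c x \<in> snd c ` {x \<in> fst c. h x \<in> fst d}" using c d by blast
qed (auto simp: manifold_chart_inv_snd[OF X c(1)] manifold_chart_inv_snd[OF Y d(1)])

context
  fixes r :: enat and X :: "'m topology" and A :: "('m, 'e::euclidean_space) chart set"
  assumes X: "manifold r X A" and r: "1 \<le> r"
begin

lemma coord_vec_self: "c \<in> charts_at A x \<Longrightarrow> coord_vec A c x a c = a"
  unfolding coord_vec_def charts_at_def by (simp add: chart_self_frechet_derivative[OF X])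

lemma coord_vec_tangent:
  assumes "v \<in> tangent_space A x" "c \<in> charts_at A x"
  shows "coord_vec A c x (v c) = v"
proof
  fix d
  show "coord_vec A c x (v c) d = v d"
    using tangent_space_transition[OF assms, of d] tangent_space_outside[OF assms(1), of d]
    by (cases "d \<in> charts_at A x") (simp_all add: coord_vec_def)
qed

lemma coord_vec_linear:
  assumes "c \<in> charts_at A x"
  shows "linear (coord_vec A c x)"
proof -
  have "linear (frechet_derivative (snd d \<circ> chart_inv c) (at (snd c x)))" if "d \<in> charts_at A x" for d
    using transition_has_derivative[OF X r, of c d x] assms that has_derivative_linear
    unfolding charts_at_def by blast
  then show ?thesis
    by (intro linearI)
       (auto simp: coord_vec_def fun_eq_iff plus_fun_def scaleR_fun_def linear_add linear_scale)
qed

text \<open>The compatibility between two charts \<open>d\<close> and \<open>e\<close> is the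
  cocycle identity for derivatives of transition maps, an instance of the chain rule.\<close>

lemma coord_vec_in_tangent_space:
  assumes c: "c \<in> charts_at A x"
  shows "coord_vec A c x a \<in> tangent_space A x"
proof -
  have "frechet_derivative (snd e \<circ> chart_inv c) (at (snd c x)) a =
      frechet_derivative (snd e \<circ> chart_inv d) (at (snd d x)) (frechet_derivative (snd d \<circ> chart_inv c) (at (snd c x)) a)"
    if d: "d \<in> charts_at A x" "e \<in> charts_at A x" for d e
  proof -
    have *: "c \<in> A" "d \<in> A" "e \<in> A" "x \<in> fst c" "x \<in> fst d" "x \<in> fst e"
      using c d by (auto simp: charts_at_def)
    have "(snd e \<circ> (\<lambda>x. x) \<circ> chart_inv c has_derivative
       frechet_derivative (snd e \<circ> chart_inv d) (at (snd d x)) \<circ> frechet_derivative (snd d \<circ> chart_inv c) (at (snd c x))) (at (snd c x))"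
      by (rule chart_chain_rule[OF X X, where d=d])
         (use * transition_has_derivative[OF X r] in \<open>auto simp: o_def\<close>)
    then have "frechet_derivative (snd e \<circ> chart_inv d) (at (snd d x)) \<circ> frechet_derivative (snd d \<circ> chart_inv c) (at (snd c x))
       = frechet_derivative (snd e \<circ> chart_inv c) (at (snd c x))"
      by (subst frechet_derivative_at[symmetric]) (auto simp: o_def)
    then show ?thesis by (metis comp_apply)
  qed
  then have "coord_vec A c x a e = frechet_derivative (snd e \<circ> chart_inv d) (at (snd d x)) (coord_vec A c x a d)"
    if "d \<in> charts_at A x" "e \<in> charts_at A x" for d e
    unfolding coord_vec_def if_P[OF that(1)] if_P[OF that(2)] using that by blast
  moreover have "coord_vec A c x a d = 0" if "d \<notin> charts_at A x" for d
    using that by (simp add: coord_vec_def)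
  ultimately show ?thesis unfolding tangent_space_def by blast
qed

lemma tangent_space_subspace: "subspace (tangent_space A x)"
proof -
  have "linear (frechet_derivative (snd d \<circ> chart_inv c) (at (snd c x)))"
    if "c \<in> charts_at A x" "d \<in> charts_at A x" for c d
    using transition_has_derivative[OF X r, of c d x] that has_derivative_linear
    unfolding charts_at_def by blast
  note lin = this
  show ?thesis
    unfolding subspace_def
  proof (intro conjI ballI allI)
    show "0 \<in> tangent_space A x" unfolding tangent_space_def by (auto simp: linear_0[OF lin])
    fix v w :: "('m, 'e) tvec" and k :: real
    assume v: "v \<in> tangent_space A x"
    have v': "v c = 0" if "c \<notin> charts_at A x" for c
      by (rule tangent_space_outside[OF v that])
    have "k *\<^sub>R frechet_derivative (snd d \<circ> chart_inv c) (at (snd c x)) (v c) = k *\<^sub>R v d"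
      if "c \<in> charts_at A x" "d \<in> charts_at A x" for c d
      by (simp only: tangent_space_transition[OF v that, symmetric])
    then show "k *\<^sub>R v \<in> tangent_space A x"
      unfolding tangent_space_def mem_Collect_eq scaleR_fun_def
      by (metis (no_types) lin linear_scale scaleR_zero_right v')
    assume w: "w \<in> tangent_space A x"
    have w': "w c = 0" if "c \<notin> charts_at A x" for c
      by (rule tangent_space_outside[OF w that])
    have "frechet_derivative (snd d \<circ> chart_inv c) (at (snd c x)) (v c) + frechet_derivative (snd d \<circ> chart_inv c) (at (snd c x)) (w c) = v d + w d"
      if "c \<in> charts_at A x" "d \<in> charts_at A x" for c d
      by (simp only: tangent_space_transition[OF v that, symmetric] tangent_space_transition[OF w that, symmetric])
    then show "v + w \<in> tangent_space A x"
      unfolding tangent_space_def mem_Collect_eq plus_fun_def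
      by (metis (no_types) lin linear_add add_0 v' w')
  qed
qed

lemma tangent_eqI:
  "v \<in> tangent_space A x \<Longrightarrow> w \<in> tangent_space A x \<Longrightarrow> c \<in> charts_at A x \<Longrightarrow> v c = w c \<Longrightarrow> v = w"
  using coord_vec_tangent by metis

text \<open>Frees \<open>tangent_map\<close> from the chart picked by \<open>SOME\<close>: the chain
  rule through that chart absorbs the change of coordinates.\<close>

lemma tangent_map_chart:
  assumes Y: "manifold s Y B" and h: "Cr_map 1 X A Y B h"
    and v: "v \<in> tangent_space A x" and c: "c \<in> charts_at A x" and d: "d \<in> charts_at B (h x)"
  shows "tangent_map A B h x v d = frechet_derivative (snd d \<circ> h \<circ> chart_inv c) (at (snd c x)) (v c)"
proof -
  define e where "e = (SOME c. c \<in> charts_at A x)"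
  have e: "e \<in> charts_at A x" unfolding e_def using c by (rule someI)
  have *: "c \<in> A" "d \<in> B" "e \<in> A" "x \<in> fst c" "h x \<in> fst d" "x \<in> fst e"
    using c d e by (auto simp: charts_at_def)
  have "((snd d \<circ> h) \<circ> (\<lambda>x. x) \<circ> chart_inv c has_derivative
     frechet_derivative (snd d \<circ> h \<circ> chart_inv e) (at (snd e x)) \<circ> frechet_derivative (snd e \<circ> chart_inv c) (at (snd c x))) (at (snd c x))"
    by (rule chart_chain_rule[OF X X, where d=e])
       (use * transition_has_derivative[OF X r] Cr_map_chart_has_derivative[OF X h chart_openin[OF Y]] in \<open>auto simp: o_def\<close>)
  then have "frechet_derivative (snd d \<circ> h \<circ> chart_inv e) (at (snd e x)) \<circ> frechet_derivative (snd e \<circ> chart_inv c) (at (snd c x))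
     = frechet_derivative (snd d \<circ> h \<circ> chart_inv c) (at (snd c x))"
    by (subst frechet_derivative_at[symmetric]) (auto simp: o_def)
  moreover have "v e = frechet_derivative (snd e \<circ> chart_inv c) (at (snd c x)) (v c)"
    using v c e by (rule tangent_space_transition)
  ultimately show ?thesis
    using d by (simp add: tangent_map_def Let_def e_def[symmetric] fun_eq_iff)
qed

end

text \<open>Differentiate \<open>k \<circ> h = id\<close> in charts. Tangency of the image vector is
  a hypothesis because invariance of the bundles supplies it wherever the lemma is applied.\<close>

lemma tangent_map_left_inverse:
  assumes X: "manifold r X A" "1 \<le> r" and Y: "manifold s Y B" "1 \<le> s" and h: "Cr_map 1 X A Y B h" and k: "Cr_map 1 Y B X A k"
    and kh: "\<And>x. x \<in> topspace X \<Longrightarrow> k (h x) = x"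
    and x: "x \<in> topspace X" and v: "v \<in> tangent_space A x"
    and hv: "tangent_map A B h x v \<in> tangent_space B (h x)"
  shows "tangent_map B A k (h x) (tangent_map A B h x v) = v"
proof
  fix c
  show "tangent_map B A k (h x) (tangent_map A B h x v) c = v c"
  proof (cases "c \<in> charts_at A x")
    case False
    then show ?thesis using v by (simp add: tangent_map_def kh[OF x] tangent_space_outside)
  next
    case True
    have "h x \<in> topspace Y" using h x unfolding Cr_map_def continuous_map_def by auto
    then obtain d where d: "d \<in> B" "h x \<in> fst d" using manifold_chart_exists[OF Y(1)] by blast
    have c: "c \<in> A" "x \<in> fst c" using True by (auto simp: charts_at_def)
    have "tangent_map B A k (h x) (tangent_map A B h x v) c =
        frechet_derivative (snd c \<circ> k \<circ> chart_inv d) (at (snd d (h x))) (frechet_derivative (snd d \<circ> h \<circ> chart_inv c) (at (snd c x)) (v c))"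
      using tangent_map_chart[OF Y X(1) k hv, of d c] tangent_map_chart[OF X Y(1) h v, of c d]
        c d kh[OF x] by (simp add: charts_at_def)
    moreover have "(snd c \<circ> k \<circ> h \<circ> chart_inv c has_derivative
        frechet_derivative (snd c \<circ> k \<circ> chart_inv d) (at (snd d (h x))) \<circ> frechet_derivative (snd d \<circ> h \<circ> chart_inv c) (at (snd c x))) (at (snd c x))"
      by (rule chart_chain_rule[OF X(1) Y(1), where d=d])
        (use c d kh[OF x] h Cr_map_chart_has_derivative[OF X(1) h chart_openin[OF Y(1)]]
            Cr_map_chart_has_derivative[OF Y(1) k chart_openin[OF X(1)]] in \<open>auto simp: Cr_map_def\<close>)
    then have "(snd c \<circ> chart_inv c has_derivative
        frechet_derivative (snd c \<circ> k \<circ> chart_inv d) (at (snd d (h x))) \<circ> frechet_derivative (snd d \<circ> h \<circ> chart_inv c) (at (snd c x))) (at (snd c x))"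
    proof (rule has_derivative_transform_within_open)
      show "open (snd c ` fst c)" by (rule chart_image_open[OF X(1) c(1)])
      fix p assume p: "p \<in> snd c ` fst c"
      then have "chart_inv c p \<in> topspace X"
        using subsetD[OF manifold_chart_subset[OF X(1) c(1)] chart_inv_image] by simp
      then show "(snd c \<circ> k \<circ> h \<circ> chart_inv c) p = (snd c \<circ> chart_inv c) p" by (simp add: kh)
    qed (simp add: c)
    then have "frechet_derivative (snd c \<circ> k \<circ> chart_inv d) (at (snd d (h x))) \<circ> frechet_derivative (snd d \<circ> h \<circ> chart_inv c) (at (snd c x))
        = (\<lambda>a. a)"
      using chart_self_frechet_derivative[OF X(1) c] frechet_derivative_at by metis
    ultimately show ?thesis by (metis comp_apply)
  qed
qed

section \<open>Limits in subbundles\<close>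

text \<open>Recasts the local frame for use with sequences: the fibre is written with coefficients
  indexed by numbers instead of by vectors, and continuity is sequential, in the fixed chart
  \<open>c\<close>.\<close>

lemma subbundle_frame:
  fixes E :: "'m \<Rightarrow> ('m, 'e::euclidean_space) tvec set"
  assumes X: "manifold r X A" and E: "subbundle X A k E"
    and c: "c \<in> A" and x: "x \<in> fst c"
  shows "\<exists>U b. openin X U \<and> x \<in> U \<and>
    (\<forall>y\<in>U. inj_on (\<lambda>i::nat. b i y) {..<k} \<and> independent ((\<lambda>i. b i y) ` {..<k}) \<and>
       E y = {\<Sum>i<k. u i *\<^sub>R b i y |u. True}) \<and>
    (\<forall>i<k. \<forall>ys::nat \<Rightarrow> 'm. (\<forall>n. ys n \<in> fst c) \<longrightarrow> (\<lambda>n. snd c (ys n)) \<longlonglongrightarrow> snd c x \<longrightarrow>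
        (\<lambda>n. b i (ys n) c) \<longlonglongrightarrow> b i x c)"
proof -
  have xX: "x \<in> topspace X" using manifold_chart_subset[OF X c] x by blast
  from bspec[OF conjunct2[OF E[unfolded subbundle_def]] this]
  obtain U b where U: "openin X U" "x \<in> U"
    and b: "\<forall>y\<in>U. inj_on (\<lambda>i::nat. b i y) {..<k} \<and> independent ((\<lambda>i. b i y) ` {..<k}) \<and>
           span ((\<lambda>i. b i y) ` {..<k}) = E y"
    and cont: "\<forall>i<k. \<forall>c\<in>A. continuous_map (subtopology X (U \<inter> fst c)) euclidean (\<lambda>y. b i y c)"
    by (elim exE conjE)
  show ?thesis
  proof (intro exI conjI ballI allI impI)
    show "openin X U" "x \<in> U" by fact+
    fix y assume "y \<in> U"
    with b show inj: "inj_on (\<lambda>i. b i y) {..<k}" and "independent ((\<lambda>i. b i y) ` {..<k})" by blast+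
    from \<open>y \<in> U\<close> b have sp: "span ((\<lambda>i. b i y) ` {..<k}) = E y" by blast
    have "E y = range (\<lambda>u. \<Sum>v\<in>(\<lambda>i. b i y) ` {..<k}. u v *\<^sub>R v)"
      using span_finite[of "(\<lambda>i. b i y) ` {..<k}"] sp by simp
    also have "\<dots> = range (\<lambda>u. \<Sum>i<k. u (b i y) *\<^sub>R b i y)"
      by (simp add: sum.reindex[OF inj] o_def)
    also have "\<dots> = {\<Sum>i<k. u i *\<^sub>R b i y |u. True}"
    proof (intro equalityI subsetI)
      fix v assume "v \<in> {\<Sum>i<k. u i *\<^sub>R b i y |u. True}"
      then obtain u where v: "v = (\<Sum>i<k. u i *\<^sub>R b i y)" by blast
      have "v = (\<Sum>i<k. (u \<circ> inv_into {..<k} (\<lambda>i. b i y)) (b i y) *\<^sub>R b i y)"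
        unfolding v by (rule sum.cong) (simp_all add: inv_into_f_f[OF inj])
      then show "v \<in> range (\<lambda>u. \<Sum>i<k. u (b i y) *\<^sub>R b i y)" by blast
    next
      fix v assume "v \<in> range (\<lambda>u. \<Sum>i<k. u (b i y) *\<^sub>R b i y)"
      then obtain u where "v = (\<Sum>i<k. (\<lambda>i. u (b i y)) i *\<^sub>R b i y)" by blast
      then show "v \<in> {\<Sum>i<k. u i *\<^sub>R b i y |u. True}"
        by (intro CollectI exI[of _ "\<lambda>i. u (b i y)"]) simp
    qed
    finally show "E y = {\<Sum>i<k. u i *\<^sub>R b i y |u. True}" .
  next
    fix i and ys :: "nat \<Rightarrow> 'm" assume i: "i < k" and lim: "(\<lambda>n. snd c (ys n)) \<longlonglongrightarrow> snd c x"
      and ys: "\<forall>n. ys n \<in> fst c"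
    have lx: "limitin X ys x sequentially"
      using chart_tendsto_imp_limitin[OF X c x _ lim] ys by simp
    moreover from this have "\<forall>\<^sub>F n in sequentially. ys n \<in> U" using U by (simp add: limitin_def)
    ultimately have "limitin (subtopology X (U \<inter> fst c)) ys x sequentially"
      using U ys x by (simp add: limitin_subtopology)
    from continuous_map_limit[OF cont[rule_format, OF i c] this]
    show "(\<lambda>n. b i (ys n) c) \<longlonglongrightarrow> b i x c" by (simp add: o_def)
  qed
qed

text \<open>Keep the coefficients of \<open>w\<close> constant and let the frame move.\<close>

lemma subbundle_approx:
  fixes E :: "'m \<Rightarrow> ('m, 'e::euclidean_space) tvec set"
  assumes X: "manifold r X A" and E: "subbundle X A k E"
    and c: "c \<in> A" and x: "x \<in> fst c" and xs: "\<And>i::nat. xs i \<in> fst c"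
    and lim: "(\<lambda>i. snd c (xs i)) \<longlonglongrightarrow> snd c x" and w: "w \<in> E x"
  shows "\<exists>ws. (\<forall>i. ws i \<in> E (xs i)) \<and> (\<lambda>i. ws i c) \<longlonglongrightarrow> w c"
proof -
  obtain U b where U: "openin X U" "x \<in> U"
    and fr: "\<forall>y\<in>U. inj_on (\<lambda>i::nat. b i y) {..<k} \<and> independent ((\<lambda>i. b i y) ` {..<k}) \<and>
       E y = {\<Sum>i<k. u i *\<^sub>R b i y |u. True}"
    and b: "\<forall>i<k. \<forall>ys::nat \<Rightarrow> 'm. (\<forall>n. ys n \<in> fst c) \<longrightarrow> (\<lambda>n. snd c (ys n)) \<longlonglongrightarrow> snd c x \<longrightarrow>
        (\<lambda>n. b i (ys n) c) \<longlonglongrightarrow> b i x c"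
    using subbundle_frame[OF X E c x] by (elim exE conjE)
  have inj: "inj_on (\<lambda>i. b i y) {..<k}" and ind: "independent ((\<lambda>i. b i y) ` {..<k})"
    and E': "E y = {\<Sum>i<k. u i *\<^sub>R b i y |u. True}" if "y \<in> U" for y
    using fr that by blast+
  have b: "(\<lambda>n. b i (xs n) c) \<longlonglongrightarrow> b i x c" if "i < k" for i
    using b xs lim that by blast
  obtain u where u: "w = (\<Sum>i<k. u i *\<^sub>R b i x)" using w E'[OF U(2)] by auto
  \<comment> \<open>Finitely many \<open>xs n\<close> may lie outside the domain of the frame; there
    0 is a legitimate member of the fibre.\<close>
  define ws where "ws n = (if xs n \<in> U then \<Sum>i<k. u i *\<^sub>R b i (xs n) else 0)" for n
  have "xs n \<in> topspace X" for n using manifold_chart_subset[OF X c] xs by blast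
  then have "0 \<in> E (xs n)" for n using E unfolding subbundle_def by (simp add: subspace_0)
  then have "ws n \<in> E (xs n)" for n using E' by (auto simp: ws_def)
  moreover have "(\<lambda>i. ws i c) \<longlonglongrightarrow> w c"
  proof (rule Lim_transform_eventually)
    show "(\<lambda>n. \<Sum>i<k. u i *\<^sub>R b i (xs n) c) \<longlonglongrightarrow> w c"
      unfolding u sum_fun_apply scaleR_fun_def
      by (intro tendsto_intros b) auto
    have "limitin X xs x sequentially"
      using chart_tendsto_imp_limitin[OF X c x _ lim] xs by simp
    then have "\<forall>\<^sub>F n in sequentially. xs n \<in> U" using U by (simp add: limitin_def)
    then show "\<forall>\<^sub>F n in sequentially. (\<Sum>i<k. u i *\<^sub>R b i (xs n) c) = ws n c"
      by eventually_elim (simp add: ws_def sum_fun_apply scaleR_fun_def)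
  qed
  ultimately show ?thesis by blast
qed

lemma linear_tvec_apply: "linear (\<lambda>v::('m, 'e::euclidean_space) tvec. v c)"
  by (rule linearI) (simp_all add: scaleR_fun_def)

text \<open>The coefficients in a frame are encoded as a vector of the model space, in which bounded
  linear maps injective on a subspace are bounded below.\<close>

lemma subbundle_limit:
  fixes E :: "'m \<Rightarrow> ('m, 'e::euclidean_space) tvec set"
  assumes X: "manifold r X A" and r: "1 \<le> r" and E: "subbundle X A k E"
    and c: "c \<in> A" and x: "x \<in> fst c" and xs: "\<And>i::nat. xs i \<in> fst c"
    and lim: "(\<lambda>i. snd c (xs i)) \<longlonglongrightarrow> snd c x"
    and a: "\<And>i. a i \<in> (\<lambda>v. v c) ` E (xs i)" "a \<longlonglongrightarrow> l"
  shows "l \<in> (\<lambda>v. v c) ` E x"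
proof -
  obtain U b where U: "openin X U" "x \<in> U"
    and fr: "\<forall>y\<in>U. inj_on (\<lambda>i::nat. b i y) {..<k} \<and> independent ((\<lambda>i. b i y) ` {..<k}) \<and>
       E y = {\<Sum>i<k. u i *\<^sub>R b i y |u. True}"
    and b: "\<forall>i<k. \<forall>ys::nat \<Rightarrow> 'm. (\<forall>n. ys n \<in> fst c) \<longrightarrow> (\<lambda>n. snd c (ys n)) \<longlonglongrightarrow> snd c x \<longrightarrow>
        (\<lambda>n. b i (ys n) c) \<longlonglongrightarrow> b i x c"
    using subbundle_frame[OF X E c x] by (elim exE conjE)
  have inj: "inj_on (\<lambda>i. b i y) {..<k}" and ind: "independent ((\<lambda>i. b i y) ` {..<k})"
    and E': "E y = {\<Sum>i<k. u i *\<^sub>R b i y |u. True}" if "y \<in> U" for y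
    using fr that by blast+
  have b: "(\<lambda>n. b i (xs n) c) \<longlonglongrightarrow> b i x c" if "i < k" for i
    using b xs lim that by blast
  have xX: "x \<in> topspace X" using manifold_chart_subset[OF X c] x by blast
  have cx: "c \<in> charts_at A x" using c x by (simp add: charts_at_def)
  have ET: "E x \<subseteq> tangent_space A x" and sE: "subspace (E x)" using E xX unfolding subbundle_def by auto
  have bE: "b i x \<in> E x" if "i < k" for i
  proof -
    have "b i x = (\<Sum>j<k. (if j = i then 1 else 0) *\<^sub>R b j x)"
      using that by (simp add: if_distrib[of "\<lambda>t. t *\<^sub>R _"] cong: if_cong)
    then show ?thesis
      unfolding E'[OF U(2)] by (intro CollectI exI[of _ "\<lambda>j. if j = i then 1 else 0"]) simp
  qed
  have injc: "inj_on (\<lambda>v. v c) (E x)"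
    using ET tangent_eqI[OF X r _ _ cx] by (intro inj_onI) blast
  \<comment> \<open>The frame stays independent when read in the chart \<open>c\<close>, so
    \<open>k\<close> is at most the dimension of the model space. This leaves room for
    \<open>k\<close> coefficients as coordinates along distinct basis vectors.\<close>
  have "span ((\<lambda>i. b i x) ` {..<k}) \<subseteq> E x"
    using bE sE by (intro span_minimal) auto
  then have "inj_on (\<lambda>v. v c) (span ((\<lambda>i. b i x) ` {..<k}))" using injc inj_on_subset by blast
  from linear_independent_injective_image[OF linear_tvec_apply ind[OF U(2)] this]
  have "independent ((\<lambda>v. v c) ` (\<lambda>i. b i x) ` {..<k})" .
  then have "card ((\<lambda>v. v c) ` (\<lambda>i. b i x) ` {..<k}) \<le> DIM('e)" by (rule independent_bound[THEN conjunct2])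
  moreover have "card ((\<lambda>v. v c) ` (\<lambda>i. b i x) ` {..<k}) = k"
  proof -
    have "inj_on (\<lambda>v. v c) ((\<lambda>i. b i x) ` {..<k})" using bE by (intro inj_on_subset[OF injc]) auto
    then show ?thesis by (simp add: card_image inj[OF U(2)])
  qed
  ultimately have "card {..<k} \<le> card (Basis :: 'e set)" by simp
  then obtain e :: "nat \<Rightarrow> 'e" where e: "e ` {..<k} \<subseteq> Basis" "inj_on e {..<k}"
    using card_le_inj[of "{..<k}" "Basis :: 'e set"] by auto
  define L where "L y \<alpha> = (\<Sum>j<k. (\<alpha> \<bullet> e j) *\<^sub>R b j y c)" for y \<alpha>
  define V where "V = {\<alpha>::'e. \<forall>\<beta>\<in>Basis - e ` {..<k}. \<alpha> \<bullet> \<beta> = 0}"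
  have V: "subspace V" by (auto simp: V_def subspace_def inner_simps)
  have linL: "linear (L y)" for y
    unfolding L_def by (intro linear_compose_sum ballI linearI) (auto simp: inner_simps scaleR_add_left)
  have code: "\<exists>\<alpha>\<in>V. \<forall>j<k. \<alpha> \<bullet> e j = u j" for u
  proof -
    have ij: "e i \<bullet> e j = (if i = j then 1 else 0)" if "i < k" "j < k" for i j
    proof -
      have "e i \<in> Basis" "e j \<in> Basis" using e(1) that by auto
      moreover have "e i = e j \<longleftrightarrow> i = j" using e(2) that by (auto simp: inj_on_def)
      ultimately show ?thesis by (simp add: inner_Basis)
    qed
    let ?\<alpha> = "\<Sum>i<k. u i *\<^sub>R e i"
    have "e i \<bullet> \<beta> = 0" if "\<beta> \<in> Basis - e ` {..<k}" "i < k" for i \<beta>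
      using that e(1) by (intro inner_not_same_Basis) auto
    then have "?\<alpha> \<in> V"
      unfolding V_def by (auto simp: inner_sum_left intro!: sum.neutral)
    moreover have "?\<alpha> \<bullet> e j = u j" if "j < k" for j
    proof -
      have "?\<alpha> \<bullet> e j = (\<Sum>i<k. if i = j then u i else 0)"
        unfolding inner_sum_left by (rule sum.cong) (use that ij in auto)
      then show ?thesis using that by simp
    qed
    ultimately show ?thesis by blast
  qed
  have fib: "(\<lambda>v. v c) ` E y = L y ` V" if y: "y \<in> U" for y
  proof (intro equalityI subsetI)
    fix z assume "z \<in> (\<lambda>v. v c) ` E y"
    then obtain u where "z = (\<Sum>j<k. u j *\<^sub>R b j y c)"
      unfolding E'[OF y] by (auto simp: sum_fun_apply scaleR_fun_def)
    moreover obtain \<alpha> where "\<alpha> \<in> V" "\<forall>j<k. \<alpha> \<bullet> e j = u j" using code[of u] by blast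
    moreover from this have "L y \<alpha> = (\<Sum>j<k. u j *\<^sub>R b j y c)" by (simp add: L_def)
    ultimately show "z \<in> L y ` V" by (intro image_eqI[of _ _ \<alpha>]) simp_all
  next
    fix z assume "z \<in> L y ` V"
    then obtain \<alpha> where "z = (\<Sum>j<k. (\<alpha> \<bullet> e j) *\<^sub>R b j y) c"
      by (auto simp: L_def sum_fun_apply scaleR_fun_def)
    moreover have "(\<Sum>j<k. (\<alpha> \<bullet> e j) *\<^sub>R b j y) \<in> E y"
      unfolding E'[OF y] by (intro CollectI exI[of _ "\<lambda>j. \<alpha> \<bullet> e j"]) simp
    ultimately show "z \<in> (\<lambda>v. v c) ` E y" by blast
  qed
  have "\<alpha> = 0" if \<alpha>: "\<alpha> \<in> V" "L x \<alpha> = 0" for \<alpha>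
  proof -
    let ?v = "\<Sum>j<k. (\<alpha> \<bullet> e j) *\<^sub>R b j x"
    have "?v c = 0 c" using \<alpha>(2) by (simp add: L_def sum_fun_apply scaleR_fun_def)
    moreover have "?v \<in> E x"
      unfolding E'[OF U(2)] by (intro CollectI exI[of _ "\<lambda>j. \<alpha> \<bullet> e j"]) simp
    moreover have "0 \<in> E x" using sE by (rule subspace_0)
    ultimately have "?v = 0" using injc by (meson inj_onD)
    then have s0: "(\<Sum>v\<in>(\<lambda>j. b j x) ` {..<k}. (\<alpha> \<bullet> e (inv_into {..<k} (\<lambda>j. b j x) v)) *\<^sub>R v) = 0"
      by (simp add: sum.reindex[OF inj[OF U(2)]] inv_into_f_f[OF inj[OF U(2)]])
    have "\<alpha> \<bullet> e (inv_into {..<k} (\<lambda>j. b j x) (b i x)) = 0" if "i < k" for i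
      using that by (intro independentD[OF ind[OF U(2)] _ order_refl s0]) auto
    then have "\<alpha> \<bullet> e i = 0" if "i < k" for i using that by (simp add: inv_into_f_f[OF inj[OF U(2)]])
    note coef = this
    show "\<alpha> = 0"
    proof (rule euclidean_eqI)
      fix \<beta> :: 'e assume "\<beta> \<in> Basis"
      then have "\<alpha> \<bullet> \<beta> = 0"
        using coef \<alpha>(1) unfolding V_def by (cases "\<beta> \<in> e ` {..<k}") blast+
      then show "\<alpha> \<bullet> \<beta> = 0 \<bullet> \<beta>" by simp
    qed
  qed
  \<comment> \<open>An injective linear map on a finite-dimensional subspace is bounded
    below.\<close>
  then obtain m where m: "m > 0" "\<And>\<alpha>. \<alpha> \<in> V \<Longrightarrow> m * norm \<alpha> \<le> norm (L x \<alpha>)"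
    using injective_imp_isometric[OF closed_subspace[OF V] V, of "L x"] linL
    by (auto simp: linear_conv_bounded_linear)
  define \<delta> where "\<delta> i = (\<Sum>j<k. norm (b j (xs i) c - b j x c))" for i
  have "(\<lambda>i. \<Sum>j<k. norm (b j (xs i) c - b j x c)) \<longlonglongrightarrow> (\<Sum>j<k. norm (b j x c - b j x c))"
    by (intro tendsto_intros b) auto
  then have \<delta>: "\<delta> \<longlonglongrightarrow> 0" unfolding \<delta>_def by simp
  have close: "norm (L (xs i) \<alpha> - L x \<alpha>) \<le> \<delta> i * norm \<alpha>" for i \<alpha>
  proof -
    have "L (xs i) \<alpha> - L x \<alpha> = (\<Sum>j<k. (\<alpha> \<bullet> e j) *\<^sub>R (b j (xs i) c - b j x c))"
      by (simp add: L_def sum_subtractf scaleR_diff_right)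
    also have "norm \<dots> \<le> (\<Sum>j<k. norm (b j (xs i) c - b j x c) * norm \<alpha>)"
    proof (rule sum_norm_le)
      fix j assume "j \<in> {..<k}"
      then have "\<bar>\<alpha> \<bullet> e j\<bar> \<le> norm \<alpha>" using e(1) by (intro Basis_le_norm) auto
      then show "norm ((\<alpha> \<bullet> e j) *\<^sub>R (b j (xs i) c - b j x c)) \<le> norm (b j (xs i) c - b j x c) * norm \<alpha>"
        by (simp add: mult.commute[of _ "norm \<alpha>"] mult_right_mono)
    qed
    finally show ?thesis by (simp add: \<delta>_def sum_distrib_right)
  qed
  define \<alpha> where "\<alpha> i = (if xs i \<in> U then SOME \<beta>. \<beta> \<in> V \<and> a i = L (xs i) \<beta> else 0)" for i
  have \<alpha>: "\<alpha> i \<in> V \<and> (xs i \<in> U \<longrightarrow> a i = L (xs i) (\<alpha> i))" for i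
  proof (cases "xs i \<in> U")
    case True
    then have "\<exists>\<beta>. \<beta> \<in> V \<and> a i = L (xs i) \<beta>" using a(1)[of i] fib[OF True] by auto
    from someI_ex[OF this] show ?thesis using True by (simp add: \<alpha>_def)
  next
    case False
    then show ?thesis using subspace_0[OF V] by (simp add: \<alpha>_def)
  qed
  have "limitin X xs x sequentially" using chart_tendsto_imp_limitin[OF X c x _ lim] xs by simp
  then have evU: "\<forall>\<^sub>F i in sequentially. xs i \<in> U" using U by (simp add: limitin_def)
  \<comment> \<open>With an error below \<open>m / 2\<close>, half of the lower bound survives, so
    the codes \<open>\<alpha> i\<close> are bounded by \<open>2 / m\<close> times the norm of
    \<open>a i\<close>. Hence replacing \<open>xs i\<close> by \<open>x\<close> in \<open>L\<close>
    changes \<open>a i\<close> by a null sequence.\<close>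
  have "\<forall>\<^sub>F i in sequentially. \<delta> i < m / 2" using order_tendstoD(2)[OF \<delta>, of "m / 2"] m by simp
  with evU have "\<forall>\<^sub>F i in sequentially. norm (L x (\<alpha> i) - a i) \<le> \<delta> i * (2 / m * norm (a i))"
  proof eventually_elim
    case (elim i)
    have ai: "a i = L (xs i) (\<alpha> i)" and V: "\<alpha> i \<in> V" using \<alpha> elim by auto
    have d0: "\<delta> i \<ge> 0" by (simp add: \<delta>_def sum_nonneg)
    have *: "norm (a i - L x (\<alpha> i)) \<le> \<delta> i * norm (\<alpha> i)" using close[of i "\<alpha> i"] ai by simp
    have "m * norm (\<alpha> i) \<le> norm (L x (\<alpha> i))" by (rule m(2)[OF V])
    also have "\<dots> \<le> norm (a i) + norm (a i - L x (\<alpha> i))" using norm_triangle_sub[of "L x (\<alpha> i)" "a i"] by (simp add: norm_minus_commute)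
    also have "\<dots> \<le> norm (a i) + \<delta> i * norm (\<alpha> i)" using * by simp
    also have "\<dots> \<le> norm (a i) + m / 2 * norm (\<alpha> i)" using elim by (intro add_left_mono mult_right_mono) auto
    finally have "norm (\<alpha> i) \<le> 2 / m * norm (a i)" using m(1) by (simp add: field_simps)
    then have "\<delta> i * norm (\<alpha> i) \<le> \<delta> i * (2 / m * norm (a i))" using d0 by (rule mult_left_mono)
    then show ?case using * by (simp add: norm_minus_commute)
  qed
  moreover have "(\<lambda>i. \<delta> i * (2 / m * norm (a i))) \<longlonglongrightarrow> 0 * (2 / m * norm l)"
    by (intro tendsto_intros \<delta> a)
  then have "(\<lambda>i. \<delta> i * (2 / m * norm (a i))) \<longlonglongrightarrow> 0" by simp
  ultimately have "(\<lambda>i. L x (\<alpha> i) - a i) \<longlonglongrightarrow> 0" by (rule Lim_null_comparison)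
  from tendsto_add[OF this a(2)] have lim: "(\<lambda>i. L x (\<alpha> i)) \<longlonglongrightarrow> l" by simp
  have "closed (L x ` V)" by (intro closed_subspace linear_subspace_image linL V)
  then have "l \<in> L x ` V" by (rule closed_sequentially[OF _ _ lim]) (simp add: \<alpha>)
  then show ?thesis by (simp only: fib[OF U(2)])
qed

lemma tangent_map_linear:
  assumes X: "manifold r X A" and Y: "manifold s Y B" and h: "Cr_map 1 X A Y B h"
    and x: "x \<in> topspace X"
  shows "linear (tangent_map A B h x)"
proof -
  define c where "c = (SOME c. c \<in> charts_at A x)"
  have "\<exists>c. c \<in> charts_at A x" using manifold_chart_exists[OF X x] by (auto simp: charts_at_def)
  then have "c \<in> charts_at A x" unfolding c_def by (rule someI_ex)
  then have c: "c \<in> A" "x \<in> fst c" by (auto simp: charts_at_def)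
  have "linear (frechet_derivative (snd d \<circ> h \<circ> chart_inv c) (at (snd c x)))" if "d \<in> charts_at B (h x)" for d
    using Cr_map_chart_has_derivative[OF X h chart_openin[OF Y] c(1) _ c(2)] that has_derivative_linear
    unfolding charts_at_def by blast
  note lin = this
  show ?thesis
  proof (rule linearI)
    fix v w and k :: real
    show "tangent_map A B h x (v + w) = tangent_map A B h x v + tangent_map A B h x w"
    proof
      fix d
      show "tangent_map A B h x (v + w) d = (tangent_map A B h x v + tangent_map A B h x w) d"
        by (cases "d \<in> charts_at B (h x)")
           (simp_all add: tangent_map_def Let_def c_def[symmetric] linear_add[OF lin])
    qed
    show "tangent_map A B h x (k *\<^sub>R v) = k *\<^sub>R tangent_map A B h x v"
    proof
      fix d
      show "tangent_map A B h x (k *\<^sub>R v) d = (k *\<^sub>R tangent_map A B h x v) d"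
        by (cases "d \<in> charts_at B (h x)")
           (simp_all add: tangent_map_def Let_def c_def[symmetric] scaleR_fun_def linear_scale[OF lin])
    qed
  qed
qed

section \<open>The adapted metric\<close>

lemma one_le_infinity: "1 \<le> (\<infinity>::enat)"
  by simp

locale ph_system =
  fixes M :: "'m topology" and A :: "('m, 'e::euclidean_space) chart set"
    and g :: "'m \<Rightarrow> ('m, 'e) tvec \<Rightarrow> ('m, 'e) tvec \<Rightarrow> real"
    and f :: "'m \<Rightarrow> 'm"
    and Es Ec Eu :: "'m \<Rightarrow> ('m, 'e) tvec set"
  assumes closed: "closed_connected_manifold M A"
    and metric: "riemannian_metric M A g"
    and ph: "partially_hyperbolic M A g f Es Ec Eu"
begin

lemma mfd: "manifold \<infinity> M A" and compact_M: "compact_space M" and Hausdorff_M: "Hausdorff_space M"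
  using closed unfolding closed_connected_manifold_def manifold_def by auto

lemmas chart_openin = chart_openin[OF mfd]
  and chart_image_open = chart_image_open[OF mfd]
  and chart_subset = manifold_chart_subset[OF mfd]
  and chart_exists = manifold_chart_exists[OF mfd]
  and chart_inj = chart_inj[OF mfd]
  and chart_inv_snd = manifold_chart_inv_snd[OF mfd]
  and coord_vec_self = coord_vec_self[OF mfd one_le_infinity]
  and coord_vec_tangent = coord_vec_tangent[OF mfd one_le_infinity]
  and coord_vec_linear = coord_vec_linear[OF mfd one_le_infinity]
  and coord_vec_in_tangent_space = coord_vec_in_tangent_space[OF mfd one_le_infinity]
  and tangent_eqI = tangent_eqI[OF mfd one_le_infinity]
  and tangent_space_subspace = tangent_space_subspace[OF mfd one_le_infinity]

section \<open>The inverse diffeomorphism and the invariant bundles\<close>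

definition G :: "'m \<Rightarrow> 'm" where "G = inv_into (topspace M) f"

lemma f_bij: "bij_betw f (topspace M) (topspace M)"
  and f_C1: "Cr_map 1 M A M A f" and G_C1: "Cr_map 1 M A M A G"
  using ph unfolding partially_hyperbolic_def diffeomorphism_def G_def by auto

lemma f_continuous: "continuous_map M M f" and G_continuous: "continuous_map M M G"
  using f_C1 G_C1 unfolding Cr_map_def by auto

lemma f_in: "x \<in> topspace M \<Longrightarrow> f x \<in> topspace M" and G_in: "x \<in> topspace M \<Longrightarrow> G x \<in> topspace M"
  using f_continuous G_continuous unfolding continuous_map_def by auto

lemma f_G: "x \<in> topspace M \<Longrightarrow> f (G x) = x" and G_f: "x \<in> topspace M \<Longrightarrow> G (f x) = x"
  using f_bij unfolding G_def by (auto simp: bij_betw_inv_into_right bij_betw_inv_into_left)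

definition Ecs :: "'m \<Rightarrow> ('m, 'e) tvec set" where "Ecs = bundle_sum Ec Es"

lemma bundle_rank: "E \<in> {Es, Ec, Eu} \<Longrightarrow> \<exists>k\<ge>1. subbundle M A k E"
  and bundle_invariant: "E \<in> {Es, Ec, Eu} \<Longrightarrow> x \<in> topspace M \<Longrightarrow> tangent_map A A f x ` E x = E (f x)"
  using ph unfolding partially_hyperbolic_def by blast+

lemma bundle_subspace: "E \<in> {Es, Ec, Eu} \<Longrightarrow> x \<in> topspace M \<Longrightarrow> subspace (E x)"
  and bundle_tangent: "E \<in> {Es, Ec, Eu} \<Longrightarrow> x \<in> topspace M \<Longrightarrow> E x \<subseteq> tangent_space A x"
  using bundle_rank unfolding subbundle_def by blast+

text \<open>The inequalities of \<open>partially_hyperbolic\<close> quantify over unit vectors of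
  all three bundles at once; using the one for \<open>Eu\<close> therefore requires unit vectors of
  \<open>Es\<close> and \<open>Ec\<close> at the same point.\<close>

lemma bundle_nonzero:
  assumes "E \<in> {Es, Ec, Eu}" "x \<in> topspace M"
  shows "\<exists>v\<in>E x. v \<noteq> 0"
proof -
  obtain k where k: "k \<ge> 1" "subbundle M A k E" using bundle_rank[OF assms(1)] by blast
  from bspec[OF conjunct2[OF k(2)[unfolded subbundle_def]] assms(2)]
  obtain U and b :: "nat \<Rightarrow> _" where U: "x \<in> U" and b: "\<forall>y\<in>U. inj_on (\<lambda>i::nat. b i y) {..<k} \<and> independent ((\<lambda>i. b i y) ` {..<k}) \<and>
           span ((\<lambda>i. b i y) ` {..<k}) = E y"
    by (elim exE conjE)
  have b0: "b 0 x \<in> (\<lambda>i. b i x) ` {..<k}" using k(1) by simp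
  from bspec[OF b U] have ind: "independent ((\<lambda>i. b i x) ` {..<k})" and sp: "span ((\<lambda>i. b i x) ` {..<k}) = E x"
    by simp_all
  have "b 0 x \<in> E x" using span_base[OF b0] sp by simp
  moreover have "b 0 x \<noteq> 0" using b0 ind dependent_zero by metis
  ultimately show ?thesis by blast
qed

lemma Ecs_subspace: "x \<in> topspace M \<Longrightarrow> subspace (Ecs x)"
  using subspace_sums[of "Ec x" "Es x"] bundle_subspace by (simp add: Ecs_def bundle_sum_def)

lemma Ecs_tangent: "x \<in> topspace M \<Longrightarrow> Ecs x \<subseteq> tangent_space A x"
  using bundle_tangent[of Ec] bundle_tangent[of Es] subspace_add[OF tangent_space_subspace]
  unfolding Ecs_def bundle_sum_def by blast

lemma Eu_subspace: "x \<in> topspace M \<Longrightarrow> subspace (Eu x)"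
  and Eu_tangent: "x \<in> topspace M \<Longrightarrow> Eu x \<subseteq> tangent_space A x"
  using bundle_subspace bundle_tangent by auto

lemma splitting: "x \<in> topspace M \<Longrightarrow> v \<in> tangent_space A x \<Longrightarrow>
    \<exists>!(a, b, c). a \<in> Es x \<and> b \<in> Ec x \<and> c \<in> Eu x \<and> v = a + b + c"
  using ph[unfolded partially_hyperbolic_def splitting_def] by (elim conjE) (drule bspec, assumption, drule bspec)

lemma splitting_unique:
  assumes x: "x \<in> topspace M" and "a \<in> Es x" "b \<in> Ec x" "c \<in> Eu x" "a + b + c = 0"
  shows "a = 0 \<and> b = 0 \<and> c = 0"
proof -
  have "0 \<in> tangent_space A x" using tangent_space_subspace by (rule subspace_0)
  from splitting[OF x this] obtain t where
    t: "\<And>s. (case s of (a, b, c) \<Rightarrow> a \<in> Es x \<and> b \<in> Ec x \<and> c \<in> Eu x \<and> 0 = a + b + c) \<Longrightarrow> s = t"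
    by (elim ex1E) blast
  have "0 \<in> Es x" "0 \<in> Ec x" "0 \<in> Eu x" using bundle_subspace[OF _ x] by (auto simp: subspace_0)
  then have "(0, 0, 0) = t" by (intro t) simp
  moreover have "(a, b, c) = t" using assms(2-5) by (intro t) simp
  ultimately have "(a, b, c) = (0, 0, 0)" by simp
  then show ?thesis by simp
qed

lemma Ecs_Int_Eu: "x \<in> topspace M \<Longrightarrow> v \<in> Ecs x \<Longrightarrow> v \<in> Eu x \<Longrightarrow> v = 0"
proof -
  assume x: "x \<in> topspace M" and v: "v \<in> Ecs x" "v \<in> Eu x"
  obtain b a where "b \<in> Ec x" "a \<in> Es x" "v = b + a" using v(1) unfolding Ecs_def bundle_sum_def by blast
  moreover have "- v \<in> Eu x" using v(2) Eu_subspace[OF x] subspace_neg by blast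
  ultimately show "v = 0" using splitting_unique[OF x, of a b "- v"] by (simp add: add.commute)
qed

lemma Ec_Int_Es: "x \<in> topspace M \<Longrightarrow> v \<in> Ec x \<Longrightarrow> v \<in> Es x \<Longrightarrow> v = 0"
proof -
  assume x: "x \<in> topspace M" and v: "v \<in> Ec x" "v \<in> Es x"
  have "- v \<in> Es x" "0 \<in> Eu x" using v(2) bundle_subspace[OF _ x] subspace_neg subspace_0 by blast+
  then show "v = 0" using splitting_unique[OF x, of "- v" v 0] v by simp
qed

lemma Ecs_Eu_decomposition:
  assumes x: "x \<in> topspace M" and v: "v \<in> tangent_space A x"
  shows "\<exists>c. c \<in> Eu x \<and> v - c \<in> Ecs x"
proof -
  obtain a b c where "a \<in> Es x" "b \<in> Ec x" "c \<in> Eu x" "v = a + b + c"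
    using ex1_implies_ex[OF splitting[OF x v]] by auto
  then have "c \<in> Eu x" "v - c = b + a" by (auto simp: add.commute)
  then show ?thesis using \<open>a \<in> Es x\<close> \<open>b \<in> Ec x\<close> unfolding Ecs_def bundle_sum_def by blast
qed

text \<open>The projection onto \<open>Eu x\<close> along \<open>Ecs x\<close>, meaningful on
  tangent vectors only; \<open>pcs\<close> is the complementary projection.\<close>

definition pu :: "'m \<Rightarrow> ('m, 'e) tvec \<Rightarrow> ('m, 'e) tvec" where
  "pu x v = (SOME c. c \<in> Eu x \<and> v - c \<in> Ecs x)"

definition pcs :: "'m \<Rightarrow> ('m, 'e) tvec \<Rightarrow> ('m, 'e) tvec" where
  "pcs x v = v - pu x v"

lemma pu_in: "x \<in> topspace M \<Longrightarrow> v \<in> tangent_space A x \<Longrightarrow> pu x v \<in> Eu x"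
  and pcs_in: "x \<in> topspace M \<Longrightarrow> v \<in> tangent_space A x \<Longrightarrow> pcs x v \<in> Ecs x"
  using someI_ex[OF Ecs_Eu_decomposition] unfolding pu_def pcs_def by blast+

lemma pu_eqI:
  assumes x: "x \<in> topspace M" and c: "c \<in> Eu x" "v - c \<in> Ecs x"
  shows "pu x v = c"
proof -
  have 1: "pu x v \<in> Eu x" "v - pu x v \<in> Ecs x"
    using someI_ex[of "\<lambda>c. c \<in> Eu x \<and> v - c \<in> Ecs x"] c unfolding pu_def by blast+
  have "(v - c) - (v - pu x v) \<in> Ecs x" using subspace_diff[OF Ecs_subspace[OF x]] c 1 by blast
  then have "pu x v - c \<in> Ecs x" by simp
  moreover have "pu x v - c \<in> Eu x" using subspace_diff[OF Eu_subspace[OF x]] c 1 by blast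
  ultimately show ?thesis using Ecs_Int_Eu[OF x] by (metis eq_iff_diff_eq_0)
qed

lemma pu_combination:
  assumes x: "x \<in> topspace M" and v: "v \<in> tangent_space A x" "w \<in> tangent_space A x"
  shows "pu x (a *\<^sub>R v + b *\<^sub>R w) = a *\<^sub>R pu x v + b *\<^sub>R pu x w"
proof (rule pu_eqI[OF x])
  show "a *\<^sub>R pu x v + b *\<^sub>R pu x w \<in> Eu x"
    using Eu_subspace[OF x] pu_in[OF x] v by (intro subspace_add subspace_scale) auto
  have "a *\<^sub>R v + b *\<^sub>R w - (a *\<^sub>R pu x v + b *\<^sub>R pu x w) = a *\<^sub>R pcs x v + b *\<^sub>R pcs x w"
    by (simp add: pcs_def scaleR_diff_right)
  also have "\<dots> \<in> Ecs x"
    using Ecs_subspace[OF x] pcs_in[OF x] v by (intro subspace_add subspace_scale) auto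
  finally show "a *\<^sub>R v + b *\<^sub>R w - (a *\<^sub>R pu x v + b *\<^sub>R pu x w) \<in> Ecs x" .
qed

lemma pcs_combination:
  assumes x: "x \<in> topspace M" and v: "v \<in> tangent_space A x" "w \<in> tangent_space A x"
  shows "pcs x (a *\<^sub>R v + b *\<^sub>R w) = a *\<^sub>R pcs x v + b *\<^sub>R pcs x w"
  by (simp add: pcs_def pu_combination[OF assms] scaleR_diff_right)

section \<open>The given metric and the adapted metric\<close>

lemma g_commute: "x \<in> topspace M \<Longrightarrow> u \<in> tangent_space A x \<Longrightarrow> v \<in> tangent_space A x \<Longrightarrow> g x u v = g x v u"
  and g_pos: "x \<in> topspace M \<Longrightarrow> u \<in> tangent_space A x \<Longrightarrow> u \<noteq> 0 \<Longrightarrow> g x u u > 0"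
  and g_combination: "x \<in> topspace M \<Longrightarrow> u \<in> tangent_space A x \<Longrightarrow> v \<in> tangent_space A x \<Longrightarrow>
    w \<in> tangent_space A x \<Longrightarrow> g x (a *\<^sub>R u + b *\<^sub>R v) w = a * g x u w + b * g x v w"
  using metric unfolding riemannian_metric_def by blast+

lemma g_0: "x \<in> topspace M \<Longrightarrow> v \<in> tangent_space A x \<Longrightarrow> g x 0 v = 0"
  using g_combination[of x v v v 0 0] by simp

lemma g_scale: "x \<in> topspace M \<Longrightarrow> v \<in> tangent_space A x \<Longrightarrow> g x (k *\<^sub>R v) (k *\<^sub>R v) = k\<^sup>2 * g x v v"
proof -
  assume x: "x \<in> topspace M" and v: "v \<in> tangent_space A x"
  then have kv: "k *\<^sub>R v \<in> tangent_space A x" using tangent_space_subspace subspace_scale by blast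
  have "g x (k *\<^sub>R v) (k *\<^sub>R v) = k * g x v (k *\<^sub>R v)" using g_combination[OF x v v kv, of k 0] by simp
  also have "g x v (k *\<^sub>R v) = k * g x v v"
    using g_combination[OF x v v v, of k 0] g_commute[OF x v kv] by simp
  finally show ?thesis by (simp add: power2_eq_square)
qed

text \<open>The adapted metric: it keeps \<open>g\<close> on \<open>Eu\<close> and on
  \<open>Ecs\<close> but declares the two orthogonal. As it agrees with \<open>g\<close> on
  \<open>Eu\<close>, the hyperbolicity estimate there carries over unchanged.\<close>

definition Q :: "'m \<Rightarrow> ('m, 'e) tvec \<Rightarrow> ('m, 'e) tvec \<Rightarrow> real" where
  "Q x v w = g x (pu x v) (pu x w) + g x (pcs x v) (pcs x w)"

lemma pu_tangent: "x \<in> topspace M \<Longrightarrow> v \<in> tangent_space A x \<Longrightarrow> pu x v \<in> tangent_space A x"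
  and pcs_tangent: "x \<in> topspace M \<Longrightarrow> v \<in> tangent_space A x \<Longrightarrow> pcs x v \<in> tangent_space A x"
  using pu_in Eu_tangent pcs_in Ecs_tangent by blast+

lemma Q_commute: "x \<in> topspace M \<Longrightarrow> v \<in> tangent_space A x \<Longrightarrow> w \<in> tangent_space A x \<Longrightarrow> Q x v w = Q x w v"
  unfolding Q_def using g_commute pu_tangent pcs_tangent by simp

lemma Q_combination: "x \<in> topspace M \<Longrightarrow> u \<in> tangent_space A x \<Longrightarrow> v \<in> tangent_space A x \<Longrightarrow>
    w \<in> tangent_space A x \<Longrightarrow> Q x (a *\<^sub>R u + b *\<^sub>R v) w = a * Q x u w + b * Q x v w"
  unfolding Q_def
  by (simp add: pu_combination pcs_combination g_combination pu_tangent pcs_tangent distrib_left)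

lemma Q_pos:
  assumes x: "x \<in> topspace M" and v: "v \<in> tangent_space A x" "v \<noteq> 0"
  shows "Q x v v > 0"
proof -
  have nonneg: "g x w w \<ge> 0" if "w \<in> tangent_space A x" for w
    using g_pos[OF x that] g_0[OF x that] by (cases "w = 0") auto
  have "pu x v \<noteq> 0 \<or> pcs x v \<noteq> 0" using v(2) by (auto simp: pcs_def)
  then show ?thesis
    using g_pos[OF x] nonneg pu_tangent[OF x v(1)] pcs_tangent[OF x v(1)] unfolding Q_def
    by (metis add_nonneg_pos add_pos_nonneg)
qed

lemma Q_Eu: "x \<in> topspace M \<Longrightarrow> v \<in> Eu x \<Longrightarrow> Q x v v = g x v v"
proof -
  assume x: "x \<in> topspace M" and v: "v \<in> Eu x"
  have "pu x v = v" by (rule pu_eqI[OF x v]) (simp add: subspace_0[OF Ecs_subspace[OF x]])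
  then show ?thesis using g_0[OF x subspace_0[OF tangent_space_subspace]] by (simp add: Q_def pcs_def)
qed

text \<open>Test with \<open>w = pcs x v\<close>: the product is then the \<open>g\<close>-square of
  the center-stable part of \<open>v\<close>, which must vanish.\<close>

lemma Q_orthogonal_Ecs:
  assumes x: "x \<in> topspace M" and v: "v \<in> tangent_space A x" and orth: "\<And>w. w \<in> Ecs x \<Longrightarrow> Q x v w = 0"
  shows "v \<in> Eu x"
proof -
  have w: "pcs x v \<in> Ecs x" by (rule pcs_in[OF x v])
  have "pu x (pcs x v) = 0" by (rule pu_eqI[OF x]) (simp_all add: w subspace_0[OF Eu_subspace[OF x]])
  then have "Q x v (pcs x v) = g x (pu x v) 0 + g x (pcs x v) (pcs x v)"
    by (simp add: Q_def pcs_def[of x "pcs x v"])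
  also have "g x (pu x v) 0 = 0"
    using g_commute[OF x pu_tangent[OF x v]] g_0[OF x pu_tangent[OF x v]]
      subspace_0[OF tangent_space_subspace] by metis
  finally have "g x (pcs x v) (pcs x v) = 0" using orth[OF w] by simp
  then have "pcs x v = 0" using g_pos[OF x pcs_tangent[OF x v]] by force
  then show ?thesis using pu_in[OF x v] by (simp add: pcs_def)
qed

section \<open>The action of \<open>f\<close> and its inverse on the bundles\<close>

lemma tangent_map_G_f:
  assumes x: "x \<in> topspace M" and v: "v \<in> E x" and E: "E \<in> {Es, Ec, Eu}"
  shows "tangent_map A A G (f x) (tangent_map A A f x v) = v"
proof (rule tangent_map_left_inverse[OF mfd _ mfd _ f_C1 G_C1 G_f x])
  show "v \<in> tangent_space A x" using v bundle_tangent[OF E x] by blast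
  have "tangent_map A A f x v \<in> E (f x)" using v bundle_invariant[OF E x] by blast
  then show "tangent_map A A f x v \<in> tangent_space A (f x)" using bundle_tangent[OF E f_in[OF x]] by blast
qed simp_all

text \<open>The form needed to transport tangency: a center-stable vector at the image point must
  come from one at \<open>x\<close>, whose curve is then pushed forward.\<close>

lemma Ecs_invariant_f: "x \<in> topspace M \<Longrightarrow> Ecs (f x) \<subseteq> tangent_map A A f x ` Ecs x"
proof
  fix w assume x: "x \<in> topspace M" and "w \<in> Ecs (f x)"
  then obtain b a where "b \<in> Ec (f x)" "a \<in> Es (f x)" "w = b + a" unfolding Ecs_def bundle_sum_def by blast
  moreover from this have "b \<in> tangent_map A A f x ` Ec x" "a \<in> tangent_map A A f x ` Es x"
    using bundle_invariant[OF _ x, of Ec] bundle_invariant[OF _ x, of Es] by simp_all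
  ultimately obtain b' a' where "b' \<in> Ec x" "a' \<in> Es x" "w = tangent_map A A f x b' + tangent_map A A f x a'"
    by blast
  then show "w \<in> tangent_map A A f x ` Ecs x"
    unfolding Ecs_def bundle_sum_def using linear_add[OF tangent_map_linear[OF mfd mfd f_C1 x]]
    by (metis (mono_tags, lifting) image_eqI mem_Collect_eq)
qed

text \<open>The preimage is explicit: apply the derivative of \<open>f\<close> to each summand,
  which the derivative of \<open>G\<close> undoes.\<close>

lemma Ecs_invariant_G: "x \<in> topspace M \<Longrightarrow> Ecs (G x) \<subseteq> tangent_map A A G x ` Ecs x"
proof
  fix w assume x: "x \<in> topspace M" and "w \<in> Ecs (G x)"
  then obtain b a where ba: "b \<in> Ec (G x)" "a \<in> Es (G x)" "w = b + a" unfolding Ecs_def bundle_sum_def by blast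
  let ?b = "tangent_map A A f (G x) b" and ?a = "tangent_map A A f (G x) a"
  have "?b \<in> Ec x" "?a \<in> Es x"
    using ba bundle_invariant[OF _ G_in[OF x], of Ec] bundle_invariant[OF _ G_in[OF x], of Es] f_G[OF x] by auto
  moreover have "tangent_map A A G x (?b + ?a) = w"
    using tangent_map_G_f[where E=Ec, OF G_in[OF x] ba(1)] tangent_map_G_f[where E=Es, OF G_in[OF x] ba(2)] ba(3)
      linear_add[OF tangent_map_linear[OF mfd mfd G_C1 x]] by (simp add: f_G[OF x])
  ultimately show "w \<in> tangent_map A A G x ` Ecs x"
    unfolding Ecs_def bundle_sum_def by blast
qed

lemma unstable_expanded:
  assumes x: "x \<in> topspace M" and "vs \<in> Es x" "vc \<in> Ec x" "vu \<in> Eu x"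
    and "tnorm g x vs = 1" "tnorm g x vc = 1" "tnorm g x vu = 1"
  shows "1 < tnorm g (f x) (tangent_map A A f x vu)"
proof -
  from ph[unfolded partially_hyperbolic_def]
  have "\<forall>x\<in>topspace M. \<forall>vs\<in>Es x. \<forall>vc\<in>Ec x. \<forall>vu\<in>Eu x.
        tnorm g x vs = 1 \<and> tnorm g x vc = 1 \<and> tnorm g x vu = 1 \<longrightarrow>
        (let n = (\<lambda>v. tnorm g (f x) (tangent_map A A f x v))
         in n vs < n vc \<and> n vc < n vu \<and> n vs < 1 \<and> 1 < n vu)" by (elim conjE)
  from this[THEN bspec, OF assms(1), THEN bspec, OF assms(2), THEN bspec, OF assms(3), THEN bspec, OF assms(4)] assms(5-7)
  show ?thesis by (simp add: Let_def)
qed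

text \<open>\<open>v\<close> is the image of some \<open>w\<close> in \<open>Eu\<close> at
  \<open>G x\<close>. Rescaling \<open>w\<close> to unit length makes the expansion by
  \<open>f\<close> applicable, and reading it backwards gives contraction by \<open>G\<close>. The
  inequality is strict but carries no uniform constant yet.\<close>

lemma Eu_contracted:
  assumes x: "x \<in> topspace M" and v: "v \<in> Eu x" "v \<noteq> 0"
  shows "tangent_map A A G x v \<in> tangent_space A (G x)"
    and "Q (G x) (tangent_map A A G x v) (tangent_map A A G x v) < Q x v v"
proof -
  let ?y = "G x"
  have y: "?y \<in> topspace M" "f ?y = x" using x G_in f_G by auto
  have "v \<in> tangent_map A A f ?y ` Eu ?y"
    using v(1) bundle_invariant[OF _ y(1), of Eu] y(2) by simp
  then obtain w where w: "w \<in> Eu ?y" "tangent_map A A f ?y w = v" by blast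
  have Gv: "tangent_map A A G x v = w" using tangent_map_G_f[where E=Eu, OF y(1) w(1)] w(2) y(2) by simp
  have wT: "w \<in> tangent_space A ?y" using w(1) Eu_tangent[OF y(1)] by blast
  then show "tangent_map A A G x v \<in> tangent_space A (G x)" by (simp add: Gv)
  have lin: "linear (tangent_map A A f ?y)" by (rule tangent_map_linear[OF mfd mfd f_C1 y(1)])
  have w0: "w \<noteq> 0" using w(2) v(2) linear_0[OF lin] by auto
  have unit: "\<exists>k>0. tnorm g ?y (k *\<^sub>R u) = 1 \<and> k\<^sup>2 * g ?y u u = 1"
    if "u \<in> tangent_space A ?y" "u \<noteq> 0" for u
  proof -
    have p: "g ?y u u > 0" by (rule g_pos[OF y(1) that])
    then show ?thesis
      by (intro exI[of _ "1 / sqrt (g ?y u u)"]) (simp add: tnorm_def g_scale[OF y(1) that(1)] power_divide)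
  qed
  have unitE: "\<exists>u\<in>E ?y. tnorm g ?y u = 1" if "E \<in> {Es, Ec, Eu}" for E
    using bundle_nonzero[OF that y(1)] unit bundle_tangent[OF that y(1)] bundle_subspace[OF that y(1)] subspace_scale
    by (metis subsetD)
  obtain vs vc where vs: "vs \<in> Es ?y" "tnorm g ?y vs = 1" and vc: "vc \<in> Ec ?y" "tnorm g ?y vc = 1"
    using unitE[of Es] unitE[of Ec] by auto
  obtain k where k: "k > 0" "tnorm g ?y (k *\<^sub>R w) = 1" "k\<^sup>2 * g ?y w w = 1" using unit[OF wT w0] by blast
  have "k *\<^sub>R w \<in> Eu ?y" using w(1) Eu_subspace[OF y(1)] subspace_scale by blast
  then have "1 < tnorm g (f ?y) (tangent_map A A f ?y (k *\<^sub>R w))"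
    using unstable_expanded[OF y(1) vs(1) vc(1) _ vs(2) vc(2) k(2)] by simp
  then have "1 < g x (k *\<^sub>R v) (k *\<^sub>R v)"
    using linear_scale[OF lin] w(2) y(2) by (simp add: tnorm_def)
  also have "\<dots> = k\<^sup>2 * g x v v" using g_scale[OF x] v(1) Eu_tangent[OF x] by blast
  finally have "k\<^sup>2 * g ?y w w < k\<^sup>2 * g x v v" using k(3) by simp
  then have "g ?y w w < g x v v" using k(1) by simp
  then show "Q (G x) (tangent_map A A G x v) (tangent_map A A G x v) < Q x v v"
    by (simp add: Gv Q_Eu[OF y(1) w(1)] Q_Eu[OF x v(1)])
qed

section \<open>Continuity of the bundles and of the adapted metric in coordinates\<close>

lemma bundle_limit:
  assumes "E \<in> {Es, Ec, Eu}" "c \<in> A" "x \<in> fst c" "\<And>i::nat. xs i \<in> fst c"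
    "(\<lambda>i. snd c (xs i)) \<longlonglongrightarrow> snd c x" "\<And>i. a i \<in> (\<lambda>v. v c) ` E (xs i)" "a \<longlonglongrightarrow> l"
  shows "l \<in> (\<lambda>v. v c) ` E x"
  using bundle_rank[OF assms(1)] subbundle_limit[where E=E, OF mfd one_le_infinity _ assms(2-7)] by auto

lemma bundle_approx:
  assumes "E \<in> {Es, Ec, Eu}" "c \<in> A" "x \<in> fst c" "\<And>i::nat. xs i \<in> fst c"
    "(\<lambda>i. snd c (xs i)) \<longlonglongrightarrow> snd c x" "w \<in> E x"
  shows "\<exists>ws. (\<forall>i. ws i \<in> E (xs i)) \<and> (\<lambda>i. ws i c) \<longlonglongrightarrow> w c"
  using bundle_rank[OF assms(1)] subbundle_approx[where E=E, OF mfd _ assms(2-6)] by auto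

lemma in_charts_at: "c \<in> A \<Longrightarrow> x \<in> fst c \<Longrightarrow> c \<in> charts_at A x"
  by (simp add: charts_at_def)

lemma coordinate_subspace: "subspace (E x) \<Longrightarrow> subspace ((\<lambda>v::('m, 'e) tvec. v c) ` E x)"
  by (rule linear_subspace_image[OF linear_tvec_apply])

lemma coordinate_Int:
  assumes "c \<in> A" "x \<in> fst c" "E \<subseteq> tangent_space A x" "F \<subseteq> tangent_space A x" "E \<inter> F \<subseteq> {0}"
  shows "(\<lambda>v. v c) ` E \<inter> (\<lambda>v. v c) ` F \<subseteq> {0}"
proof
  fix z assume "z \<in> (\<lambda>v. v c) ` E \<inter> (\<lambda>v. v c) ` F"
  then obtain v w where vw: "v \<in> E" "w \<in> F" "z = v c" "z = w c" by blast
  then have "v = w" using tangent_eqI[OF _ _ in_charts_at[OF assms(1,2)], of v w] assms(3,4) by auto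
  then have "v = 0" using vw assms(5) by blast
  then show "z \<in> {0}" using vw by simp
qed

text \<open>Closedness passes from \<open>Ec\<close> and \<open>Es\<close> to their sum because they
  stay transverse in the limit, so the summands of a convergent sequence converge
  separately.\<close>

lemma Ecs_limit:
  assumes c: "c \<in> A" and x: "x \<in> fst c" and xs: "\<And>i::nat. xs i \<in> fst c"
    and lim: "(\<lambda>i. snd c (xs i)) \<longlonglongrightarrow> snd c x" and a: "\<And>i. a i \<in> (\<lambda>v. v c) ` Ecs (xs i)" "a \<longlonglongrightarrow> l"
  shows "l \<in> (\<lambda>v. v c) ` Ecs x"
proof -
  have M: "x \<in> topspace M" "xs i \<in> topspace M" for i using chart_subset[OF c] x xs by auto
  have "\<exists>b s. b \<in> (\<lambda>v. v c) ` Ec (xs i) \<and> s \<in> (\<lambda>v. v c) ` Es (xs i) \<and> a i = b + s" for i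
  proof -
    obtain v b s where "b \<in> Ec (xs i)" "s \<in> Es (xs i)" "v = b + s" "a i = v c"
      using a(1)[of i] unfolding Ecs_def bundle_sum_def by blast
    then show ?thesis by (intro exI[of _ "b c"] exI[of _ "s c"]) auto
  qed
  then obtain b s where bs: "\<And>i. b i \<in> (\<lambda>v. v c) ` Ec (xs i)" "\<And>i. s i \<in> (\<lambda>v. v c) ` Es (xs i)" "\<And>i. a i = b i + s i"
    by metis
  have "\<exists>b0\<in>(\<lambda>v. v c) ` Ec x. \<exists>s0\<in>(\<lambda>v. v c) ` Es x. b0 + s0 = l \<and> b \<longlonglongrightarrow> b0 \<and> s \<longlonglongrightarrow> s0"
  proof (rule complementary_summands_tendsto[where E="\<lambda>i. (\<lambda>v. v c) ` Ec (xs i)" and F="\<lambda>i. (\<lambda>v. v c) ` Es (xs i)"])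
    show "(\<lambda>v. v c) ` Ec x \<inter> (\<lambda>v. v c) ` Es x \<subseteq> {0}"
      by (rule coordinate_Int[OF c x]) (use bundle_tangent M Ec_Int_Es in auto)
    show "(\<lambda>i. b i + s i) \<longlonglongrightarrow> l" using a(2) by (simp add: bs(3)[symmetric])
  next
    fix r :: "nat \<Rightarrow> nat" and a l assume r: "strict_mono r" and "\<And>i. a i \<in> (\<lambda>v. v c) ` Ec (xs (r i))" "a \<longlonglongrightarrow> l"
    then show "l \<in> (\<lambda>v. v c) ` Ec x"
      using LIMSEQ_subseq_LIMSEQ[OF lim r] by (intro bundle_limit[of Ec c x "xs \<circ> r" a l]) (auto simp: c x xs o_def)
  next
    fix r :: "nat \<Rightarrow> nat" and a l assume r: "strict_mono r" and "\<And>i. a i \<in> (\<lambda>v. v c) ` Es (xs (r i))" "a \<longlonglongrightarrow> l"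
    then show "l \<in> (\<lambda>v. v c) ` Es x"
      using LIMSEQ_subseq_LIMSEQ[OF lim r] by (intro bundle_limit[of Es c x "xs \<circ> r" a l]) (auto simp: c x xs o_def)
  qed (use bs bundle_subspace M in \<open>simp_all add: coordinate_subspace\<close>)
  then obtain v w where "v \<in> Ec x" "w \<in> Es x" "v c + w c = l" by blast
  then have "v + w \<in> Ecs x" "l = (v + w) c" unfolding Ecs_def bundle_sum_def by auto
  then show ?thesis by blast
qed

lemma Ecs_approx:
  assumes c: "c \<in> A" and x: "x \<in> fst c" and xs: "\<And>i::nat. xs i \<in> fst c"
    and lim: "(\<lambda>i. snd c (xs i)) \<longlonglongrightarrow> snd c x" and w: "w \<in> Ecs x"
  shows "\<exists>ws. (\<forall>i. ws i \<in> Ecs (xs i)) \<and> (\<lambda>i. ws i c) \<longlonglongrightarrow> w c"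
proof -
  obtain b s where bs: "b \<in> Ec x" "s \<in> Es x" "w = b + s" using w unfolding Ecs_def bundle_sum_def by blast
  obtain bi si where i: "\<forall>i. bi i \<in> Ec (xs i)" "(\<lambda>i. bi i c) \<longlonglongrightarrow> b c" "\<forall>i. si i \<in> Es (xs i)" "(\<lambda>i. si i c) \<longlonglongrightarrow> s c"
    using bundle_approx[of Ec c x xs b] bundle_approx[of Es c x xs s] c x xs lim bs by auto
  have "bi i + si i \<in> Ecs (xs i)" for i using i unfolding Ecs_def bundle_sum_def by blast
  moreover have "(\<lambda>i. (bi i + si i) c) \<longlonglongrightarrow> w c" unfolding bs(3) plus_fun_apply by (intro tendsto_add i)
  ultimately show ?thesis by (intro exI[of _ "\<lambda>i. bi i + si i"]) blast
qed

text \<open>Continuity of the two projections, with base points and vectors both moving: the parts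
  converge separately by transversality, and uniqueness of the decomposition identifies their
  limits.\<close>

lemma pu_pcs_tendsto:
  assumes c: "c \<in> A" and x: "x \<in> fst c" and xs: "\<And>i::nat. xs i \<in> fst c"
    and lim: "(\<lambda>i. snd c (xs i)) \<longlonglongrightarrow> snd c x" and a: "a \<longlonglongrightarrow> l"
  shows "(\<lambda>i. pu (xs i) (coord_vec A c (xs i) (a i)) c) \<longlonglongrightarrow> pu x (coord_vec A c x l) c"
    and "(\<lambda>i. pcs (xs i) (coord_vec A c (xs i) (a i)) c) \<longlonglongrightarrow> pcs x (coord_vec A c x l) c"
proof -
  have M: "x \<in> topspace M" "xs i \<in> topspace M" for i using chart_subset[OF c] x xs by auto
  let ?v = "\<lambda>i. coord_vec A c (xs i) (a i)"
  have T: "?v i \<in> tangent_space A (xs i)" for i by (rule coord_vec_in_tangent_space[OF in_charts_at[OF c xs]])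
  have "\<exists>b0\<in>(\<lambda>v. v c) ` Eu x. \<exists>c0\<in>(\<lambda>v. v c) ` Ecs x. b0 + c0 = l \<and>
      (\<lambda>i. pu (xs i) (?v i) c) \<longlonglongrightarrow> b0 \<and> (\<lambda>i. pcs (xs i) (?v i) c) \<longlonglongrightarrow> c0"
  proof (rule complementary_summands_tendsto[where E="\<lambda>i. (\<lambda>v. v c) ` Eu (xs i)" and F="\<lambda>i. (\<lambda>v. v c) ` Ecs (xs i)"])
    show "(\<lambda>v. v c) ` Eu x \<inter> (\<lambda>v. v c) ` Ecs x \<subseteq> {0}"
      by (rule coordinate_Int[OF c x]) (use Eu_tangent Ecs_tangent M Ecs_Int_Eu in auto)
    have "pu (xs i) (?v i) c + pcs (xs i) (?v i) c = a i" for i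
      by (simp add: pcs_def coord_vec_self[OF in_charts_at[OF c xs]])
    then show "(\<lambda>i. pu (xs i) (?v i) c + pcs (xs i) (?v i) c) \<longlonglongrightarrow> l" using a by simp
  next
    fix r :: "nat \<Rightarrow> nat" and a l assume r: "strict_mono r" and "\<And>i. a i \<in> (\<lambda>v. v c) ` Eu (xs (r i))" "a \<longlonglongrightarrow> l"
    then show "l \<in> (\<lambda>v. v c) ` Eu x"
      using LIMSEQ_subseq_LIMSEQ[OF lim r] by (intro bundle_limit[of Eu c x "xs \<circ> r" a l]) (auto simp: c x xs o_def)
  next
    fix r :: "nat \<Rightarrow> nat" and a l assume r: "strict_mono r" and "\<And>i. a i \<in> (\<lambda>v. v c) ` Ecs (xs (r i))" "a \<longlonglongrightarrow> l"
    then show "l \<in> (\<lambda>v. v c) ` Ecs x"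
      using LIMSEQ_subseq_LIMSEQ[OF lim r] by (intro Ecs_limit[of c x "xs \<circ> r" a l]) (auto simp: c x xs o_def)
  qed (use Eu_subspace Ecs_subspace M pu_in[OF M(2) T] pcs_in[OF M(2) T] in \<open>simp_all add: coordinate_subspace\<close>)
  then obtain v w where vw: "v \<in> Eu x" "w \<in> Ecs x" "v c + w c = l"
    and l: "(\<lambda>i. pu (xs i) (?v i) c) \<longlonglongrightarrow> v c" "(\<lambda>i. pcs (xs i) (?v i) c) \<longlonglongrightarrow> w c" by blast
  have "v + w \<in> tangent_space A x"
    using vw Eu_tangent[OF M(1)] Ecs_tangent[OF M(1)] by (intro subspace_add tangent_space_subspace) auto
  then have vw': "coord_vec A c x l = v + w"
    using coord_vec_tangent[OF _ in_charts_at[OF c x], of "v + w"] vw(3) by simp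
  have "pu x (coord_vec A c x l) = v" by (rule pu_eqI[OF M(1) vw(1)]) (simp add: vw' vw(2))
  moreover from this have "pcs x (coord_vec A c x l) = w" by (simp add: pcs_def vw')
  ultimately show "(\<lambda>i. pu (xs i) (?v i) c) \<longlonglongrightarrow> pu x (coord_vec A c x l) c"
    "(\<lambda>i. pcs (xs i) (?v i) c) \<longlonglongrightarrow> pcs x (coord_vec A c x l) c" using l by simp_all
qed

text \<open>\<open>riemannian_metric\<close> controls \<open>g\<close> only on vectors with constant
  coordinates; expansion in the basis extends its continuity to moving coordinates.\<close>

lemma g_coord_sum:
  assumes c: "c \<in> A" and x: "x \<in> fst c"
  shows "g x (coord_vec A c x a) (coord_vec A c x b) =
    (\<Sum>i\<in>Basis. \<Sum>j\<in>Basis. (a \<bullet> i) * (b \<bullet> j) * g x (coord_vec A c x i) (coord_vec A c x j))"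
proof -
  have M: "x \<in> topspace M" using chart_subset[OF c] x by auto
  note cx = in_charts_at[OF c x]
  note T = coord_vec_in_tangent_space[OF cx]
  have lin1: "linear (\<lambda>a. g x (coord_vec A c x a) w)" if "w \<in> tangent_space A x" for w
  proof (rule linearI)
    fix a b k
    show "g x (coord_vec A c x (a + b)) w = g x (coord_vec A c x a) w + g x (coord_vec A c x b) w"
      using g_combination[OF M T[of a] T[of b] that, of 1 1] by (simp add: linear_add[OF coord_vec_linear[OF cx]])
    show "g x (coord_vec A c x (k *\<^sub>R a)) w = k *\<^sub>R g x (coord_vec A c x a) w"
      using g_combination[OF M T[of a] T[of a] that, of k 0] by (simp add: linear_scale[OF coord_vec_linear[OF cx]])
  qed
  have "g x (coord_vec A c x a) (coord_vec A c x b) =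
     (\<Sum>i\<in>Basis. (a \<bullet> i) * g x (coord_vec A c x i) (coord_vec A c x b))"
    using linear_eq_sum_Basis[OF lin1[OF T[of b]], of a] by simp
  also have "\<dots> = (\<Sum>i\<in>Basis. (a \<bullet> i) * g x (coord_vec A c x b) (coord_vec A c x i))"
    by (simp add: g_commute[OF M T[of _] T[of b]])
  also have "\<dots> = (\<Sum>i\<in>Basis. (a \<bullet> i) * (\<Sum>j\<in>Basis. (b \<bullet> j) * g x (coord_vec A c x j) (coord_vec A c x i)))"
    by (rule sum.cong) (use linear_eq_sum_Basis[OF lin1[OF T], of b] in simp_all)
  also have "\<dots> = (\<Sum>i\<in>Basis. \<Sum>j\<in>Basis. (a \<bullet> i) * (b \<bullet> j) * g x (coord_vec A c x i) (coord_vec A c x j))"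
    unfolding sum_distrib_left by (intro sum.cong refl) (metis M T g_commute mult.assoc)
  finally show ?thesis .
qed

lemma g_tendsto:
  assumes c: "c \<in> A" and x: "x \<in> fst c" and xs: "\<And>i::nat. xs i \<in> fst c"
    and lim: "(\<lambda>i. snd c (xs i)) \<longlonglongrightarrow> snd c x" and a: "a \<longlonglongrightarrow> l" and b: "b \<longlonglongrightarrow> m"
  shows "(\<lambda>i. g (xs i) (coord_vec A c (xs i) (a i)) (coord_vec A c (xs i) (b i)))
    \<longlonglongrightarrow> g x (coord_vec A c x l) (coord_vec A c x m)"
proof -
  have "(\<lambda>i. g (xs i) (coord_vec A c (xs i) p) (coord_vec A c (xs i) q)) \<longlonglongrightarrow> g x (coord_vec A c x p) (coord_vec A c x q)" for p q
  proof -
    note * = spec[OF spec[OF bspec[OF conjunct2[OF metric[unfolded riemannian_metric_def]] c], of p], of q]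
    from continuous_on_tendsto_compose[OF Cr_on_continuous[OF *] lim] x xs
    show ?thesis by (simp add: Let_def chart_inv_snd[OF c])
  qed
  then have "(\<lambda>n. \<Sum>i\<in>Basis. \<Sum>j\<in>Basis. (a n \<bullet> i) * (b n \<bullet> j) * g (xs n) (coord_vec A c (xs n) i) (coord_vec A c (xs n) j))
    \<longlonglongrightarrow> (\<Sum>i\<in>Basis. \<Sum>j\<in>Basis. (l \<bullet> i) * (m \<bullet> j) * g x (coord_vec A c x i) (coord_vec A c x j))"
    by (intro tendsto_intros a b)
  moreover have "(\<lambda>n. g (xs n) (coord_vec A c (xs n) (a n)) (coord_vec A c (xs n) (b n))) =
    (\<lambda>n. \<Sum>i\<in>Basis. \<Sum>j\<in>Basis. (a n \<bullet> i) * (b n \<bullet> j) * g (xs n) (coord_vec A c (xs n) i) (coord_vec A c (xs n) j))"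
    by (rule ext) (rule g_coord_sum[OF c xs])
  moreover note g_coord_sum[OF c x, of l m]
  ultimately show ?thesis by (simp only:)
qed

text \<open>Transfers the adapted metric to the model space, where its values at different base
  points become comparable.\<close>

definition Qc :: "('m, 'e) chart \<Rightarrow> 'm \<Rightarrow> 'e \<Rightarrow> 'e \<Rightarrow> real" where
  "Qc c x a b = Q x (coord_vec A c x a) (coord_vec A c x b)"

lemma Qc_tendsto:
  assumes c: "c \<in> A" and x: "x \<in> fst c" and xs: "\<And>i::nat. xs i \<in> fst c"
    and lim: "(\<lambda>i. snd c (xs i)) \<longlonglongrightarrow> snd c x" and a: "a \<longlonglongrightarrow> l" and b: "b \<longlonglongrightarrow> m"
  shows "(\<lambda>i. Qc c (xs i) (a i) (b i)) \<longlonglongrightarrow> Qc c x l m"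
proof -
  \<comment> \<open>Each projected vector is rewritten as the vector with its own coordinates, the
    shape to which continuity of \<open>g\<close> applies.\<close>
  have eq: "Qc c y p q =
      g y (coord_vec A c y (pu y (coord_vec A c y p) c)) (coord_vec A c y (pu y (coord_vec A c y q) c)) +
      g y (coord_vec A c y (pcs y (coord_vec A c y p) c)) (coord_vec A c y (pcs y (coord_vec A c y q) c))"
    if y: "y \<in> fst c" for y p q
  proof -
    have M: "y \<in> topspace M" using chart_subset[OF c] y by auto
    note cy = in_charts_at[OF c y]
    show ?thesis
      unfolding Qc_def Q_def
      by (simp add: coord_vec_tangent[OF _ cy] pu_tangent[OF M] pcs_tangent[OF M] coord_vec_in_tangent_space[OF cy])
  qed
  show ?thesis
    unfolding eq[OF x] eq[OF xs]
    by (intro tendsto_add g_tendsto[OF c x xs lim] pu_pcs_tendsto[OF c x xs lim] a b)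
qed

lemma Qc_bilinear:
  assumes c: "c \<in> A" and x: "x \<in> fst c"
  shows Qc_commute: "Qc c x a b = Qc c x b a"
    and Qc_add_left: "Qc c x (a + a') b = Qc c x a b + Qc c x a' b"
    and Qc_scale_left: "Qc c x (k *\<^sub>R a) b = k * Qc c x a b"
    and Qc_pos: "a \<noteq> 0 \<Longrightarrow> Qc c x a a > 0"
proof -
  have M: "x \<in> topspace M" using chart_subset[OF c] x by auto
  note cx = in_charts_at[OF c x]
  note T = coord_vec_in_tangent_space[OF cx]
  show "Qc c x a b = Qc c x b a" unfolding Qc_def by (rule Q_commute[OF M T T])
  show "Qc c x (a + a') b = Qc c x a b + Qc c x a' b"
    unfolding Qc_def using Q_combination[OF M T[of a] T[of a'] T[of b], of 1 1]
    by (simp add: linear_add[OF coord_vec_linear[OF cx]])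
  show "Qc c x (k *\<^sub>R a) b = k * Qc c x a b"
    unfolding Qc_def using Q_combination[OF M T[of a] T[of a] T[of b], of k 0]
    by (simp add: linear_scale[OF coord_vec_linear[OF cx]])
  assume "a \<noteq> 0"
  then have "coord_vec A c x a \<noteq> 0" using coord_vec_self[OF cx, of a] by auto
  then show "Qc c x a a > 0" unfolding Qc_def by (rule Q_pos[OF M T])
qed

end

section \<open>The distance to a center-stable set\<close>

context ph_system
begin

lemma Qc_scale:
  assumes "c \<in> A" "x \<in> fst c"
  shows "Qc c x (k *\<^sub>R a) (k *\<^sub>R a) = k\<^sup>2 * Qc c x a a"
  using Qc_scale_left[OF assms, of k a] Qc_commute[OF assms, of a "k *\<^sub>R a"]
  by (simp add: power2_eq_square)

lemma Qc_bounded_bilinear: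
  assumes "c \<in> A" "x \<in> fst c"
  shows "bounded_bilinear (Qc c x)"
proof -
  have "linear (\<lambda>a. Qc c x a b)" for b
    by (rule linearI) (simp_all add: Qc_add_left[OF assms] Qc_scale_left[OF assms])
  moreover from this have "linear (\<lambda>b. Qc c x a b)" for a by (simp add: Qc_commute[OF assms, of a])
  ultimately show ?thesis by (simp add: bilinear_conv_bounded_bilinear[symmetric] bilinear_def)
qed

text \<open>The base point will lie in the ball of radius \<open>r\<close>, the second point in that
  of radius \<open>2 * r\<close>. The gap ensures that points close to a base point still qualify;
  that both balls are closed and inside the chart keeps limits of coordinates there.\<close>

definition piece :: "('m, 'e) chart \<times> 'e \<times> real \<Rightarrow> bool" where
  "piece = (\<lambda>(c, p, r). c \<in> A \<and> r > 0 \<and> cball p (2 * r) \<subseteq> snd c ` fst c)"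

definition core :: "('m, 'e) chart \<times> 'e \<times> real \<Rightarrow> 'm set" where
  "core = (\<lambda>(c, p, r). {x \<in> fst c. snd c x \<in> cball p r})"

lemma finite_piece_cover: "\<exists>P. finite P \<and> (\<forall>t\<in>P. piece t) \<and> topspace M \<subseteq> (\<Union>t\<in>P. core t)"
proof -
  \<comment> \<open>Compactness needs open sets; the closed balls in \<open>core\<close> contain
    them.\<close>
  define Op where "Op = (\<lambda>(c::('m, 'e) chart, p, r). {x \<in> fst c. snd c x \<in> ball p r})"
  have "openin M (Op t)" if "piece t" for t
    using openin_chart_preimage[OF mfd _ open_ball] that by (auto simp: Op_def piece_def split: prod.splits)
  moreover have "topspace M \<subseteq> \<Union> (Op ` {t. piece t})"
  proof
    fix x assume "x \<in> topspace M"
    then obtain c where c: "c \<in> A" "x \<in> fst c" using chart_exists by blast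
    then obtain e where e: "e > 0" "cball (snd c x) e \<subseteq> snd c ` fst c"
      using chart_image_open[OF c(1)] open_contains_cball by blast
    have "piece (c, snd c x, e / 2)" using c e by (simp add: piece_def)
    moreover have "x \<in> Op (c, snd c x, e / 2)" using c e by (simp add: Op_def)
    ultimately show "x \<in> \<Union> (Op ` {t. piece t})" by blast
  qed
  ultimately obtain F where F: "finite F" "F \<subseteq> Op ` {t. piece t}" "topspace M \<subseteq> \<Union> F"
    using compact_M unfolding compact_space_alt by (metis (no_types, lifting) imageE mem_Collect_eq)
  obtain P where P: "P \<subseteq> {t. piece t}" "finite P" "F = Op ` P"
    using finite_subset_image[OF F(1,2)] by blast
  have "Op t \<subseteq> core t" for t by (auto simp: Op_def core_def split: prod.splits)
  then have "topspace M \<subseteq> (\<Union>t\<in>P. core t)" using F(3) P(3) by blast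
  then show ?thesis using P by blast
qed

definition pieces :: "(('m, 'e) chart \<times> 'e \<times> real) set" where
  "pieces = (SOME P. finite P \<and> (\<forall>t\<in>P. piece t) \<and> topspace M \<subseteq> (\<Union>t\<in>P. core t))"

text \<open>An arbitrary choice, in general discontinuous in \<open>x\<close>. As it takes only
  finitely many values, a sequence of points has a subsequence on which it is constant.\<close>

definition piece_of :: "'m \<Rightarrow> ('m, 'e) chart \<times> 'e \<times> real" where
  "piece_of x = (SOME t. t \<in> pieces \<and> x \<in> core t)"

lemma pieces: "finite pieces" "t \<in> pieces \<Longrightarrow> piece t" "topspace M \<subseteq> (\<Union>t\<in>pieces. core t)"
  using someI_ex[OF finite_piece_cover] unfolding pieces_def by blast+

lemma piece_of: "x \<in> topspace M \<Longrightarrow> piece_of x \<in> pieces \<and> x \<in> core (piece_of x)"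
  unfolding piece_of_def by (rule someI_ex) (use pieces(3) in blast)

lemma piece_of_eq:
  assumes "x \<in> topspace M" "piece_of x = (c, p, r)"
  shows "c \<in> A" "r > 0" "cball p (2 * r) \<subseteq> snd c ` fst c" "x \<in> fst c" "snd c x \<in> cball p r"
  using piece_of[OF assms(1)] pieces(2)[of "(c, p, r)"] assms(2) by (auto simp: piece_def core_def)

text \<open>Not symmetric in general: the larger ball used is the one chosen for
  \<open>x\<close>.\<close>

definition near :: "'m \<Rightarrow> 'm \<Rightarrow> bool" where
  "near x y = (case piece_of x of (c, p, r) \<Rightarrow> y \<in> fst c \<and> snd c y \<in> cball p (2 * r))"

text \<open>The squared distance from \<open>x\<close> to \<open>y\<close> in the chart selected for \<open>x\<close>, measured by the adapted
  metric at \<open>x\<close>; only meaningful if \<open>near x y\<close>. Freezing the metric at \<open>x\<close> makes it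
  smooth in \<open>y\<close>, although the splitting is only continuous.\<close>

definition D2 :: "'m \<Rightarrow> 'm \<Rightarrow> real" where
  "D2 x y = (case piece_of x of (c, p, r) \<Rightarrow> Qc c x (snd c y - snd c x) (snd c y - snd c x))"

lemma Qc_0: "c \<in> A \<Longrightarrow> x \<in> fst c \<Longrightarrow> Qc c x 0 a = 0"
  using Qc_scale_left[of c x 0 0 a] by simp

section \<open>Convergence expressed through \<open>near\<close> and \<open>D2\<close>\<close>

lemma near_refl: "x \<in> topspace M \<Longrightarrow> near x x" and D2_refl: "x \<in> topspace M \<Longrightarrow> D2 x x = 0"
proof -
  assume x: "x \<in> topspace M"
  obtain c p r where t: "piece_of x = (c, p, r)" by (cases "piece_of x")
  note P = piece_of_eq[OF x t]
  show "near x x" using P by (simp add: near_def t)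
  show "D2 x x = 0" using Qc_0[OF P(1,4)] by (simp add: D2_def t)
qed

text \<open>Pigeonhole on the finitely many pieces, then compactness of the coordinate ball.\<close>

lemma piece_subsequence:
  assumes xs: "\<And>i::nat. xs i \<in> topspace M"
  shows "\<exists>r c p \<rho> x. strict_mono (r::nat \<Rightarrow> nat) \<and> (\<forall>i. piece_of (xs (r i)) = (c, p, \<rho>)) \<and>
    x \<in> fst c \<and> (\<lambda>i. snd c (xs (r i))) \<longlonglongrightarrow> snd c x"
proof -
  have "finite ((\<lambda>i. piece_of (xs i)) ` UNIV)"
    by (rule finite_subset[OF _ pieces(1)]) (use piece_of[OF xs] in auto)
  then obtain i0 where "infinite {i. piece_of (xs i) = piece_of (xs i0)}"
    using pigeonhole_infinite[OF infinite_UNIV_nat] by auto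
  from infinite_enumerate[OF this] obtain r :: "nat \<Rightarrow> nat"
    where r: "strict_mono r" "\<forall>i. piece_of (xs (r i)) = piece_of (xs i0)" by auto
  obtain c p \<rho> where t: "piece_of (xs i0) = (c, p, \<rho>)" by (cases "piece_of (xs i0)")
  note P = piece_of_eq[OF xs t]
  have "snd c (xs (r i)) \<in> cball p \<rho>" for i using piece_of_eq(5)[OF xs] r(2) t by metis
  then obtain l r' where l: "l \<in> cball p \<rho>" "strict_mono (r'::nat \<Rightarrow> nat)" "((\<lambda>i. snd c (xs (r i))) \<circ> r') \<longlonglongrightarrow> l"
    using compact_cball[of p \<rho>] unfolding compact_def by (metis (no_types, lifting))
  have "l \<in> snd c ` fst c" using l(1) P(2) by (intro subsetD[OF P(3)]) auto
  then obtain x where "x \<in> fst c" "l = snd c x" by blast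
  then show ?thesis using strict_mono_o[OF r(1) l(2)] l(3) r(2) t by (intro exI[of _ "r \<circ> r'"] exI[of _ c] exI[of _ p] exI[of _ \<rho>] exI[of _ x]) (simp add: o_def)
qed

text \<open>The second points stay in the compact ball of radius \<open>2 * \<rho>\<close>, so their
  coordinates subconverge; the limit has adapted distance 0 from \<open>x\<close>, and positive
  definiteness identifies it.\<close>

lemma near_subsequence:
  assumes xs: "\<And>i::nat. xs i \<in> topspace M" and near: "\<And>i. near (xs i) (ys i)" and D2: "(\<lambda>i. D2 (xs i) (ys i)) \<longlonglongrightarrow> 0"
  shows "\<exists>r c p \<rho> x. strict_mono (r::nat \<Rightarrow> nat) \<and> (\<forall>i. piece_of (xs (r i)) = (c, p, \<rho>)) \<and>
    x \<in> fst c \<and> (\<lambda>i. snd c (xs (r i))) \<longlonglongrightarrow> snd c x \<and> (\<lambda>i. snd c (ys (r i))) \<longlonglongrightarrow> snd c x"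
proof -
  obtain r c p \<rho> x where r: "strict_mono (r::nat \<Rightarrow> nat)" "\<And>i. piece_of (xs (r i)) = (c, p, \<rho>)"
    and x: "x \<in> fst c" and lim: "(\<lambda>i. snd c (xs (r i))) \<longlonglongrightarrow> snd c x"
    using piece_subsequence[of xs, OF xs] by blast
  have c: "c \<in> A" and xc: "\<And>i. xs (r i) \<in> fst c" using piece_of_eq[OF xs r(2)] by auto
  have "snd c (ys (r i)) \<in> cball p (2 * \<rho>)" for i using near[of "r i"] by (simp add: near_def r(2))
  then obtain l r' where r': "strict_mono (r'::nat \<Rightarrow> nat)" and l: "((\<lambda>i. snd c (ys (r i))) \<circ> r') \<longlonglongrightarrow> l"
    using compact_cball[of p "2 * \<rho>"] unfolding compact_def by (metis (no_types, lifting))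
  have lim': "(\<lambda>i. snd c (xs (r (r' i)))) \<longlonglongrightarrow> snd c x"
    using LIMSEQ_subseq_LIMSEQ[OF lim r'] by (simp add: o_def)
  have l': "(\<lambda>i. snd c (ys (r (r' i)))) \<longlonglongrightarrow> l" using l by (simp add: o_def)
  let ?a = "\<lambda>i. snd c (ys (r (r' i))) - snd c (xs (r (r' i)))"
  have "(\<lambda>i. Qc c (xs (r (r' i))) (?a i) (?a i)) \<longlonglongrightarrow> Qc c x (l - snd c x) (l - snd c x)"
    by (intro Qc_tendsto[OF c x xc lim'] tendsto_diff l' lim')
  moreover have "(\<lambda>i. Qc c (xs (r (r' i))) (?a i) (?a i)) \<longlonglongrightarrow> 0"
    using LIMSEQ_subseq_LIMSEQ[OF LIMSEQ_subseq_LIMSEQ[OF D2 r(1)] r'] by (simp add: D2_def r(2) o_def)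
  ultimately have "Qc c x (l - snd c x) (l - snd c x) = 0" by (rule LIMSEQ_unique)
  then have "l = snd c x" using Qc_pos[OF c x, of "l - snd c x"] by fastforce
  then show ?thesis using strict_mono_o[OF r(1) r'] r(2) x lim' l'
    by (intro exI[of _ "r \<circ> r'"] exI[of _ c] exI[of _ p] exI[of _ \<rho>] exI[of _ x]) (simp add: o_def)
qed

text \<open>The substitute for a triangle inequality: points at distance tending to 0 from a
  convergent sequence subconverge to the same limit. The chart limit is identified with
  \<open>x\<close> by the Hausdorff property.\<close>

lemma near_limitin:
  assumes xs: "\<And>i::nat. xs i \<in> topspace M" and near: "\<And>i. near (xs i) (ys i)" and D2: "(\<lambda>i. D2 (xs i) (ys i)) \<longlonglongrightarrow> 0"
    and lim: "limitin M xs x sequentially"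
  shows "\<exists>r. strict_mono (r::nat \<Rightarrow> nat) \<and> limitin M (ys \<circ> r) x sequentially"
proof -
  obtain r c p \<rho> y where r: "strict_mono (r::nat \<Rightarrow> nat)" "\<And>i. piece_of (xs (r i)) = (c, p, \<rho>)"
    and y: "y \<in> fst c" "(\<lambda>i. snd c (xs (r i))) \<longlonglongrightarrow> snd c y" "(\<lambda>i. snd c (ys (r i))) \<longlonglongrightarrow> snd c y"
    using near_subsequence[of xs ys, OF xs near D2] by blast
  have c: "c \<in> A" and xc: "\<And>i. xs (r i) \<in> fst c" using piece_of_eq[OF xs r(2)] by auto
  have yc: "ys (r i) \<in> fst c" for i using near[of "r i"] by (simp add: near_def r(2))
  have "limitin M (xs \<circ> r) y sequentially"
    by (rule chart_tendsto_imp_limitin[OF mfd c y(1)]) (simp_all add: xc y o_def)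
  moreover have "limitin M (xs \<circ> r) x sequentially" by (rule limitin_subsequence[OF r(1) lim])
  ultimately have "y = x" using limitin_Hausdorff_unique[OF _ _ _ Hausdorff_M] by (metis trivial_limit_sequentially)
  moreover have "limitin M (ys \<circ> r) y sequentially"
    by (rule chart_tendsto_imp_limitin[OF mfd c y(1)]) (simp_all add: yc y o_def)
  ultimately show ?thesis using r(1) by blast
qed

lemma near_neighbourhood:
  assumes x0: "x0 \<in> topspace M" and \<epsilon>: "\<epsilon> > 0"
  shows "\<exists>W. openin M W \<and> x0 \<in> W \<and> (\<forall>x\<in>W. \<forall>y\<in>W. near x y \<and> D2 x y < \<epsilon>)"
proof (rule ccontr)
  assume no: "\<nexists>W. openin M W \<and> x0 \<in> W \<and> (\<forall>x\<in>W. \<forall>y\<in>W. near x y \<and> D2 x y < \<epsilon>)"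
  obtain c0 where c0: "c0 \<in> A" "x0 \<in> fst c0" using chart_exists[OF x0] by blast
  define W where "W n = {x \<in> fst c0. snd c0 x \<in> ball (snd c0 x0) (inverse (real (Suc n)))}" for n
  have "openin M (W n) \<and> x0 \<in> W n" for n
    using openin_chart_preimage[OF mfd c0(1) open_ball] c0(2) by (simp add: W_def)
  then have "\<exists>x\<in>W n. \<exists>y\<in>W n. \<not> (near x y \<and> D2 x y < \<epsilon>)" for n using no by blast
  then obtain xs ys where xy: "\<And>n. xs n \<in> W n" "\<And>n. ys n \<in> W n" "\<And>n. \<not> (near (xs n) (ys n) \<and> D2 (xs n) (ys n) < \<epsilon>)"
    by metis
  have limW: "limitin M zs x0 sequentially" if "\<And>n. zs n \<in> W n" for zs
  proof (rule chart_tendsto_imp_limitin[OF mfd c0])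
    have "(\<lambda>n. dist (snd c0 (zs n)) (snd c0 x0)) \<longlonglongrightarrow> 0"
    proof (rule tendsto_sandwich[OF _ _ tendsto_const LIMSEQ_inverse_real_of_nat])
      show "\<forall>\<^sub>F n in sequentially. dist (snd c0 (zs n)) (snd c0 x0) \<le> inverse (real (Suc n))"
        using that by (intro always_eventually allI) (auto simp: W_def dist_commute less_imp_le)
    qed simp
    then show "(\<lambda>n. snd c0 (zs n)) \<longlonglongrightarrow> snd c0 x0" by (rule tendsto_dist_iff[THEN iffD2])
    show "\<forall>\<^sub>F n in sequentially. zs n \<in> fst c0" using that by (simp add: W_def)
  qed
  have xM: "xs n \<in> topspace M" for n using xy(1)[of n] chart_subset[OF c0(1)] by (auto simp: W_def)
  obtain r c p \<rho> x where r: "strict_mono (r::nat \<Rightarrow> nat)" "\<And>i. piece_of (xs (r i)) = (c, p, \<rho>)"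
    and x: "x \<in> fst c" "(\<lambda>i. snd c (xs (r i))) \<longlonglongrightarrow> snd c x"
    using piece_subsequence[of xs, OF xM] by blast
  note P = piece_of_eq[OF xM r(2)]
  have "limitin M (xs \<circ> r) x sequentially"
    by (rule chart_tendsto_imp_limitin[OF mfd P(1) x(1)]) (simp_all add: P x o_def)
  moreover have "limitin M (xs \<circ> r) x0 sequentially" by (rule limitin_subsequence[OF r(1) limW[OF xy(1)]])
  ultimately have xx0: "x = x0" using limitin_Hausdorff_unique[OF _ _ _ Hausdorff_M] by (metis trivial_limit_sequentially)
  have "limitin M (ys \<circ> r) x sequentially" unfolding xx0 by (rule limitin_subsequence[OF r(1) limW[OF xy(2)]])
  from limitin_imp_chart_tendsto[OF mfd this P(1) x(1)]
  have ev: "\<forall>\<^sub>F i in sequentially. ys (r i) \<in> fst c" and y: "(\<lambda>i. snd c (ys (r i))) \<longlonglongrightarrow> snd c x"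
    by (simp_all add: o_def)
  let ?a = "\<lambda>i. snd c (ys (r i)) - snd c (xs (r i))"
  have a: "?a \<longlonglongrightarrow> 0" using tendsto_diff[OF y x(2)] by simp
  have "(\<lambda>i. Qc c (xs (r i)) (?a i) (?a i)) \<longlonglongrightarrow> Qc c x 0 0"
    by (intro Qc_tendsto[OF P(1) x(1) P(4) x(2)] a)
  then have "(\<lambda>i. D2 (xs (r i)) (ys (r i))) \<longlonglongrightarrow> 0" by (simp add: D2_def r(2) Qc_0[OF P(1) x(1)])
  then have "\<forall>\<^sub>F i in sequentially. D2 (xs (r i)) (ys (r i)) < \<epsilon>" using \<epsilon> by (rule order_tendstoD)
  moreover have "\<forall>\<^sub>F i in sequentially. norm (?a i) < \<rho>"
    using order_tendstoD(2)[OF tendsto_norm[OF a], of \<rho>] P(2) by simp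
  ultimately have "\<forall>\<^sub>F i in sequentially. False" using ev
  proof eventually_elim
    case (elim i)
    \<comment> \<open>The first point lies within \<open>\<rho>\<close> of the centre and the
      displacement is shorter than \<open>\<rho>\<close>: the factor 2 in \<open>near\<close>
      absorbs both.\<close>
    have "dist p (snd c (ys (r i))) \<le> dist p (snd c (xs (r i))) + norm (?a i)"
      using dist_triangle[of p "snd c (ys (r i))" "snd c (xs (r i))"] by (simp add: dist_norm norm_minus_commute)
    also have "\<dots> \<le> 2 * \<rho>" using P(5)[of i] elim by simp
    finally have "near (xs (r i)) (ys (r i))" using elim by (simp add: near_def r(2))
    then show False using xy(3) elim by blast
  qed
  then show False by simp
qed

text \<open>Every vector of \<open>Ecs\<close> at a point of \<open>T\<close> is the velocity of a curve in \<open>T\<close>: all that the argument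
  needs from tangency, and stable under \<open>f\<close> and its inverse.\<close>

definition cs_set :: "'m set \<Rightarrow> bool" where
  "cs_set T \<longleftrightarrow> compactin M T \<and>
     (\<forall>y\<in>T. \<forall>w\<in>Ecs y. \<forall>c\<in>charts_at A y. \<exists>h. h 0 = snd c y \<and> (h has_vector_derivative w c) (at (0::real)) \<and>
        (\<forall>\<^sub>F t in at 0. h t \<in> snd c ` (T \<inter> fst c)))"

lemma cs_setD:
  assumes "cs_set T" "y \<in> T" "w \<in> Ecs y" "c \<in> A" "y \<in> fst c"
  obtains h where "h 0 = snd c y" "(h has_vector_derivative w c) (at (0::real))"
    "\<forall>\<^sub>F t in at 0. h t \<in> snd c ` (T \<inter> fst c)"
  using assms in_charts_at[OF assms(4,5)] unfolding cs_set_def by blast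

text \<open>By \<open>inv\<close>, a center-stable vector at the image comes from one at the source;
  its curve, pushed through \<open>F\<close> in charts, has the required velocity by the chain
  rule.\<close>

lemma cs_set_image:
  assumes F: "Cr_map 1 M A M A F" and inv: "\<And>x. x \<in> topspace M \<Longrightarrow> Ecs (F x) \<subseteq> tangent_map A A F x ` Ecs x"
    and T: "cs_set T"
  shows "cs_set (F ` T)"
  unfolding cs_set_def
proof (intro conjI ballI)
  have TM: "T \<subseteq> topspace M" using T unfolding cs_set_def by (blast dest: compactin_subset_topspace)
  have Fc: "continuous_map M M F" using F unfolding Cr_map_def by blast
  show "compactin M (F ` T)" using T image_compactin[OF _ Fc] unfolding cs_set_def by blast
  fix y' w' d assume y': "y' \<in> F ` T" and w': "w' \<in> Ecs y'" and d: "d \<in> charts_at A y'"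
  obtain y where y: "y \<in> T" "y' = F y" using y' by blast
  then have yM: "y \<in> topspace M" using TM by blast
  obtain w where w: "w \<in> Ecs y" "w' = tangent_map A A F y w" using w' inv[OF yM] y(2) by blast
  obtain c where c: "c \<in> A" "y \<in> fst c" using chart_exists[OF yM] by blast
  have d': "d \<in> A" "F y \<in> fst d" using d y(2) by (auto simp: charts_at_def)
  obtain h where h: "h 0 = snd c y" "(h has_vector_derivative w c) (at (0::real))"
    "\<forall>\<^sub>F t in at 0. h t \<in> snd c ` (T \<inter> fst c)"
    by (rule cs_setD[OF T y(1) w(1) c])
  let ?k = "snd d \<circ> F \<circ> chart_inv c"
  have k: "(?k has_derivative frechet_derivative ?k (at (snd c y))) (at (snd c y))"
    by (rule Cr_map_chart_has_derivative[OF mfd F chart_openin c(1) d'(1) c(2) d'(2)])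
  have w'd: "w' d = frechet_derivative ?k (at (snd c y)) (w c)"
    unfolding w(2) by (rule tangent_map_chart[OF mfd one_le_infinity mfd F])
      (use w(1) Ecs_tangent[OF yM] c d y(2) in \<open>auto intro: in_charts_at\<close>)
  have "((?k \<circ> h) has_derivative (frechet_derivative ?k (at (snd c y)) \<circ> (\<lambda>t. t *\<^sub>R w c))) (at 0)"
    using h(1,2) k unfolding has_vector_derivative_def by (intro diff_chain_at) auto
  then have "((?k \<circ> h) has_vector_derivative w' d) (at 0)"
    using linear_scale[OF has_derivative_linear[OF k]] by (simp add: has_vector_derivative_def w'd o_def)
  moreover have "(?k \<circ> h) 0 = snd d y'" by (simp add: h(1) chart_inv_snd[OF c] y(2))
  moreover have "\<forall>\<^sub>F t in at 0. (?k \<circ> h) t \<in> snd d ` (F ` T \<inter> fst d)"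
  proof -
    have "(h \<longlongrightarrow> snd c y) (at 0)"
      using has_vector_derivative_continuous[OF h(2)] h(1) by (simp add: isCont_def)
    moreover have "open (snd c ` {x \<in> fst c. F x \<in> fst d})"
      by (rule Cr_map_chart_open[where h=F and d=d, OF mfd F chart_openin c(1) d'(1) c(2) d'(2)])
    moreover have "snd c y \<in> snd c ` {x \<in> fst c. F x \<in> fst d}" using c d' by blast
    ultimately have "\<forall>\<^sub>F t in at 0. h t \<in> snd c ` {x \<in> fst c. F x \<in> fst d}" by (rule topological_tendstoD)
    with h(3) show ?thesis
    proof eventually_elim
      case (elim t)
      obtain z where z: "z \<in> T" "z \<in> fst c" "h t = snd c z" using elim(1) by blast
      obtain z' where z': "z' \<in> fst c" "F z' \<in> fst d" "h t = snd c z'" using elim(2) by blast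
      have "z' = z" using inj_onD[OF chart_inj[OF c(1)], of z' z] z z' by simp
      then show ?case using z z' by (auto simp: chart_inv_snd[OF c(1)])
    qed
  qed
  ultimately show "\<exists>h. h 0 = snd d y' \<and> (h has_vector_derivative w' d) (at (0::real)) \<and>
        (\<forall>\<^sub>F t in at 0. h t \<in> snd d ` (F ` T \<inter> fst d))" by blast
qed

lemma cs_set_f: "cs_set T \<Longrightarrow> cs_set (f ` T)" and cs_set_G: "cs_set T \<Longrightarrow> cs_set (G ` T)"
  using cs_set_image[OF f_C1 Ecs_invariant_f] cs_set_image[OF G_C1 Ecs_invariant_G] by auto

text \<open>The possibly finer topology of \<open>S\<close> is harmless: continuity of the inclusion
  makes \<open>topspace S\<close> compact in \<open>M\<close>, and the curves come from charts of
  \<open>S\<close> itself.\<close>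

lemma cs_set_submanifold:
  fixes S :: "'m topology" and B :: "('m, 'd::euclidean_space) chart set"
  assumes S: "center_stable_submanifold M A Es Ec S B" and comp: "compact_space S"
  shows "cs_set (topspace S)"
  unfolding cs_set_def
proof (intro conjI ballI)
  have mS: "manifold 1 S B" and SM: "topspace S \<subseteq> topspace M" and i: "Cr_map 1 S B M A (\<lambda>x. x)"
    and tan: "\<forall>x\<in>topspace S. tangent_map B A (\<lambda>x. x) x ` tangent_space B x = Ecs x"
    using S unfolding center_stable_submanifold_def immersed_submanifold_def Ecs_def by auto
  have "continuous_map S M (\<lambda>x. x)" using i unfolding Cr_map_def by blast
  from image_compactin[OF _ this] comp show "compactin M (topspace S)" by (simp add: compact_space_def)
  fix y w d assume y: "y \<in> topspace S" and w: "w \<in> Ecs y" and d: "d \<in> charts_at A y"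
  have d': "d \<in> A" "y \<in> fst d" using d by (auto simp: charts_at_def)
  obtain c where c: "c \<in> B" "y \<in> fst c" using manifold_chart_exists[OF mS y] by blast
  from w tan y have "w \<in> tangent_map B A (\<lambda>x. x) y ` tangent_space B y" by simp
  then obtain s where s: "s \<in> tangent_space B y" "w = tangent_map B A (\<lambda>x. x) y s" by blast
  let ?k = "snd d \<circ> (\<lambda>x. x) \<circ> chart_inv c"
  have k: "(?k has_derivative frechet_derivative ?k (at (snd c y))) (at (snd c y))"
    by (rule Cr_map_chart_has_derivative[OF mS i chart_openin c(1) d'(1) c(2) d'(2)])
  have wd: "w d = frechet_derivative ?k (at (snd c y)) (s c)"
    unfolding s(2) by (rule tangent_map_chart[OF mS order_refl mfd i s(1)]) (use c d in \<open>auto simp: charts_at_def\<close>)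
  \<comment> \<open>A straight line in a chart of \<open>S\<close>, with the direction of a preimage
    of \<open>w\<close> under the inclusion; the inclusion maps it to the desired curve.\<close>
  let ?h = "\<lambda>t::real. snd c y + t *\<^sub>R s c"
  have "(?h has_derivative (\<lambda>t. t *\<^sub>R s c)) (at 0)" by (auto intro!: derivative_eq_intros)
  then have "((?k \<circ> ?h) has_derivative (frechet_derivative ?k (at (snd c y)) \<circ> (\<lambda>t. t *\<^sub>R s c))) (at 0)"
    using k by (intro diff_chain_at) auto
  then have "((?k \<circ> ?h) has_vector_derivative w d) (at 0)"
    using linear_scale[OF has_derivative_linear[OF k]] by (simp add: has_vector_derivative_def wd o_def)
  moreover have "(?k \<circ> ?h) 0 = snd d y" by (simp add: manifold_chart_inv_snd[OF mS c])
  moreover have "\<forall>\<^sub>F t in at 0. (?k \<circ> ?h) t \<in> snd d ` (topspace S \<inter> fst d)"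
  proof -
    have "(?h \<longlongrightarrow> snd c y + 0 *\<^sub>R s c) (at 0)" by (intro tendsto_intros)
    then have "(?h \<longlongrightarrow> snd c y) (at 0)" by simp
    moreover have "open (snd c ` {x \<in> fst c. x \<in> fst d})"
      by (rule Cr_map_chart_open[where h="\<lambda>x. x" and d=d, OF mS i chart_openin c(1) d'(1) c(2) d'(2)])
    moreover have "snd c y \<in> snd c ` {x \<in> fst c. x \<in> fst d}" using c d' by blast
    ultimately have "\<forall>\<^sub>F t in at 0. ?h t \<in> snd c ` {x \<in> fst c. x \<in> fst d}" by (rule topological_tendstoD)
    then show ?thesis
    proof eventually_elim
      case (elim t)
      obtain z where z: "z \<in> fst c" "z \<in> fst d" "?h t = snd c z" using elim by blast
      have "z \<in> topspace S" using manifold_chart_subset[OF mS c(1)] z(1) by blast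
      then show ?case using z by (auto simp: manifold_chart_inv_snd[OF mS c(1)])
    qed
  qed
  ultimately show "\<exists>h. h 0 = snd d y \<and> (h has_vector_derivative w d) (at (0::real)) \<and>
        (\<forall>\<^sub>F t in at 0. h t \<in> snd d ` (topspace S \<inter> fst d))" by blast
qed

lemma minimizer:
  assumes x: "x \<in> topspace M" and T: "compactin M T" and y: "y \<in> T" "near x y"
  shows "\<exists>z\<in>T. near x z \<and> (\<forall>u\<in>T. near x u \<longrightarrow> D2 x z \<le> D2 x u)"
proof -
  obtain c p r where t: "piece_of x = (c, p, r)" by (cases "piece_of x")
  note P = piece_of_eq[OF x t]
  \<comment> \<open>The coordinates of the admissible points of \<open>T\<close>, written as a
    closed ball minus an open set to make compactness immediate.\<close>
  define K where "K = cball p (2 * r) - snd c ` (fst c \<inter> (topspace M - T))"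
  have K: "K = {snd c u |u. u \<in> T \<and> near x u}"
  proof (intro equalityI subsetI)
    fix b assume b: "b \<in> K"
    then obtain u where u: "u \<in> fst c" "b = snd c u" using P(3) by (auto simp: K_def)
    then have "u \<in> T" using b chart_subset[OF P(1)] by (auto simp: K_def)
    then show "b \<in> {snd c u |u. u \<in> T \<and> near x u}" using u b by (auto simp: near_def t K_def)
  next
    fix b assume "b \<in> {snd c u |u. u \<in> T \<and> near x u}"
    then obtain u where u: "u \<in> T" "u \<in> fst c" "b = snd c u" "b \<in> cball p (2 * r)"
      by (auto simp: near_def t)
    have "b \<noteq> snd c z" if "z \<in> fst c" "z \<notin> T" for z
    proof
      assume "b = snd c z"
      then have "z = u" using u(3) by (intro inj_onD[OF chart_inj[OF P(1)] _ that(1) u(2)]) simp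
      then show False using that(2) u(1) by simp
    qed
    then have "b \<notin> snd c ` (fst c \<inter> (topspace M - T))" by blast
    then show "b \<in> K" using u(4) by (simp add: K_def)
  qed
  have "closedin M T" using compactin_imp_closedin[OF Hausdorff_M T] .
  then have "open (snd c ` (fst c \<inter> (topspace M - T)))"
    by (intro open_chart_image[OF mfd P(1)]) (simp add: openin_diff)
  then have "compact K" unfolding K_def by (intro compact_diff) auto
  moreover have "K \<noteq> {}" unfolding K using y by blast
  moreover have "continuous_on K (\<lambda>b. Qc c x (b - snd c x) (b - snd c x))"
    by (intro bounded_bilinear.continuous_on[OF Qc_bounded_bilinear[OF P(1,4)]] continuous_intros)
  ultimately obtain b where b: "b \<in> K" "\<forall>b'\<in>K. Qc c x (b - snd c x) (b - snd c x) \<le> Qc c x (b' - snd c x) (b' - snd c x)"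
    using continuous_attains_inf by blast
  obtain z where z: "z \<in> T" "near x z" "b = snd c z" using b(1) K by blast
  have "D2 x z \<le> D2 x u" if "u \<in> T" "near x u" for u
  proof -
    have "snd c u \<in> K" unfolding K using that by blast
    then show ?thesis using b(2) z(3) by (simp add: D2_def t)
  qed
  then show ?thesis using z by blast
qed

end

section \<open>Contraction of the distance\<close>

context ph_system
begin

lemma D2_nonneg:
  assumes "x \<in> topspace M"
  shows "D2 x y \<ge> 0"
proof -
  obtain c p r where t: "piece_of x = (c, p, r)" by (cases "piece_of x")
  note P = piece_of_eq[OF assms t]
  show ?thesis using Qc_pos[OF P(1,4), of "snd c y - snd c x"] Qc_0[OF P(1,4), of 0]
    by (cases "snd c y - snd c x = 0") (auto simp: D2_def t)
qed

text \<open>First variation: along a curve in \<open>T\<close> with velocity \<open>w\<close>, the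
  squared distance has a local minimum at 0. With the metric frozen at \<open>x\<close> its
  derivative is a plain bilinear expression. The vector \<open>w\<close> lives at \<open>z\<close>
  while the form lives at \<open>x\<close>; they match only in the limit.\<close>

lemma minimizer_orthogonal:
  assumes x: "x \<in> topspace M" "piece_of x = (c, p, r)" and T: "cs_set T" and z: "z \<in> T" "near x z"
    and min: "\<And>u. u \<in> T \<Longrightarrow> near x u \<Longrightarrow> D2 x z \<le> D2 x u"
    and ball: "snd c z \<in> ball p (2 * r)" and w: "w \<in> Ecs z"
  shows "Qc c x (snd c z - snd c x) (w c) = 0"
proof -
  note P = piece_of_eq[OF x]
  note Q = Qc_bounded_bilinear[OF P(1,4)]
  have zc: "z \<in> fst c" using z(2) by (simp add: near_def x(2))
  obtain h where h: "h 0 = snd c z" "(h has_vector_derivative w c) (at (0::real))"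
    "\<forall>\<^sub>F t in at 0. h t \<in> snd c ` (T \<inter> fst c)"
    by (rule cs_setD[OF T z(1) w P(1) zc])
  let ?a = "\<lambda>t. h t - snd c x"
  let ?q = "\<lambda>t. Qc c x (?a t) (?a t)"
  have da: "(?a has_vector_derivative w c) (at 0)"
    using has_vector_derivative_diff[OF h(2) has_vector_derivative_const[of "snd c x"]] by simp
  have dq: "(?q has_real_derivative Qc c x (?a 0) (w c) + Qc c x (w c) (?a 0)) (at 0)"
    using bounded_bilinear.has_vector_derivative[OF Q da da]
    by (simp add: has_real_derivative_iff_has_vector_derivative)
  have "(h \<longlongrightarrow> snd c z) (at 0)"
    using has_vector_derivative_continuous[OF h(2)] h(1) by (simp add: isCont_def)
  \<comment> \<open>Interiority of \<open>z\<close> in the larger ball keeps the curve among the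
    points with which \<open>z\<close> was compared.\<close>
  then have "\<forall>\<^sub>F t in at 0. h t \<in> ball p (2 * r)" using ball by (intro topological_tendstoD) auto
  with h(3) have "\<forall>\<^sub>F t in at 0. ?q 0 \<le> ?q t"
  proof eventually_elim
    case (elim t)
    then obtain u where u: "u \<in> T" "u \<in> fst c" "h t = snd c u" by blast
    have "near x u" using u elim by (simp add: near_def x(2) less_imp_le)
    from min[OF u(1) this] show ?case by (simp add: D2_def x(2) u(3) h(1))
  qed
  then obtain d where d: "d > 0" "\<And>t. t \<noteq> 0 \<Longrightarrow> \<bar>t\<bar> < d \<Longrightarrow> ?q 0 \<le> ?q t"
    by (auto simp: eventually_at)
  have "Qc c x (?a 0) (w c) + Qc c x (w c) (?a 0) = 0"
  proof (rule DERIV_local_min[OF dq d(1)], intro allI impI)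
    fix t :: real assume "\<bar>0 - t\<bar> < d"
    then show "?q 0 \<le> ?q t" using d(2)[of t] by (cases "t = 0") auto
  qed
  then show ?thesis using Qc_commute[OF P(1,4), of "w c"] by (simp add: h(1))
qed

text \<open>By contradiction: along a sequence of counterexamples with distances tending to 0, the normalised
  displacements from \<open>x\<close> to a nearest point of \<open>T\<close> converge to a unit vector orthogonal to \<open>Ecs\<close>,
  hence in \<open>Eu\<close>, which \<open>G\<close> contracts strictly.\<close>

lemma distance_contracted:
  "\<exists>\<epsilon>>0. \<exists>\<kappa>\<ge>0. \<kappa> < 1 \<and> (\<forall>x\<in>topspace M. \<forall>T. cs_set T \<longrightarrow> (\<forall>y\<in>T. near x y \<and> D2 x y < \<epsilon> \<longrightarrow>
     (\<exists>y'\<in>G ` T. near (G x) y' \<and> D2 (G x) y' \<le> \<kappa> * D2 x y)))"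
proof (rule ccontr)
  assume no: "\<not> ?thesis"
  \<comment> \<open>Candidate factors tending to 1, paired with distance bounds
    \<open>1 / (n + 1)\<close>: if no uniform constants exist, each pair has a
    counterexample.\<close>
  define \<kappa> where "\<kappa> n = real n / real (Suc n)" for n
  have \<kappa>: "0 \<le> \<kappa> n" "\<kappa> n < 1" for n by (simp_all add: \<kappa>_def)
  have "\<exists>x T y. x \<in> topspace M \<and> cs_set T \<and> y \<in> T \<and> near x y \<and> D2 x y < inverse (real (Suc n)) \<and>
      (\<forall>y'\<in>G ` T. near (G x) y' \<longrightarrow> \<kappa> n * D2 x y < D2 (G x) y')" for n
  proof (rule ccontr)
    assume neg: "\<not> ?thesis"
    have *: "\<exists>y'\<in>G ` T. near (G x) y' \<and> D2 (G x) y' \<le> \<kappa> n * D2 x y"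
      if "x \<in> topspace M" "cs_set T" "y \<in> T" "near x y \<and> D2 x y < inverse (real (Suc n))" for x T y
      using neg that not_le by metis
    from no show False
      by (rule notE, intro exI[of _ "inverse (real (Suc n))"] exI[of _ "\<kappa> n"] conjI ballI allI impI)
         (use \<kappa>[of n] * in simp_all)
  qed
  then obtain xs Ts ys where xs: "\<And>n. xs n \<in> topspace M" and Ts: "\<And>n. cs_set (Ts n)"
    and ys: "\<And>n. ys n \<in> Ts n" "\<And>n. near (xs n) (ys n)" "\<And>n. D2 (xs n) (ys n) < inverse (real (Suc n))"
    and bad: "\<And>n y'. y' \<in> G ` Ts n \<Longrightarrow> near (G (xs n)) y' \<Longrightarrow> \<kappa> n * D2 (xs n) (ys n) < D2 (G (xs n)) y'"
    by metis
  have "\<exists>z\<in>Ts n. near (xs n) z \<and> (\<forall>u\<in>Ts n. near (xs n) u \<longrightarrow> D2 (xs n) z \<le> D2 (xs n) u)" for n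
    using minimizer[OF xs _ ys(1,2)] Ts unfolding cs_set_def by blast
  then obtain zs where zs: "\<And>n. zs n \<in> Ts n" "\<And>n. near (xs n) (zs n)"
    and min: "\<And>n u. u \<in> Ts n \<Longrightarrow> near (xs n) u \<Longrightarrow> D2 (xs n) (zs n) \<le> D2 (xs n) u" by metis
  \<comment> \<open>Passing to a nearest point only decreases the left-hand side.\<close>
  have bad': "\<kappa> n * D2 (xs n) (zs n) < D2 (G (xs n)) y'" if "y' \<in> G ` Ts n" "near (G (xs n)) y'" for n y'
    using bad[OF that] mult_left_mono[OF min[OF ys(1,2)[of n]] \<kappa>(1)[of n]] by linarith
  have D0: "(\<lambda>n. D2 (xs n) (zs n)) \<longlonglongrightarrow> 0"
  proof (rule tendsto_sandwich[OF _ _ tendsto_const LIMSEQ_inverse_real_of_nat])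
    show "\<forall>\<^sub>F n in sequentially. D2 (xs n) (zs n) \<le> inverse (real (Suc n))"
      using min[OF ys(1,2)] ys(3) by (intro always_eventually allI) (meson less_imp_le order_trans)
  qed (simp add: D2_nonneg xs)
  obtain r1 c p \<rho> x where r1: "strict_mono (r1::nat \<Rightarrow> nat)" "\<And>i. piece_of (xs (r1 i)) = (c, p, \<rho>)"
    and x: "x \<in> fst c" and xlim1: "(\<lambda>i. snd c (xs (r1 i))) \<longlonglongrightarrow> snd c x"
    and zlim1: "(\<lambda>i. snd c (zs (r1 i))) \<longlonglongrightarrow> snd c x"
    using near_subsequence[of xs zs, OF xs zs(2) D0] by blast
  \<comment> \<open>The images under \<open>G\<close> live in a chart of their own, so their piece
    is frozen by a second extraction; a third makes the displacement directions converge.\<close>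
  obtain r2 d q \<sigma> x' where r2: "strict_mono (r2::nat \<Rightarrow> nat)" "\<And>i. piece_of (G (xs (r1 (r2 i)))) = (d, q, \<sigma>)"
    and x': "x' \<in> fst d" and Glim2: "(\<lambda>i. snd d (G (xs (r1 (r2 i))))) \<longlonglongrightarrow> snd d x'"
    using piece_subsequence[of "\<lambda>i. G (xs (r1 i))"] G_in xs by blast
  define v where "v i = sgn (snd c (zs (r1 (r2 i))) - snd c (xs (r1 (r2 i))))" for i
  have "v i \<in> cball 0 1" for i by (simp add: v_def norm_sgn)
  then obtain v0 r3 where r3: "strict_mono (r3::nat \<Rightarrow> nat)" and vlim: "(v \<circ> r3) \<longlonglongrightarrow> v0"
    using compact_cball[of "0::'e" 1] unfolding compact_def by (metis (no_types, lifting))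
  define r where "r i = r1 (r2 (r3 i))" for i
  have mono: "strict_mono r"
    using strict_mono_o[OF r1(1) strict_mono_o[OF r2(1) r3]] by (simp add: r_def[abs_def] o_def)
  define X where "X i = xs (r i)" for i
  define Z where "Z i = zs (r i)" for i
  have XM: "X i \<in> topspace M" for i by (simp add: X_def xs)
  have pX: "piece_of (X i) = (c, p, \<rho>)" for i by (simp add: X_def r_def r1)
  have pGX: "piece_of (G (X i)) = (d, q, \<sigma>)" for i by (simp add: X_def r_def r2)
  note P = piece_of_eq[OF XM pX]
  note PG = piece_of_eq[OF G_in[OF XM] pGX]
  have r23: "strict_mono (r2 \<circ> r3)" by (rule strict_mono_o[OF r2(1) r3])
  have Xlim: "(\<lambda>i. snd c (X i)) \<longlonglongrightarrow> snd c x"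
    using LIMSEQ_subseq_LIMSEQ[OF xlim1 r23] by (simp add: X_def r_def o_def)
  have Zlim: "(\<lambda>i. snd c (Z i)) \<longlonglongrightarrow> snd c x"
    using LIMSEQ_subseq_LIMSEQ[OF zlim1 r23] by (simp add: Z_def r_def o_def)
  have GXlim: "(\<lambda>i. snd d (G (X i))) \<longlonglongrightarrow> snd d x'"
    using LIMSEQ_subseq_LIMSEQ[OF Glim2 r3] by (simp add: X_def r_def o_def)
  have xM: "x \<in> topspace M" using chart_subset[OF P(1)] x by blast
  have Zc: "Z i \<in> fst c" for i using zs(2)[of "r i"] pX by (simp add: near_def X_def Z_def)
  have "limitin M X x sequentially"
    by (rule chart_tendsto_imp_limitin[OF mfd P(1) x _ Xlim]) (simp add: P(4))
  from continuous_map_limit[OF G_continuous this] have "limitin M (\<lambda>i. G (X i)) (G x) sequentially"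
    by (simp add: o_def)
  moreover have "limitin M (\<lambda>i. G (X i)) x' sequentially"
    by (rule chart_tendsto_imp_limitin[OF mfd PG(1) x' _ GXlim]) (simp add: PG(4))
  ultimately have "x' = G x" using limitin_Hausdorff_unique[OF _ _ _ Hausdorff_M] by (metis trivial_limit_sequentially)
  then have Gx: "G x \<in> fst d" and GXlim: "(\<lambda>i. snd d (G (X i))) \<longlonglongrightarrow> snd d (G x)"
    using x' GXlim by simp_all

  define t where "t i = norm (snd c (Z i) - snd c (X i))" for i
  \<comment> \<open>Otherwise \<open>G (X i)\<close> would itself belong to the image set, at
    distance 0, contradicting strictness in \<open>bad'\<close>.\<close>
  have ZX: "snd c (Z i) \<noteq> snd c (X i)" for i
  proof
    assume "snd c (Z i) = snd c (X i)"
    then have "Z i = X i" by (rule inj_onD[OF chart_inj[OF P(1)] _ Zc P(4)])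
    then have "\<kappa> (r i) * D2 (X i) (X i) < D2 (G (X i)) (G (X i))"
      using bad'[of "G (Z i)" "r i"] zs(1)[of "r i"] near_refl[OF G_in[OF XM[of i]]] by (simp add: X_def Z_def)
    then show False using D2_refl[OF XM] D2_refl[OF G_in[OF XM]] by simp
  qed
  then have t0: "t i > 0" for i by (simp add: t_def)
  have tlim: "t \<longlonglongrightarrow> 0" using tendsto_norm[OF tendsto_diff[OF Zlim Xlim]] by (simp add: t_def[abs_def])
  define V where "V i = v (r3 i)" for i
  have Vlim: "V \<longlonglongrightarrow> v0" using vlim by (simp add: V_def[abs_def] o_def)
  have ZXV: "snd c (Z i) - snd c (X i) = t i *\<^sub>R V i" for i
    using ZX[of i] by (simp add: V_def v_def t_def Z_def X_def r_def sgn_div_norm)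
  have "norm (V i) = 1" for i
    using ZX[of i] by (simp add: V_def v_def norm_sgn Z_def X_def r_def)
  then have "norm v0 = 1" using tendsto_norm[OF Vlim] by (simp add: LIMSEQ_const_iff)
  then have v0: "v0 \<noteq> 0" by auto

  \<comment> \<open>Orthogonality is known against \<open>Ecs\<close> at the nearest points, so
    \<open>w\<close> is approximated by vectors there before passing to the limit.\<close>
  have orth: "Qc c x v0 (w c) = 0" if w: "w \<in> Ecs x" for w
  proof -
    obtain ws where ws: "\<And>i. ws i \<in> Ecs (Z i)" "(\<lambda>i. ws i c) \<longlonglongrightarrow> w c"
      using Ecs_approx[of c x Z w, OF P(1) x Zc Zlim w] by blast
    have lim: "(\<lambda>i. Qc c (X i) (V i) (ws i c)) \<longlonglongrightarrow> Qc c x v0 (w c)"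
      by (rule Qc_tendsto[OF P(1) x P(4) Xlim Vlim ws(2)])
    \<comment> \<open>The closed ball of radius \<open>\<rho>\<close> retains the limit, hence the
      nearest points are eventually interior to the ball of radius \<open>2 * \<rho>\<close>, as the
      first variation requires.\<close>
    have "snd c x \<in> cball p \<rho>"
      by (rule closed_sequentially[OF closed_cball P(5) Xlim])
    then have "snd c x \<in> ball p (2 * \<rho>)" using P(2) by simp
    then have "\<forall>\<^sub>F i in sequentially. snd c (Z i) \<in> ball p (2 * \<rho>)"
      using Zlim by (intro topological_tendstoD) auto
    then have "\<forall>\<^sub>F i in sequentially. Qc c (X i) (V i) (ws i c) = 0"
    proof eventually_elim
      case (elim i)
      have "Qc c (X i) (snd c (Z i) - snd c (X i)) (ws i c) = 0"
        by (rule minimizer_orthogonal[OF XM pX Ts[of "r i"] _ _ _ elim ws(1)])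
           (use zs[of "r i"] min[of _ "r i"] in \<open>simp_all add: X_def Z_def\<close>)
      then show ?case using t0[of i] by (simp add: ZXV Qc_scale_left[OF P(1,4)])
    qed
    then have "(\<lambda>i. Qc c (X i) (V i) (ws i c)) \<longlonglongrightarrow> 0" by (rule tendsto_eventually)
    with lim show ?thesis by (rule LIMSEQ_unique)
  qed
  note cx = in_charts_at[OF P(1) x]
  define W where "W = coord_vec A c x v0"
  have WT: "W \<in> tangent_space A x" unfolding W_def by (rule coord_vec_in_tangent_space[OF cx])
  have Wc: "W c = v0" unfolding W_def by (rule coord_vec_self[OF cx])
  have WEu: "W \<in> Eu x"
  proof (rule Q_orthogonal_Ecs[OF xM WT])
    fix w assume w: "w \<in> Ecs x"
    then have "coord_vec A c x (w c) = w" using coord_vec_tangent[OF _ cx] Ecs_tangent[OF xM] by blast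
    then show "Q x W w = 0" using orth[OF w] by (simp add: Qc_def W_def)
  qed
  have "W \<noteq> 0" using v0 Wc by auto
  note contr = Eu_contracted[OF xM WEu this]

  let ?k = "snd d \<circ> G \<circ> chart_inv c"
  let ?U = "snd c ` {y \<in> fst c. G y \<in> fst d}"
  have kC: "Cr_on 1 ?k ?U" and kO: "open ?U"
    using Cr_map_chart_Cr_on[where h=G and d=d, OF mfd G_C1 chart_openin P(1) PG(1) x Gx]
      Cr_map_chart_open[where h=G and d=d, OF mfd G_C1 chart_openin P(1) PG(1) x Gx] by simp_all
  have xU: "snd c x \<in> ?U" using x Gx by blast
  define u0 where "u0 = frechet_derivative ?k (at (snd c x)) v0"
  \<comment> \<open>The image displacement is divided by the same \<open>t i\<close> as the original
    one, so the factor \<open>(t i)\<^sup>2\<close> cancels from both squared distances.\<close>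
  define u where "u i = (?k (snd c (X i) + t i *\<^sub>R V i) - ?k (snd c (X i))) /\<^sub>R t i" for i
  have ulim: "u \<longlonglongrightarrow> u0"
    unfolding u_def[abs_def] u0_def
    by (rule C1_difference_quotient_tendsto[OF kC order_refl kO xU Xlim tlim t0 Vlim])
  have "tangent_map A A G x W d = u0"
    unfolding u0_def Wc[symmetric]
    by (rule tangent_map_chart[OF mfd one_le_infinity mfd G_C1 WT cx in_charts_at[OF PG(1) Gx]])
  then have "coord_vec A d (G x) u0 = tangent_map A A G x W"
    using coord_vec_tangent[OF contr(1) in_charts_at[OF PG(1) Gx]] by simp
  then have less: "Qc d (G x) u0 u0 < Qc c x v0 v0" using contr(2) by (simp add: Qc_def W_def)

  have kX: "?k (snd c (X i)) = snd d (G (X i))" and kZ: "?k (snd c (X i) + t i *\<^sub>R V i) = snd d (G (Z i))" for i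
    by (simp_all add: chart_inv_snd[OF P(1) P(4)] chart_inv_snd[OF P(1) Zc] ZXV[symmetric])
  have GZX: "snd d (G (Z i)) - snd d (G (X i)) = t i *\<^sub>R u i" for i
    using t0[of i] unfolding u_def kX kZ by simp
  have "(\<lambda>i. t i *\<^sub>R u i) \<longlonglongrightarrow> 0" using tendsto_scaleR[OF tlim ulim] by simp
  from tendstoD[OF this PG(2)] have tu: "\<forall>\<^sub>F i in sequentially. norm (t i *\<^sub>R u i) < \<sigma>"
    by (simp add: dist_norm)
  have "\<forall>\<^sub>F i in sequentially. snd c (Z i) \<in> ?U" using topological_tendstoD[OF Zlim kO xU] .
  with tu have ev: "\<forall>\<^sub>F i in sequentially. \<kappa> (r i) * Qc c (X i) (V i) (V i) \<le> Qc d (G (X i)) (u i) (u i)"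
  proof eventually_elim
    case (elim i)
    obtain y where y: "y \<in> fst c" "G y \<in> fst d" "snd c (Z i) = snd c y" using elim(2) by blast
    have "y = Z i" by (rule inj_onD[OF chart_inj[OF P(1)] y(3)[symmetric] y(1) Zc])
    then have GZd: "G (Z i) \<in> fst d" using y(2) by simp
    have "dist q (snd d (G (Z i))) \<le> dist q (snd d (G (X i))) + norm (t i *\<^sub>R u i)"
      using dist_triangle[of q "snd d (G (Z i))" "snd d (G (X i))"]
      by (simp only: GZX[symmetric] dist_norm norm_minus_commute)
    then have "near (G (X i)) (G (Z i))" using GZd PG(5)[of i] elim(1) by (simp add: near_def pGX)
    then have "\<kappa> (r i) * D2 (X i) (Z i) < D2 (G (X i)) (G (Z i))"
      using bad'[of "G (Z i)" "r i"] zs(1)[of "r i"] by (simp add: X_def Z_def)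
    moreover have "D2 (X i) (Z i) = (t i)\<^sup>2 * Qc c (X i) (V i) (V i)"
      by (simp only: D2_def pX prod.case ZXV Qc_scale[OF P(1,4)])
    moreover have "D2 (G (X i)) (G (Z i)) = (t i)\<^sup>2 * Qc d (G (X i)) (u i) (u i)"
      by (simp only: D2_def pGX prod.case GZX Qc_scale[OF PG(1,4)])
    ultimately have "(t i)\<^sup>2 * (\<kappa> (r i) * Qc c (X i) (V i) (V i)) < (t i)\<^sup>2 * Qc d (G (X i)) (u i) (u i)"
      by (simp add: mult.left_commute)
    then show ?case using t0[of i] by simp
  qed
  have "\<kappa> \<longlonglongrightarrow> 1" unfolding \<kappa>_def[abs_def] by (rule LIMSEQ_n_over_Suc_n)
  then have "(\<lambda>i. \<kappa> (r i)) \<longlonglongrightarrow> 1" using LIMSEQ_subseq_LIMSEQ[OF _ mono] by (simp add: o_def)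
  then have L: "(\<lambda>i. \<kappa> (r i) * Qc c (X i) (V i) (V i)) \<longlonglongrightarrow> 1 * Qc c x v0 v0"
    by (intro tendsto_mult Qc_tendsto[OF P(1) x P(4) Xlim Vlim Vlim])
  have R: "(\<lambda>i. Qc d (G (X i)) (u i) (u i)) \<longlonglongrightarrow> Qc d (G x) u0 u0"
    by (rule Qc_tendsto[OF PG(1) Gx PG(4) GXlim ulim ulim])
  \<comment> \<open>In the limit the counterexamples say that the derivative of \<open>G\<close>
    does not shrink the unstable vector \<open>W\<close>, against strict contraction.\<close>
  have "1 * Qc c x v0 v0 \<le> Qc d (G x) u0 u0"
    by (rule tendsto_le[OF trivial_limit_sequentially R L ev])
  then show False using less by simp
qed

end

section \<open>Periodicity\<close>

lemma funpow_left_inverse: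
  assumes h: "\<And>x. x \<in> X \<Longrightarrow> h x \<in> X" and kh: "\<And>x. x \<in> X \<Longrightarrow> k (h x) = x" and x: "x \<in> X"
  shows "(k ^^ n) ((h ^^ n) x) = x"
proof (induction n)
  case (Suc n)
  have "(h ^^ n) x \<in> X" by (induction n) (simp_all add: h x)
  then have "(k ^^ Suc n) ((h ^^ Suc n) x) = (k ^^ n) ((h ^^ n) x)"
    by (simp only: funpow_Suc_right[of n k] funpow.simps(2)[of n h] o_apply kh)
  then show ?case using Suc by simp
qed simp

context ph_system
begin

lemma funpow_in: "x \<in> topspace M \<Longrightarrow> (f ^^ n) x \<in> topspace M" "x \<in> topspace M \<Longrightarrow> (G ^^ n) x \<in> topspace M"
  by (induction n) (auto intro: f_in G_in)

lemma funpow_f_continuous: "continuous_map M M (f ^^ n)"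
  and funpow_G_continuous: "continuous_map M M (G ^^ n)"
  by (induction n) (auto simp del: funpow.simps simp: funpow.simps(1) funpow_Suc_right id_def[symmetric]
    intro: continuous_map_compose f_continuous G_continuous)

lemma G_f_funpow: "x \<in> topspace M \<Longrightarrow> (G ^^ n) ((f ^^ n) x) = x"
  by (rule funpow_left_inverse[where X="topspace M"]) (simp_all add: f_in G_f)

lemma f_G_funpow: "x \<in> topspace M \<Longrightarrow> (f ^^ n) ((G ^^ n) x) = x"
  by (rule funpow_left_inverse[where X="topspace M"]) (simp_all add: G_in f_G)

lemma f_G_commute: "x \<in> topspace M \<Longrightarrow> (f ^^ k) ((G ^^ n) x) = (G ^^ n) ((f ^^ k) x)"
proof (induction k)
  case (Suc k)
  have 1: "f ((G ^^ n) y) = (G ^^ n) (f y)" if y: "y \<in> topspace M" for y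
  proof (cases n)
    case (Suc m)
    have "(G ^^ n) (f y) = (G ^^ m) y" by (simp del: funpow.simps(2) add: Suc funpow_Suc_right G_f[OF y])
    moreover have "f ((G ^^ n) y) = (G ^^ m) y" using funpow_in(2)[OF y, of m] by (simp add: Suc f_G)
    ultimately show ?thesis by simp
  qed simp
  show ?case using Suc 1[OF funpow_in(1)[OF Suc.prems, of k]] by simp
qed simp

lemma cs_set_funpow:
  assumes "cs_set T"
  shows "cs_set ((f ^^ n) ` T)" "cs_set ((G ^^ n) ` T)"
proof -
  have image: "(h ^^ Suc n) ` T = h ` (h ^^ n) ` T" for h and n by (simp add: image_comp)
  show "cs_set ((f ^^ n) ` T)"
    by (induction n) (use assms in \<open>simp_all only: image cs_set_f funpow_0 image_ident\<close>)
  show "cs_set ((G ^^ n) ` T)"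
    by (induction n) (use assms in \<open>simp_all only: image cs_set_G funpow_0 image_ident\<close>)
qed

text \<open>Plays the role of total boundedness. Points in a common member are close in both orders,
  which makes up for the asymmetry of \<open>near\<close> and \<open>D2\<close>.\<close>

lemma finite_near_cover:
  assumes "\<epsilon> > 0"
  shows "\<exists>\<W>. finite \<W> \<and> topspace M \<subseteq> \<Union>\<W> \<and> (\<forall>W\<in>\<W>. \<forall>x\<in>W. \<forall>y\<in>W. near x y \<and> D2 x y < \<epsilon>)"
proof -
  define \<U> where "\<U> = {W. openin M W \<and> (\<forall>x\<in>W. \<forall>y\<in>W. near x y \<and> D2 x y < \<epsilon>)}"
  have "\<forall>U\<in>\<U>. openin M U" by (simp add: \<U>_def)
  moreover have "topspace M \<subseteq> \<Union>\<U>" using near_neighbourhood[OF _ assms] unfolding \<U>_def by blast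
  ultimately obtain F where "finite F" "F \<subseteq> \<U>" "topspace M \<subseteq> \<Union>F"
    using compact_M unfolding compact_space_alt by meson
  then show ?thesis by (intro exI[of _ F]) (auto simp: \<U>_def)
qed

theorem cs_set_periodic:
  assumes T: "cs_set T"
  shows "\<exists>k\<ge>1. (f ^^ k) ` T = T"
proof -
  have TM: "T \<subseteq> topspace M" and Tcl: "closedin M T"
    using T compactin_subset_topspace compactin_imp_closedin[OF Hausdorff_M] unfolding cs_set_def by blast+
  obtain \<epsilon> \<kappa> where \<epsilon>: "\<epsilon> > 0" and \<kappa>: "\<kappa> \<ge> 0" "\<kappa> < 1"
    and contract: "\<And>x U y. x \<in> topspace M \<Longrightarrow> cs_set U \<Longrightarrow> y \<in> U \<Longrightarrow> near x y \<Longrightarrow> D2 x y < \<epsilon> \<Longrightarrow>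
       \<exists>y'\<in>G ` U. near (G x) y' \<and> D2 (G x) y' \<le> \<kappa> * D2 x y"
    using distance_contracted by (elim exE conjE) blast
  \<comment> \<open>Distances never leave the range below \<open>\<epsilon>\<close>, since powers of
    \<open>\<kappa>\<close> are at most 1, and the sets stay of the type \<open>cs_set\<close>;
    hence the same two constants serve at every step.\<close>
  have iterate: "\<exists>y'\<in>(G ^^ j) ` U. near ((G ^^ j) x) y' \<and> D2 ((G ^^ j) x) y' \<le> \<kappa> ^ j * \<epsilon>"
    if x: "x \<in> topspace M" and U: "cs_set U" and y: "y \<in> U" "near x y" "D2 x y < \<epsilon>" for x U y j
  proof -
    have "\<exists>y'\<in>(G ^^ j) ` U. near ((G ^^ j) x) y' \<and> D2 ((G ^^ j) x) y' \<le> \<kappa> ^ j * D2 x y"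
    proof (induction j)
      case 0
      then show ?case using y by auto
    next
      case (Suc j)
      then obtain y' where y': "y' \<in> (G ^^ j) ` U" "near ((G ^^ j) x) y'" "D2 ((G ^^ j) x) y' \<le> \<kappa> ^ j * D2 x y" by blast
      have "\<kappa> ^ j * D2 x y \<le> 1 * D2 x y"
        using \<kappa> D2_nonneg[OF x, of y] by (intro mult_right_mono power_le_one) auto
      then have "D2 ((G ^^ j) x) y' < \<epsilon>" using y'(3) y(3) by linarith
      from contract[OF funpow_in(2)[OF x] cs_set_funpow(2)[OF U] y'(1,2) this]
      obtain z where z: "z \<in> G ` (G ^^ j) ` U" "near (G ((G ^^ j) x)) z" "D2 (G ((G ^^ j) x)) z \<le> \<kappa> * D2 ((G ^^ j) x) y'" by blast
      have "\<kappa> * D2 ((G ^^ j) x) y' \<le> \<kappa> ^ Suc j * D2 x y" using mult_left_mono[OF y'(3) \<kappa>(1)] by (simp add: mult.assoc)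
      then show ?case using z by (intro bexI[of _ z]) (auto simp: image_comp)
    qed
    moreover have "\<kappa> ^ j * D2 x y \<le> \<kappa> ^ j * \<epsilon>" using \<kappa>(1) y(3) by (intro mult_left_mono) auto
    ultimately show ?thesis using order_trans by blast
  qed
  define S where "S n = (f ^^ n) ` T" for n
  have S: "cs_set (S n)" "S n \<subseteq> topspace M" for n
    using cs_set_funpow(1)[OF T] TM funpow_in(1) by (auto simp: S_def)
  obtain \<W> where \<W>: "finite \<W>" "topspace M \<subseteq> \<Union>\<W>"
    and small: "\<forall>W\<in>\<W>. \<forall>x\<in>W. \<forall>y\<in>W. near x y \<and> D2 x y < \<epsilon>"
    using finite_near_cover[OF \<epsilon>] by (elim exE conjE)
  \<comment> \<open>There are only finitely many such patterns, so infinitely many iterates share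
    one; sets with equal patterns are close in both directions.\<close>
  define C where "C n = {W \<in> \<W>. W \<inter> S n \<noteq> {}}" for n
  have "finite (range C)" by (rule finite_subset[of _ "Pow \<W>"]) (auto simp: C_def \<W>(1))
  then obtain n0 where "infinite {n. C n = C n0}"
    using pigeonhole_infinite[OF infinite_UNIV_nat, of C] by auto
  from infinite_enumerate[OF this] obtain e :: "nat \<Rightarrow> nat" where e: "strict_mono e" "\<And>j. C (e j) = C n0" by auto
  have close: "\<exists>y\<in>S n. near x y \<and> D2 x y < \<epsilon>" if "C m = C n" "x \<in> S m" for m n x
  proof -
    obtain W where W: "W \<in> \<W>" "x \<in> W" using \<W>(2) S(2) \<open>x \<in> S m\<close> by blast
    then have "W \<in> C m" using \<open>x \<in> S m\<close> by (auto simp: C_def)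
    then have "W \<in> C n" using \<open>C m = C n\<close> by simp
    then obtain y where "y \<in> W" "y \<in> S n" by (auto simp: C_def)
    then show ?thesis using small W by blast
  qed
  have "(\<lambda>j. \<kappa> ^ j * \<epsilon>) \<longlonglongrightarrow> 0 * \<epsilon>" using \<kappa> by (intro tendsto_intros LIMSEQ_power_zero) auto
  from LIMSEQ_subseq_LIMSEQ[OF this e(1)] have small0: "(\<lambda>j. \<kappa> ^ e j * \<epsilon>) \<longlonglongrightarrow> 0" by (simp add: o_def)
  have D0: "(\<lambda>j. D2 (xs j) (ys j)) \<longlonglongrightarrow> 0"
    if "\<And>j. xs j \<in> topspace M" "\<And>j. D2 (xs j) (ys j) \<le> \<kappa> ^ e j * \<epsilon>" for xs ys
    by (rule tendsto_sandwich[OF _ _ tendsto_const small0]) (simp_all add: that D2_nonneg)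
  \<comment> \<open>Abstracted over \<open>H\<close> to serve twice: with \<open>f ^^ k\<close> from
    \<open>a\<close> to \<open>b\<close>, and with \<open>G ^^ k\<close> back.\<close>
  have key: "H ` T \<subseteq> T"
    if a: "C a = C n0" and b: "C b = C n0" and H: "continuous_map M M H"
      and HS: "\<And>n y. y \<in> S a \<Longrightarrow> H ((G ^^ n) y) \<in> (G ^^ n) ` S b" for a b H
  proof
    fix z' assume "z' \<in> H ` T"
    then obtain z where z: "z \<in> T" "z' = H z" by blast
    then have zM: "z \<in> topspace M" using TM by blast
    \<comment> \<open>A point \<open>z\<close> of \<open>T\<close> is \<open>G ^^ e j\<close> of a
      point of \<open>S (e j)\<close>, and the latter is close to \<open>S a\<close>. Pulling back
      makes \<open>z\<close> a limit of points of the pulled-back sets.\<close>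
    have "\<exists>u\<in>(G ^^ e j) ` S a. near z u \<and> D2 z u \<le> \<kappa> ^ e j * \<epsilon>" for j
    proof -
      have x: "(f ^^ e j) z \<in> S (e j)" using z by (simp add: S_def)
      obtain y where y: "y \<in> S a" "near ((f ^^ e j) z) y" "D2 ((f ^^ e j) z) y < \<epsilon>"
        using close[OF _ x, of a] a e(2) by metis
      show ?thesis using iterate[OF funpow_in(1)[OF zM] S(1) y, of "e j"] by (simp add: G_f_funpow[OF zM])
    qed
    then obtain u where u: "\<And>j. u j \<in> (G ^^ e j) ` S a" "\<And>j. near z (u j)" "\<And>j. D2 z (u j) \<le> \<kappa> ^ e j * \<epsilon>"
      by metis
    obtain r where r: "strict_mono (r::nat \<Rightarrow> nat)" "limitin M (u \<circ> r) z sequentially"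
      using near_limitin[of "\<lambda>_. z" u z, OF zM u(2) D0[OF zM u(3)]] zM by auto
    \<comment> \<open>The same comparison in the other direction: \<open>H\<close> moves the
      approximations into the pulled-back \<open>S b\<close>, and pulling back the closeness of
      \<open>S b\<close> to \<open>S (e j)\<close> yields points of \<open>T\<close>.\<close>
    have "\<exists>w\<in>T. near (H (u j)) w \<and> D2 (H (u j)) w \<le> \<kappa> ^ e j * \<epsilon>" for j
    proof -
      obtain y where "y \<in> S a" "u j = (G ^^ e j) y" using u(1)[of j] by blast
      then have "H (u j) \<in> (G ^^ e j) ` S b" using HS by simp
      then obtain v where v: "v \<in> S b" "H (u j) = (G ^^ e j) v" by blast
      obtain y where y: "y \<in> S (e j)" "near v y" "D2 v y < \<epsilon>"
        using close[OF _ v(1), of "e j"] b e(2) by metis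
      have vM: "v \<in> topspace M" using v(1) S(2) by blast
      have "(G ^^ e j) ` S (e j) = (\<lambda>x. x) ` T"
        unfolding S_def image_image by (rule image_cong[OF refl]) (use TM G_f_funpow in blast)
      then show ?thesis using iterate[OF vM S(1) y, of "e j"] v(2) by simp
    qed
    then obtain w where w: "\<And>j. w j \<in> T" "\<And>j. near (H (u j)) (w j)" "\<And>j. D2 (H (u j)) (w j) \<le> \<kappa> ^ e j * \<epsilon>"
      by metis
    have HuM: "H (u j) \<in> topspace M" for j
    proof -
      obtain y where "y \<in> S a" "u j = (G ^^ e j) y" using u(1)[of j] by blast
      then have "u j \<in> topspace M" using funpow_in(2)[OF subsetD[OF S(2)]] by simp
      then show ?thesis using H unfolding continuous_map_def by auto
    qed
    \<comment> \<open>Continuity of \<open>H\<close> joins the two approximations: the points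
      \<open>w\<close> of \<open>T\<close> subconverge to \<open>H z\<close>, and \<open>T\<close>
      is closed.\<close>
    have "limitin M (\<lambda>j. H (u (r j))) (H z) sequentially"
      using continuous_map_limit[OF H r(2)] by (simp add: o_def)
    from near_limitin[of "\<lambda>j. H (u (r j))" "\<lambda>j. w (r j)", OF HuM w(2) _ this]
    obtain r' where "limitin M (\<lambda>j. w (r (r' j))) (H z) sequentially"
      using LIMSEQ_subseq_LIMSEQ[OF D0[of "\<lambda>j. H (u j)" w, OF HuM w(3)] r(1)] by (auto simp: o_def)
    then show "z' \<in> T" unfolding z(2)
      by (rule limitin_closedin[OF _ Tcl always_eventually trivial_limit_sequentially]) (simp add: w(1))
  qed
  define a b where "a = e 0" and "b = e 1"
  have "a < b" using e(1) by (simp add: a_def b_def strict_mono_def)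
  define k where "k = b - a"
  have k: "k \<ge> 1" "b = k + a" using \<open>a < b\<close> by (auto simp: k_def)
  have Sb: "S b = (f ^^ k) ` S a" by (simp add: S_def k(2) funpow_add image_comp)
  have f_sub: "(f ^^ k) ` T \<subseteq> T"
  proof (rule key[of a b])
    fix n y assume y: "y \<in> S a"
    then have "(f ^^ k) ((G ^^ n) y) = (G ^^ n) ((f ^^ k) y)" using S(2) by (intro f_G_commute) blast
    then show "(f ^^ k) ((G ^^ n) y) \<in> (G ^^ n) ` S b" using y by (simp add: Sb)
  qed (simp_all add: a_def b_def e funpow_f_continuous)
  \<comment> \<open>Exchanging the roles of \<open>a\<close> and \<open>b\<close> gives invariance
    under the inverse iterate, which upgrades inclusion to equality.\<close>
  have "(G ^^ k) ` T \<subseteq> T"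
  proof (rule key[of b a])
    fix n y assume "y \<in> S b"
    then obtain y' where y': "y' \<in> S a" "y = (f ^^ k) y'" using Sb by blast
    have "(G ^^ k) ((G ^^ n) y) = (G ^^ n) ((G ^^ k) y)" by (simp add: add.commute flip: funpow_add[THEN fun_cong, unfolded o_def])
    also have "(G ^^ k) y = y'" using y' S(2) by (auto intro: G_f_funpow)
    finally show "(G ^^ k) ((G ^^ n) y) \<in> (G ^^ n) ` S a" using y'(1) by simp
  qed (simp_all add: a_def b_def e funpow_G_continuous)
  have "T \<subseteq> (f ^^ k) ` T"
  proof
    fix z assume z: "z \<in> T"
    then have "(G ^^ k) z \<in> T" using \<open>(G ^^ k) ` T \<subseteq> T\<close> by blast
    moreover have "(f ^^ k) ((G ^^ k) z) = z" using z TM by (intro f_G_funpow) blast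
    ultimately show "z \<in> (f ^^ k) ` T" by (metis imageI)
  qed
  with f_sub have "(f ^^ k) ` T = T" by (rule equalityI)
  then show ?thesis using k(1) by blast
qed

end

theorem theorem2p2:
  fixes M :: "'m topology" and A :: "('m, 'e::euclidean_space) chart set"
    and g :: "'m \<Rightarrow> ('m, 'e) tvec \<Rightarrow> ('m, 'e) tvec \<Rightarrow> real"
    and f :: "'m \<Rightarrow> 'm"
    and Es Ec Eu :: "'m \<Rightarrow> ('m, 'e) tvec set"
    and S :: "'m topology" and B :: "('m, 'd::euclidean_space) chart set"
  assumes "closed_connected_manifold M A"
    and "riemannian_metric M A g"
    and "partially_hyperbolic M A g f Es Ec Eu"
    and "center_stable_submanifold M A Es Ec S B"
    and "compact_space S"
  shows "\<exists>k\<ge>1. (f ^^ k) ` topspace S = topspace S"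
proof -
  interpret ph_system M A g f Es Ec Eu by (rule ph_system.intro[OF assms(1-3)])
  show ?thesis by (rule cs_set_periodic[OF cs_set_submanifold[OF assms(4,5)]])
qed

end
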